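(* Let $Y=\mathbb{P}^1\times\mathbb{P}^1$ and $L=\mathcal{O}_Y(e_1,e_2)$ with integers $e_1,e_2\geq 1$. Let $r\ge 9$ be an integer and suppose that $\frac{e_2}{e_1}\notin[\beta_r,\alpha_r]$. (Odd case) If $r$ is odd, $r\geq 9$, then $$\epsilon_r(L)=\begin{cases} e_2 & \text{if } \frac{e_2}{e_1}\leq \frac{2}{r+1},\\[1mm] \frac{2e_1+(r-1)e_2}{2r} & \text{if } \frac{e_2}{e_1}\in[\frac{2}{r+1},\beta_r],\\[1mm] \frac{(r-1)e_1+2e_2}{2r} & \text{if } \frac{e_2}{e_1}\in[\alpha_r,\frac{r+1}{2}],\\[1mm] e_1 & \text{if } \frac{r+1}{2}\leq\frac{e_2}{e_1}.\end{cases}$$ (Even case) If $r$ is even, $r\geq 10$, put $v_L=(e_1,e_2,-\eta_r(L))\in V_r$ and $n=\lfloor \varphi_r(v_L)+\frac12\rfloor$, where $\lfloor x\rfloor$ is the largest integer $\leq x$. Then $$\epsilon_r(L)=\frac{e_1\,p_{n,r}+e_2\,p_{n-1,r}}{r\,m_{n,r}}.$$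
   Context: Work over $\mathbb{C}$. Let $\pi\colon X\to Y=\mathbb{P}^1\times\mathbb{P}^1$ be the blowup at $r$ very general points, with exceptional divisors $E_1,\dots,E_r$ and $E=\sum_{i=1}^r E_i$. For an ample line bundle $L$ on $Y$, the $r$-point Seshadri constant is $\epsilon_r(L)=\sup\{\gamma\geq 0 : \pi^*L-\gamma E \text{ is nef}\}$. $\alpha_r=\frac{(r-4)+\sqrt{r(r-8)}}{4}$ and $\beta_r=\frac{(r-4)-\sqrt{r(r-8)}}{4}$ are the roots of $t^2-\frac{r-4}{2}t+1=0$. $F_1,F_2$ are the pullbacks to $X$ of the classes of $\mathcal{O}_Y(1,0)$ and $\mathcal{O}_Y(0,1)$, and $V_r\subset H^2(X,\mathbb{R})$ is the span of $F_1,F_2,E$. The triple $(a,b,c)$ denotes $aF_1+bF_2+cE$. The intersection form on $V_r$ is given by $F_1^2=F_2^2=0$, $F_1\cdot F_2=1$, $F_i\cdot E=0$, $E^2=-r$. $\eta_r(L)=\sqrt{2e_1e_2/r}$. $v_{\alpha_r}=\left(\frac{1}{\alpha_r+1},\frac{\alpha_r}{\alpha_r+1},-\frac2r\right)$ and $v_{\beta_r}=\left(\frac{\alpha_r}{\alpha_r+1},\frac{1}{\alpha_r+1},-\frac2r\right)$. For $v\in V_r$ with $v^2=0$, not a multiple of $v_{\alpha_r}$ or $v_{\beta_r}$, $$\varphi_r(v)=\frac{\log\left(\frac{v\cdot v_{\beta_r}}{v\cdot v_{\alpha_r}}\right)}{2\log\alpha_r}.$$ The sequences $\{p_{n,r}\}_{n\in\mathbb{Z}}$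 and $\{m_{n,r}\}_{n\in\mathbb{Z}}$ are determined by $p_{-1,r}=0,\ p_{0,r}=0,\ p_{1,r}=r$ and $m_{-1,r}=1,\ m_{0,r}=-1,\ m_{1,r}=1$, each satisfying, for all $n\in\mathbb{Z}$, the recursion $s_{n,r}=\frac{r-2}{2}(s_{n-1,r}-s_{n-2,r})+s_{n-3,r}$. *)

theory Defs
  imports
    Complex_Main
    "HOL-Library.Countable_Set"
    "HOL-Computational_Algebra.Computational_Algebra"
begin

section \<open>Curves on the product of two projective lines\<close>

text \<open>
  A point of \<open>Y = P1 x P1\<close> is given by homogeneous coordinates \<open>([x0 : x1], [y0 : y1])\<close>, that is, by
  a pair of nonzero vectors of \<open>C^2\<close>.  All notions below depend only on the point, not on the choice
  of coordinates.  An \<open>r\<close>-tuple of points is a function on \<open>nat\<close> of which only the values at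
  \<open>i < r\<close> are used.
\<close>

type_synonym ypoint = "(complex \<times> complex) \<times> (complex \<times> complex)"

definition ypoints :: "nat \<Rightarrow> (nat \<Rightarrow> ypoint) set" where
  "ypoints r = {P. \<forall>i<r. fst (P i) \<noteq> (0, 0) \<and> snd (P i) \<noteq> (0, 0)}"

text \<open>
  The polynomial ring \<open>C[x0][x1][y0][y1]\<close>; the innermost variable is \<open>x0\<close>, the outermost \<open>y1\<close>.
\<close>

type_synonym poly4 = "complex poly poly poly poly"

definition coeff4 :: "poly4 \<Rightarrow> nat \<Rightarrow> nat \<Rightarrow> nat \<Rightarrow> nat \<Rightarrow> complex" where
  "coeff4 F i j k l = coeff (coeff (coeff (coeff F l) k) j) i"

definition eval4 :: "poly4 \<Rightarrow> ypoint \<Rightarrow> complex" where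
  "eval4 F q = (case q of ((x0, x1), (y0, y1)) \<Rightarrow>
     poly (poly (poly (poly F [:[:[:y1:]:]:]) [:[:y0:]:]) [:x1:]) x0)"

definition bihomogeneous :: "nat \<Rightarrow> nat \<Rightarrow> poly4 \<Rightarrow> bool" where
  "bihomogeneous a b F \<longleftrightarrow> (\<forall>i j k l. coeff4 F i j k l \<noteq> 0 \<longrightarrow> i + j = a \<and> k + l = b)"

text \<open>The partial derivative taken \<open>i, j, k, l\<close> times with respect to \<open>x0, x1, y0, y1\<close>.\<close>

definition partial4 :: "nat \<Rightarrow> nat \<Rightarrow> nat \<Rightarrow> nat \<Rightarrow> poly4 \<Rightarrow> poly4" where
  "partial4 i j k l F =
     ((map_poly (map_poly (map_poly pderiv))) ^^ i)
       (((map_poly (map_poly pderiv)) ^^ j)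
         (((map_poly pderiv) ^^ k)
           ((pderiv ^^ l) F)))"

text \<open>
  The multiplicity at \<open>q\<close> of the curve \<open>F = 0\<close>, for a nonzero bihomogeneous \<open>F\<close>.  It may be computed
  upstairs as the order of vanishing of \<open>F\<close> at homogeneous coordinates of \<open>q\<close>: the projection of
  \<open>(C^2 - 0) x (C^2 - 0)\<close> to \<open>Y\<close> is a smooth map, and up to a unit \<open>F\<close> is the pullback of a local
  equation of the curve.
\<close>

definition multiplicity_at :: "poly4 \<Rightarrow> ypoint \<Rightarrow> nat" where
  "multiplicity_at F q =
     (LEAST m. \<exists>i j k l. i + j + k + l = m \<and> eval4 (partial4 i j k l F) q \<noteq> 0)"


section \<open>Very general points\<close>

inductive polyfun :: "nat \<Rightarrow> ((nat \<Rightarrow> ypoint) \<Rightarrow> complex) \<Rightarrow> bool" for r where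
  const: "polyfun r (\<lambda>P. c)"
| x0: "i < r \<Longrightarrow> polyfun r (\<lambda>P. fst (fst (P i)))"
| x1: "i < r \<Longrightarrow> polyfun r (\<lambda>P. snd (fst (P i)))"
| y0: "i < r \<Longrightarrow> polyfun r (\<lambda>P. fst (snd (P i)))"
| y1: "i < r \<Longrightarrow> polyfun r (\<lambda>P. snd (snd (P i)))"
| add: "polyfun r f \<Longrightarrow> polyfun r g \<Longrightarrow> polyfun r (\<lambda>P. f P + g P)"
| mult: "polyfun r f \<Longrightarrow> polyfun r g \<Longrightarrow> polyfun r (\<lambda>P. f P * g P)"

definition rescale :: "complex \<Rightarrow> complex \<Rightarrow> ypoint \<Rightarrow> ypoint" where
  "rescale s t q = (case q of ((x0, x1), (y0, y1)) \<Rightarrow> ((s * x0, s * x1), (t * y0, t * y1)))"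

text \<open>
  Polynomials in the \<open>4 r\<close> coordinates that are homogeneous in each of the \<open>2 r\<close> pairs of variables.
  As the base field is infinite, polynomials may be identified with polynomial functions.
\<close>

definition multihomogeneous :: "nat \<Rightarrow> ((nat \<Rightarrow> ypoint) \<Rightarrow> complex) \<Rightarrow> bool" where
  "multihomogeneous r f \<longleftrightarrow> polyfun r f \<and>
     (\<exists>a b :: nat \<Rightarrow> nat. \<forall>s t P.
        f (\<lambda>i. rescale (s i) (t i) (P i)) = (\<Prod>i<r. s i ^ a i * t i ^ b i) * f P)"

definition zariski_closed :: "nat \<Rightarrow> (nat \<Rightarrow> ypoint) set \<Rightarrow> bool" where
  "zariski_closed r Z \<longleftrightarrow>
     (\<exists>S. (\<forall>f\<in>S. multihomogeneous r f) \<and> Z = {P \<in> ypoints r. \<forall>f\<in>S. f P = 0})"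

text \<open>
  \<open>Q\<close> holds for \<open>r\<close> very general points of \<open>Y\<close>: it holds off a countable union of proper closed
  subvarieties of \<open>Y^r\<close>.
\<close>

definition very_general :: "nat \<Rightarrow> ((nat \<Rightarrow> ypoint) \<Rightarrow> bool) \<Rightarrow> bool" where
  "very_general r Q \<longleftrightarrow>
     (\<exists>\<Z>. countable \<Z> \<and> (\<forall>Z\<in>\<Z>. zariski_closed r Z \<and> Z \<noteq> ypoints r) \<and>
          (\<forall>P \<in> ypoints r - \<Union>\<Z>. Q P))"


section \<open>The blowup: divisor classes, nefness, Seshadri constants\<close>

text \<open>
  For the blowup \<open>X\<close> of \<open>Y\<close> at distinct points \<open>P 0, ..., P (r - 1)\<close>, the real vector space
  \<open>H^2(X, R)\<close> has basis \<open>F1, F2, E_0, ..., E_(r-1)\<close>.  The class with coordinates \<open>(a, b, c)\<close> is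
  \<open>a F1 + b F2 + (sum over i < r of c i E_i)\<close>.
\<close>

type_synonym xclass = "real \<times> real \<times> (nat \<Rightarrow> real)"

definition intersection :: "nat \<Rightarrow> xclass \<Rightarrow> xclass \<Rightarrow> real" where
  "intersection r D D' = (case (D, D') of ((a, b, c), (a', b', c')) \<Rightarrow>
     a * b' + b * a' - (\<Sum>i<r. c i * c' i))"

text \<open>The element \<open>a F1 + b F2 + c E\<close> of the subspace \<open>V_r\<close>, where \<open>E\<close> is the sum of the \<open>E_i\<close>.\<close>

definition triple :: "real \<Rightarrow> real \<Rightarrow> real \<Rightarrow> xclass" where
  "triple a b c = (a, b, \<lambda>i. c)"

text \<open>
  The irreducible curves on \<open>X\<close> are the exceptional curves \<open>E_i\<close> and the strict transforms of the
  irreducible curves \<open>C\<close> of \<open>Y\<close>.  The latter are the zero sets of irreducible bihomogeneous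
  polynomials, and the class of the strict transform is the pullback of the class of \<open>C\<close> minus
  the sum of the \<open>mult_(P i)(C) E_i\<close>.
\<close>

inductive_set curve_classes :: "nat \<Rightarrow> (nat \<Rightarrow> ypoint) \<Rightarrow> xclass set" for r P where
  exceptional: "i < r \<Longrightarrow> (0, 0, \<lambda>j. if j = i then 1 else 0) \<in> curve_classes r P"
| strict_transform: "irreducible F \<Longrightarrow> bihomogeneous a b F \<Longrightarrow>
    (real a, real b, \<lambda>i. - real (multiplicity_at F (P i))) \<in> curve_classes r P"

definition nef :: "nat \<Rightarrow> (nat \<Rightarrow> ypoint) \<Rightarrow> xclass \<Rightarrow> bool" where
  "nef r P D \<longleftrightarrow> (\<forall>C \<in> curve_classes r P. intersection r D C \<ge> 0)"

text \<open>The \<open>r\<close>-point Seshadri constant of \<open>O_Y(e1, e2)\<close> at the points \<open>P 0, ..., P (r - 1)\<close>.\<close>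

definition seshadri :: "nat \<Rightarrow> (nat \<Rightarrow> ypoint) \<Rightarrow> int \<Rightarrow> int \<Rightarrow> real" where
  "seshadri r P e1 e2 =
     Sup {\<gamma>. \<gamma> \<ge> 0 \<and> nef r P (triple (real_of_int e1) (real_of_int e2) (- \<gamma>))}"


section \<open>The numerical data\<close>

definition alpha :: "nat \<Rightarrow> real" where
  "alpha r = ((real r - 4) + sqrt (real r * (real r - 8))) / 4"

definition beta :: "nat \<Rightarrow> real" where
  "beta r = ((real r - 4) - sqrt (real r * (real r - 8))) / 4"

definition eta :: "nat \<Rightarrow> int \<Rightarrow> int \<Rightarrow> real" where
  "eta r e1 e2 = sqrt (2 * real_of_int e1 * real_of_int e2 / real r)"

definition v_L :: "nat \<Rightarrow> int \<Rightarrow> int \<Rightarrow> xclass" where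
  "v_L r e1 e2 = triple (real_of_int e1) (real_of_int e2) (- eta r e1 e2)"

definition v_alpha :: "nat \<Rightarrow> xclass" where
  "v_alpha r = triple (1 / (alpha r + 1)) (alpha r / (alpha r + 1)) (- 2 / real r)"

definition v_beta :: "nat \<Rightarrow> xclass" where
  "v_beta r = triple (alpha r / (alpha r + 1)) (1 / (alpha r + 1)) (- 2 / real r)"

definition phi :: "nat \<Rightarrow> xclass \<Rightarrow> real" where
  "phi r v = ln (intersection r v (v_beta r) / intersection r v (v_alpha r)) / (2 * ln (alpha r))"

text \<open>
  The two-sided sequence with values \<open>a, b, c\<close> at \<open>-1, 0, 1\<close> satisfying
  \<open>s n = (r - 2) / 2 * (s (n - 1) - s (n - 2)) + s (n - 3)\<close> for all integers \<open>n\<close>; for \<open>n < -1\<close> the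
  recursion is run backwards.
\<close>

function rec_seq :: "real \<Rightarrow> real \<Rightarrow> real \<Rightarrow> nat \<Rightarrow> int \<Rightarrow> real" where
  "rec_seq a b c r n =
     (if n = - 1 then a else if n = 0 then b else if n = 1 then c
      else if n > 1 then
        (real r - 2) / 2 * (rec_seq a b c r (n - 1) - rec_seq a b c r (n - 2)) + rec_seq a b c r (n - 3)
      else
        rec_seq a b c r (n + 3) - (real r - 2) / 2 * (rec_seq a b c r (n + 2) - rec_seq a b c r (n + 1)))"
  by pat_completeness auto
termination
  by (relation "measure (\<lambda>(a, b, c, r, n). nat \<bar>n\<bar>)") auto

declare rec_seq.simps [simp del]

definition p_seq :: "nat \<Rightarrow> int \<Rightarrow> real" where
  "p_seq r = rec_seq 0 0 (real r) r"

definition m_seq :: "nat \<Rightarrow> int \<Rightarrow> real" where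
  "m_seq r = rec_seq 1 (- 1) 1 r"

lemma rec_seq_recursion:
  "rec_seq a b c r n =
     (real r - 2) / 2 * (rec_seq a b c r (n - 1) - rec_seq a b c r (n - 2)) + rec_seq a b c r (n - 3)"
proof (cases "n > 1")
  case True
  then show ?thesis by (subst rec_seq.simps) simp
next
  case False
  have "rec_seq a b c r (n - 3) =
      rec_seq a b c r n - (real r - 2) / 2 * (rec_seq a b c r (n - 1) - rec_seq a b c r (n - 2))"
    using False by (subst rec_seq.simps) simp
  then show ?thesis by simp
qed

lemma rec_seq_initial:
  "rec_seq a b c r (- 1) = a" "rec_seq a b c r 0 = b" "rec_seq a b c r 1 = c"
  by (simp_all add: rec_seq.simps)

lemma intersection_triple:
  "intersection r (triple a b c) (triple a' b' c') = a * b' + b * a' - real r * c * c'"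
  by (simp add: intersection_def triple_def)

lemma alpha_beta_roots:
  assumes "r \<ge> 8"
  shows "(alpha r)\<^sup>2 - (real r - 4) / 2 * alpha r + 1 = 0"
    and "(beta r)\<^sup>2 - (real r - 4) / 2 * beta r + 1 = 0"
proof -
  have "(sqrt (real r * (real r - 8)))\<^sup>2 = real r * (real r - 8)"
    using assms by simp
  then show "(alpha r)\<^sup>2 - (real r - 4) / 2 * alpha r + 1 = 0"
    and "(beta r)\<^sup>2 - (real r - 4) / 2 * beta r + 1 = 0"
    unfolding alpha_def beta_def by (simp_all add: power2_eq_square field_simps)
qed

end

theory Submission
  imports Defs "Jordan_Normal_Form.Determinant"
begin

text \<open>
  Call a class \<open>a F1 + b F2 - (sum of the m i E_i)\<close> always effective if it contains a curve for every position
  of the \<open>r\<close> points, general or not.  For a fixed class the positions at which it is effective form a closed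
  set (\<open>has_section_closed\<close>), and there are countably many classes.  Hence at very general points every
  effective class is always effective (\<open>very_general_effective\<close>), and the Seshadri constant of \<open>(e1, e2)\<close> is
  \<open>\<epsilon>\<close> as soon as \<open>(e1, e2) - \<epsilon> E\<close> is nonnegative on all always effective classes and zero on one whose
  multiplicities have a positive sum (\<open>seshadri_eqI\<close>).

  The set of always effective classes is stable under the exchange of the two rulings, under permutations of
  the points and under the elementary Cremona transformation at two points (\<open>always_effective_cremona\<close>).
  Indeed, a section for the transformed points can be pulled back when the points are in general position, and
  a class that is effective at general points is effective everywhere.  This symmetry gives both bounds: the
  transforms of \<open>E_i\<close> are curves that bound \<open>\<epsilon>\<close> from above, and the inequalities \<open>a \<ge> 0\<close> and \<open>b \<ge> 0\<close> for
  effective classes, transported by the group, bound it from below.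

  Let \<open>r\<close> be even.  The transformation at all points, in pairs, and the exchange of the rulings generate an
  infinite dihedral group.  The orbit of the rulings consists of isotropic classes \<open>G_n\<close>, the orbit of \<open>E\<close> has the
  coefficients \<open>p_seq\<close> and \<open>m_seq\<close>, and both are expressed by quantum integers at the square root of
  \<open>alpha r\<close>.  If \<open>n - 1/2 \<le> phi r (v_L r e1 e2) < n + 1/2\<close>, then with the asserted \<open>\<epsilon>\<close> the class \<open>(e1, e2) - \<epsilon> E\<close> is
  a nonnegative combination of \<open>G_n\<close> and \<open>G_(n+1)\<close>, and these are orthogonal to the \<open>n\<close>-th transform of \<open>E\<close>
  (\<open>seshadri_bound_even\<close>).

  Let \<open>r\<close> be odd.  A further point of multiplicity \<open>0\<close> makes the number of points even.  The transformation at all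
  of them turns classes into classes of plane curves of some degree \<open>d\<close> with multiplicities \<open>m i\<close> at \<open>r\<close> points,
  for which \<open>0 \<le> d\<close> and \<open>3 (sum of the m i) \<le> r d\<close>; the latter follows by descent along quadratic
  transformations (\<open>planar_bound\<close>).  Exchanging the rulings if necessary, let \<open>e2 / e1 > alpha r\<close>.  Then
  \<open>(e1, e2) - \<epsilon> E\<close> is a nonnegative combination of the corresponding two nef classes and \<open>F2\<close>, and the curves that
  give equality are \<open>F2 - E_i\<close> and a section through all points.
\<close>

section \<open>Polynomial functions\<close>

text \<open>
  The polynomial functions of the homogeneous coordinates of one point.  Substitution of polynomial
  functions or of arcs into \<open>f\<close> is then handled by induction on \<open>f\<close>.
\<close>

inductive pf :: "(ypoint \<Rightarrow> complex) \<Rightarrow> bool" where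
  pf_const: "pf (\<lambda>q. c)"
| pf_x0: "pf (\<lambda>q. fst (fst q))"
| pf_x1: "pf (\<lambda>q. snd (fst q))"
| pf_y0: "pf (\<lambda>q. fst (snd q))"
| pf_y1: "pf (\<lambda>q. snd (snd q))"
| pf_add: "pf f \<Longrightarrow> pf g \<Longrightarrow> pf (\<lambda>q. f q + g q)"
| pf_mult: "pf f \<Longrightarrow> pf g \<Longrightarrow> pf (\<lambda>q. f q * g q)"

lemma pf_sum: "(\<And>i. i \<in> A \<Longrightarrow> pf (f i)) \<Longrightarrow> pf (\<lambda>q. \<Sum>i\<in>A. f i q)"
  by (induction A rule: infinite_finite_induct) (auto intro: pf.intros)

lemma pf_power: "pf f \<Longrightarrow> pf (\<lambda>q. f q ^ n)"
  by (induction n) (auto intro: pf.intros)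

lemmas pf_rules = pf.intros pf_sum pf_power

lemma pf_poly1: "pf (\<lambda>q. poly p (fst (fst q)))" for p :: "complex poly"
  by (induction p) (auto intro!: pf.intros)

lemma pf_poly2: "pf (\<lambda>q. poly (poly p [:snd (fst q):]) (fst (fst q)))" for p :: "complex poly poly"
  by (induction p) (auto intro!: pf.intros pf_poly1)

lemma pf_poly3: "pf (\<lambda>q. poly (poly (poly p [:[:fst (snd q):]:]) [:snd (fst q):]) (fst (fst q)))"
  for p :: "complex poly poly poly"
  by (induction p) (auto intro!: pf.intros pf_poly2)

lemma eval4_alt: "eval4 F q = poly (poly (poly (poly F [:[:[:snd (snd q):]:]:]) [:[:fst (snd q):]:])
    [:snd (fst q):]) (fst (fst q))"
  by (simp add: eval4_def split: prod.split)

lemma pf_eval4: "pf (eval4 F)"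
  unfolding eval4_alt[abs_def]
  by (induction F) (auto intro!: pf.intros pf_poly3)

lemma eval4_add: "eval4 (F + G) q = eval4 F q + eval4 G q"
  and eval4_mult: "eval4 (F * G) q = eval4 F q * eval4 G q"
  by (simp_all add: eval4_alt)

lemma pf_imp_eval4: "pf f \<Longrightarrow> \<exists>F. f = eval4 F"
proof (induction rule: pf.induct)
  case (pf_const c)
  show ?case by (rule exI[of _ "[:[:[:[:c:]:]:]:]"]) (auto simp: eval4_alt)
next
  case pf_x0
  show ?case by (rule exI[of _ "[:[:[:[:0,1:]:]:]:]"]) (auto simp: eval4_alt)
next
  case pf_x1
  show ?case by (rule exI[of _ "[:[:[:0,1:]:]:]"]) (auto simp: eval4_alt)
next
  case pf_y0
  show ?case by (rule exI[of _ "[:[:0,1:]:]"]) (auto simp: eval4_alt)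
next
  case pf_y1
  show ?case by (rule exI[of _ "[:0,1:]"]) (auto simp: eval4_alt)
next
  case (pf_add f g)
  then obtain F G where "f = eval4 F" "g = eval4 G" by blast
  then show ?case by (intro exI[of _ "F + G"]) (auto simp: eval4_add)
next
  case (pf_mult f g)
  then obtain F G where "f = eval4 F" "g = eval4 G" by blast
  then show ?case by (intro exI[of _ "F * G"]) (auto simp: eval4_mult)
qed

lemma pf_compose:
  assumes "pf f" "pf a" "pf b" "pf c" "pf d"
  shows "pf (\<lambda>q. f ((a q, b q), (c q, d q)))"
  using assms(1) by induction (auto intro: pf.intros assms(2-))

lemma pf_imp_polyfun: "pf f \<Longrightarrow> i < r \<Longrightarrow> polyfun r (\<lambda>P. f (P i))"
  by (induction rule: pf.induct) (auto intro: polyfun.intros)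

lemma polyfun_sum: "(\<And>i. i \<in> A \<Longrightarrow> polyfun r (f i)) \<Longrightarrow> polyfun r (\<lambda>P. \<Sum>i\<in>A. f i P)"
  by (induction A rule: infinite_finite_induct) (auto intro: polyfun.intros)

lemma polyfun_prod: "(\<And>i. i \<in> A \<Longrightarrow> polyfun r (f i)) \<Longrightarrow> polyfun r (\<lambda>P. \<Prod>i\<in>A. f i P)"
  by (induction A rule: infinite_finite_induct) (auto intro: polyfun.intros)

definition interp :: "ypoint \<Rightarrow> ypoint \<Rightarrow> complex \<Rightarrow> ypoint" where
  "interp p q t =
     ((fst (fst p) + t * (fst (fst q) - fst (fst p)), snd (fst p) + t * (snd (fst q) - snd (fst p))),
      (fst (snd p) + t * (fst (snd q) - fst (snd p)), snd (snd p) + t * (snd (snd q) - snd (snd p))))"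

lemma interp_0 [simp]: "interp p q 0 = p" and interp_1 [simp]: "interp p q 1 = q"
  by (simp_all add: interp_def)

lemma polyfun_on_line:
  assumes "polyfun r f"
  shows "\<exists>h :: complex poly. \<forall>t. f (\<lambda>i. interp (P i) (Q i) t) = poly h t"
  using assms
proof induction
  case (const c)
  show ?case by (rule exI[of _ "[:c:]"]) simp
next
  case (x0 i)
  show ?case 
    by (rule exI[of _ "[:fst (fst (P i)), fst (fst (Q i)) - fst (fst (P i)):]"]) (simp add: interp_def)
next
  case (x1 i)
  show ?case 
    by (rule exI[of _ "[:snd (fst (P i)), snd (fst (Q i)) - snd (fst (P i)):]"]) (simp add: interp_def)
next
  case (y0 i)
  show ?case 
    by (rule exI[of _ "[:fst (snd (P i)), fst (snd (Q i)) - fst (snd (P i)):]"]) (simp add: interp_def)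
next
  case (y1 i)
  show ?case 
    by (rule exI[of _ "[:snd (snd (P i)), snd (snd (Q i)) - snd (snd (P i)):]"]) (simp add: interp_def)
next
  case (add f g)
  then obtain h k where "\<forall>t. f (\<lambda>i. interp (P i) (Q i) t) = poly h t" "\<forall>t. g (\<lambda>i. interp (P i) (Q i) t) = poly k t"
    by blast
  then show ?case by (intro exI[of _ "h + k"]) simp
next
  case (mult f g)
  then obtain h k where "\<forall>t. f (\<lambda>i. interp (P i) (Q i) t) = poly h t" "\<forall>t. g (\<lambda>i. interp (P i) (Q i) t) = poly k t"
    by blast
  then show ?case by (intro exI[of _ "h * k"]) simp
qed

text \<open>
  Restricted to the line joining two configurations at which they do not vanish, both functions are
  nonzero polynomials of one variable, so they have a common non-root.  This is all that is used of the
  irreducibility of the space of configurations.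
\<close>

lemma polyfun_common_nonzero:
  assumes "polyfun r f" "polyfun r g" "f P \<noteq> 0" "g Q \<noteq> 0"
  shows "\<exists>R. f R \<noteq> 0 \<and> g R \<noteq> 0"
proof -
  obtain h k where h: "\<And>t. f (\<lambda>i. interp (P i) (Q i) t) = poly h t"
    and k: "\<And>t. g (\<lambda>i. interp (P i) (Q i) t) = poly k t"
    using polyfun_on_line[OF assms(1)] polyfun_on_line[OF assms(2)] by metis
  have "h \<noteq> 0" using h[of 0] assms(3) by auto
  moreover have "k \<noteq> 0" using k[of 1] assms(4) by auto
  ultimately have "h * k \<noteq> 0" by simp
  then obtain t where "poly (h * k) t \<noteq> 0" using poly_all_0_iff_0[of "h * k"] by blast
  then have "poly h t \<noteq> 0" "poly k t \<noteq> 0" by auto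
  then show ?thesis using h k by metis
qed

lemma pf_common_nonzero:
  assumes "pf f" "pf g" "f p \<noteq> 0" "g q \<noteq> 0"
  shows "\<exists>z. f z \<noteq> 0 \<and> g z \<noteq> 0"
proof -
  have "\<exists>R. f (R (0::nat)) \<noteq> 0 \<and> g (R 0) \<noteq> 0"
    by (rule polyfun_common_nonzero[where r = 1 and f = "\<lambda>R. f (R 0)" and g = "\<lambda>R. g (R 0)" and P = "\<lambda>_. p" and Q = "\<lambda>_. q"])
      (use assms in \<open>auto intro: pf_imp_polyfun\<close>)
  then show ?thesis by blast
qed


section \<open>Monomials\<close>

type_synonym multi = "nat \<times> nat \<times> nat \<times> nat"

definition mon :: "multi \<Rightarrow> ypoint \<Rightarrow> complex" where
  "mon e q = (case (e, q) of ((i, j, k, l), ((x0, x1), (y0, y1))) \<Rightarrow> x0 ^ i * x1 ^ j * y0 ^ k * y1 ^ l)"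

definition box :: "nat \<Rightarrow> multi set" where
  "box N = {..<N} \<times> {..<N} \<times> {..<N} \<times> {..<N}"

definition coeff_at :: "poly4 \<Rightarrow> multi \<Rightarrow> complex" where
  "coeff_at F e = (case e of (i, j, k, l) \<Rightarrow> coeff4 F i j k l)"

lemma finite_box [simp]: "finite (box N)" by (simp add: box_def)

lemma pf_mon: "pf (mon e)"
proof -
  obtain i j k l where e: "e = (i, j, k, l)" by (metis prod.exhaust)
  have "mon e = (\<lambda>q. fst (fst q) ^ i * snd (fst q) ^ j * fst (snd q) ^ k * snd (snd q) ^ l)"
    by (auto simp: mon_def e fun_eq_iff)
  then show ?thesis by (auto intro!: pf_rules)
qed

lemma poly_bounded: "degree p < N \<Longrightarrow> poly p x = (\<Sum>i<N. coeff p i * x ^ i)" for p :: "'a :: comm_ring_1 poly"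
  unfolding poly_altdef
  by (rule sum.mono_neutral_left) (auto simp: coeff_eq_0 not_le)

lemma sum_box: "(\<Sum>e\<in>box N. f e) = (\<Sum>i<N. \<Sum>j<N. \<Sum>k<N. \<Sum>l<N. f (i, j, k, l))"
  unfolding box_def by (simp add: sum.cartesian_product')

text \<open>
  A common bound on the degrees at all four levels of the nested polynomial; it allows \<open>F\<close> to be
  written as a sum over a box of exponents.
\<close>

definition degrees_less :: "nat \<Rightarrow> poly4 \<Rightarrow> bool" where
  "degrees_less N F \<longleftrightarrow> degree F < N \<and> (\<forall>l. degree (coeff F l) < N) \<and> (\<forall>l k. degree (coeff (coeff F l) k) < N)
     \<and> (\<forall>l k j. degree (coeff (coeff (coeff F l) k) j) < N)"

lemma uniform_degree_bound:
  fixes F :: "'a :: zero poly" and Q :: "nat \<Rightarrow> 'a \<Rightarrow> bool"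
  assumes "\<And>c. \<exists>N. \<forall>n\<ge>N. Q n c"
  shows "\<exists>N. \<forall>n\<ge>N. \<forall>l. Q n (coeff F l)"
proof -
  have "\<exists>N. \<forall>n\<ge>N. \<forall>l\<le>degree F + 1. Q n (coeff F l)"
  proof -
    obtain b where b: "\<And>c n. n \<ge> b c \<Longrightarrow> Q n c" using assms by metis
    have "\<forall>n\<ge>Max ((\<lambda>l. b (coeff F l)) ` {..degree F + 1}). \<forall>l\<le>degree F + 1. Q n (coeff F l)"
      by (auto intro!: b simp: Max_ge_iff)
    then show ?thesis by blast
  qed
  then obtain N where N: "\<And>n l. n \<ge> N \<Longrightarrow> l \<le> degree F + 1 \<Longrightarrow> Q n (coeff F l)" by blast
  have "Q n (coeff F l)" if "n \<ge> N" for n l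
  proof (cases "l \<le> degree F")
    case False
    then have "coeff F l = coeff F (degree F + 1)" by (simp add: coeff_eq_0)
    then show ?thesis using N[OF that, of "degree F + 1"] by simp
  qed (use N[OF that, of l] in auto)
  then show ?thesis by blast
qed

lemma ex_degrees_less: "\<exists>N0. \<forall>N\<ge>N0. degrees_less N F"
proof -
  have 1: "\<exists>N. \<forall>n\<ge>N. degree c < n" for c :: "'b::zero poly" by (rule exI[of _ "Suc (degree c)"]) auto
  obtain n1 where "\<forall>n\<ge>n1. degree F < n" using 1 by blast
  moreover obtain n2 where "\<forall>n\<ge>n2. \<forall>l. degree (coeff F l) < n"
    using uniform_degree_bound[of "\<lambda>n c. degree c < n" F] 1 by blast
  moreover obtain n3 where "\<forall>n\<ge>n3. \<forall>l k. degree (coeff (coeff F l) k) < n"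
    using uniform_degree_bound[of "\<lambda>n c. \<forall>k. degree (coeff c k) < n" F,
        OF uniform_degree_bound[of "\<lambda>n c. degree c < n", OF 1]] by blast
  moreover obtain n4 where "\<forall>n\<ge>n4. \<forall>l k j. degree (coeff (coeff (coeff F l) k) j) < n"
    using uniform_degree_bound[of "\<lambda>n c. \<forall>k j. degree (coeff (coeff c k) j) < n" F,
        OF uniform_degree_bound[of "\<lambda>n c. \<forall>j. degree (coeff c j) < n",
          OF uniform_degree_bound[of "\<lambda>n c. degree c < n", OF 1]]] by blast
  ultimately have "\<forall>n\<ge>max (max n1 n2) (max n3 n4). degrees_less n F" by (auto simp: degrees_less_def)
  then show ?thesis by blast
qed

lemma eval4_expand:
  assumes "degrees_less N F"
  shows "eval4 F q = (\<Sum>e\<in>box N. coeff_at F e * mon e q)"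
proof -
  obtain x0 x1 y0 y1 where q: "q = ((x0, x1), (y0, y1))" by (metis prod.exhaust)
  have s: "degree F < N" "\<And>l. degree (coeff F l) < N" "\<And>l k. degree (coeff (coeff F l) k) < N"
     "\<And>l k j. degree (coeff (coeff (coeff F l) k) j) < N" using assms by (auto simp: degrees_less_def)
  have pc: "[:c:] ^ n = [:c ^ n:]" for c :: "'b::comm_ring_1" and n by (induction n) (auto simp: one_pCons)
  have "eval4 F q = (\<Sum>l<N. \<Sum>k<N. \<Sum>j<N. \<Sum>i<N. coeff4 F i j k l * x0 ^ i * x1 ^ j * y0 ^ k * y1 ^ l)"
    unfolding eval4_alt q fst_conv snd_conv
    by (simp add: poly_bounded[OF s(1)] poly_bounded[OF s(2)] poly_bounded[OF s(3)] poly_bounded[OF s(4)]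
         poly_sum pc poly_power coeff4_def sum_distrib_left mult_ac)
  also have "\<dots> = (\<Sum>e\<in>box N. case e of (l, k, j, i) \<Rightarrow> coeff_at F (i, j, k, l) * mon (i, j, k, l) q)"
    unfolding sum_box by (simp add: coeff_at_def mon_def q mult.assoc)
  also have "\<dots> = (\<Sum>e\<in>box N. coeff_at F e * mon e q)"
    by (rule sum.reindex_bij_witness[where i = "\<lambda>(l, k, j, i). (i, j, k, l)" and j = "\<lambda>(l, k, j, i). (i, j, k, l)"])
      (auto simp: box_def)
  finally show ?thesis .
qed

lemma univariate_coeffs_zero:
  fixes c :: "nat \<Rightarrow> complex"
  assumes "\<And>x. (\<Sum>i<N. c i * x ^ i) = 0" and "i < N"
  shows "c i = 0"
proof -
  define p where "p = (\<Sum>i<N. monom (c i) i)"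
  have "poly p x = 0" for x using assms(1)[of x] by (simp add: p_def poly_sum poly_monom)
  then have "p = 0" using poly_all_0_iff_0[of p] by simp
  moreover have "coeff p i = c i" using assms(2) by (simp add: p_def coeff_sum)
  ultimately show ?thesis by simp
qed

lemma mon_coeffs_zero:
  assumes z: "\<And>q. (\<Sum>e\<in>box N. c e * mon e q) = 0" and e: "e \<in> box N"
  shows "c e = 0"
proof -
  obtain i j k l where ee: "e = (i, j, k, l)" by (metis prod.exhaust)
  then have lt: "i < N" "j < N" "k < N" "l < N" using e by (auto simp: box_def)
  have *: "(\<Sum>i<N. (\<Sum>j<N. (\<Sum>k<N. (\<Sum>l<N. c (i, j, k, l) * y1 ^ l) * y0 ^ k) * x1 ^ j) * x0 ^ i) = 0" for x0 x1 y0 y1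
  proof -
    have "(\<Sum>i<N. (\<Sum>j<N. (\<Sum>k<N. (\<Sum>l<N. c (i, j, k, l) * y1 ^ l) * y0 ^ k) * x1 ^ j) * x0 ^ i) =
        (\<Sum>e\<in>box N. c e * mon e ((x0, x1), (y0, y1)))"
      unfolding sum_box
      by (simp add: sum_distrib_left mon_def mult_ac)
    then show ?thesis using z by simp
  qed
  note ** = univariate_coeffs_zero[OF * lt(1)]
  note *** = univariate_coeffs_zero[OF ** lt(2)]
  show ?thesis using univariate_coeffs_zero[OF univariate_coeffs_zero[OF *** lt(3)] lt(4)] ee by simp
qed

lemma coeff_at_zero_outside: "degrees_less N F \<Longrightarrow> e \<notin> box N \<Longrightarrow> coeff_at F e = 0"
proof -
  assume s: "degrees_less N F" and e: "e \<notin> box N"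
  obtain i j k l where ee: "e = (i, j, k, l)" by (metis prod.exhaust)
  have "\<not> i < N \<or> \<not> j < N \<or> \<not> k < N \<or> \<not> l < N" using e by (auto simp: box_def ee)
  then consider "l \<ge> N" | "k \<ge> N" | "j \<ge> N" | "i \<ge> N" by linarith
  then show ?thesis
  proof cases
    case 1
    then have "coeff F l = 0" using s by (intro coeff_eq_0) (auto simp: degrees_less_def)
    then show ?thesis by (simp add: coeff_at_def coeff4_def ee)
  next
    case 2
    then have "coeff (coeff F l) k = 0" using s by (intro coeff_eq_0) (meson degrees_less_def less_le_trans)
    then show ?thesis by (simp add: coeff_at_def coeff4_def ee)
  next
    case 3
    then have "coeff (coeff (coeff F l) k) j = 0" using s by (intro coeff_eq_0) (meson degrees_less_def less_le_trans)
    then show ?thesis by (simp add: coeff_at_def coeff4_def ee)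
  next
    case 4
    then have "coeff (coeff (coeff (coeff F l) k) j) i = 0" using s by (intro coeff_eq_0) (meson degrees_less_def less_le_trans)
    then show ?thesis by (simp add: coeff_at_def coeff4_def ee)
  qed
qed

lemma poly4_eqI: "(\<And>e. coeff_at F e = coeff_at G e) \<Longrightarrow> F = G"
  by (intro poly_eqI) (force simp: coeff_at_def coeff4_def split: prod.splits)

lemma eval4_inject: "eval4 F = eval4 G \<Longrightarrow> F = G"
proof -
  assume eq: "eval4 F = eval4 G"
  obtain N where N: "degrees_less N F" "degrees_less N G" using ex_degrees_less[of F] ex_degrees_less[of G]
    by (metis max.cobounded1 max.cobounded2)
  have "(\<Sum>e\<in>box N. (coeff_at F e - coeff_at G e) * mon e q) = 0" for q
    using eq eval4_expand[OF N(1), of q] eval4_expand[OF N(2), of q]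
    by (simp add: left_diff_distrib sum_subtractf)
  then have "coeff_at F e = coeff_at G e" if "e \<in> box N" for e
    using mon_coeffs_zero[where c = "\<lambda>e. coeff_at F e - coeff_at G e", OF _ that] by simp
  then show ?thesis using coeff_at_zero_outside N by (metis poly4_eqI)
qed


section \<open>Order of vanishing along arcs\<close>

definition arc :: "(complex \<Rightarrow> ypoint) \<Rightarrow> bool" where
  "arc \<gamma> \<longleftrightarrow> (\<exists>g0 g1 h0 h1. \<gamma> = (\<lambda>t. ((poly g0 t, poly g1 t), (poly h0 t, poly h1 t))))"

text \<open>
  Vanishing to order at least \<open>m\<close> at \<open>q\<close>, tested on polynomial arcs through \<open>q\<close>.  Pulling back along a
  polynomial map turns arcs into arcs, so the order cannot drop; for iterated partial derivatives this
  would need a chain rule.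
\<close>

definition vanish :: "nat \<Rightarrow> (ypoint \<Rightarrow> complex) \<Rightarrow> ypoint \<Rightarrow> bool" where
  "vanish m f q \<longleftrightarrow> (\<forall>\<gamma>. arc \<gamma> \<longrightarrow> \<gamma> 0 = q \<longrightarrow> (\<exists>h. \<forall>t. f (\<gamma> t) = t ^ m * poly h t))"

lemma pf_along_arc:
  assumes "pf f" "arc \<gamma>"
  shows "\<exists>h. \<forall>t. f (\<gamma> t) = poly h t"
proof -
  obtain g0 g1 h0 h1 where \<gamma>: "\<gamma> = (\<lambda>t. ((poly g0 t, poly g1 t), (poly h0 t, poly h1 t)))"
    using assms(2) by (auto simp: arc_def)
  show ?thesis using assms(1)
  proof induction
    case (pf_const c) show ?case by (rule exI[of _ "[:c:]"]) simp
  next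
    case (pf_add f g)
    then obtain h k where "\<forall>t. f (\<gamma> t) = poly h t" "\<forall>t. g (\<gamma> t) = poly k t" by blast
    then show ?case by (intro exI[of _ "h + k"]) simp
  next
    case (pf_mult f g)
    then obtain h k where "\<forall>t. f (\<gamma> t) = poly h t" "\<forall>t. g (\<gamma> t) = poly k t" by blast
    then show ?case by (intro exI[of _ "h * k"]) simp
  qed (auto simp: \<gamma>)
qed

lemma vanish_0: "pf f \<Longrightarrow> vanish 0 f q"
  using pf_along_arc by (simp add: vanish_def)

lemma vanish_mono:
  assumes "vanish n f q" "m \<le> n" shows "vanish m f q"
  unfolding vanish_def
proof (intro allI impI)
  fix \<gamma> assume "arc \<gamma>" "\<gamma> 0 = q"
  then obtain h where "\<And>t. f (\<gamma> t) = t ^ n * poly h t" using assms(1) by (auto simp: vanish_def)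
  then have "\<forall>t. f (\<gamma> t) = t ^ m * poly (monom 1 (n - m) * h) t"
    using assms(2) by (simp add: poly_monom mult.assoc[symmetric] power_add[symmetric])
  then show "\<exists>h. \<forall>t. f (\<gamma> t) = t ^ m * poly h t" by blast
qed

lemma vanish_add:
  assumes "vanish m f q" "vanish m g q" shows "vanish m (\<lambda>z. f z + g z) q"
  unfolding vanish_def
proof (intro allI impI)
  fix \<gamma> assume "arc \<gamma>" "\<gamma> 0 = q"
  then have "\<exists>h. \<forall>t. f (\<gamma> t) = t ^ m * poly h t" "\<exists>k. \<forall>t. g (\<gamma> t) = t ^ m * poly k t"
    using assms unfolding vanish_def by blast+
  then obtain h k where "\<And>t. f (\<gamma> t) = t ^ m * poly h t" "\<And>t. g (\<gamma> t) = t ^ m * poly k t" by blast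
  then have "\<forall>t. f (\<gamma> t) + g (\<gamma> t) = t ^ m * poly (h + k) t" by (simp add: algebra_simps)
  then show "\<exists>h. \<forall>t. f (\<gamma> t) + g (\<gamma> t) = t ^ m * poly h t" by blast
qed

lemma vanish_mult:
  assumes "vanish m f q" "vanish n g q" shows "vanish (m + n) (\<lambda>z. f z * g z) q"
  unfolding vanish_def
proof (intro allI impI)
  fix \<gamma> assume "arc \<gamma>" "\<gamma> 0 = q"
  then have "\<exists>h. \<forall>t. f (\<gamma> t) = t ^ m * poly h t" "\<exists>k. \<forall>t. g (\<gamma> t) = t ^ n * poly k t"
    using assms unfolding vanish_def by blast+
  then obtain h k where "\<And>t. f (\<gamma> t) = t ^ m * poly h t" "\<And>t. g (\<gamma> t) = t ^ n * poly k t" by blast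
  then have "\<forall>t. f (\<gamma> t) * g (\<gamma> t) = t ^ (m + n) * poly (h * k) t" by (simp add: power_add)
  then show "\<exists>h. \<forall>t. f (\<gamma> t) * g (\<gamma> t) = t ^ (m + n) * poly h t" by blast
qed

lemma vanish_zero_fun: "vanish m (\<lambda>z. 0) q"
  unfolding vanish_def by (auto intro: exI[of _ 0])

lemma vanish_sum: "(\<And>i. i \<in> A \<Longrightarrow> vanish m (f i) q) \<Longrightarrow> vanish m (\<lambda>z. \<Sum>i\<in>A. f i z) q"
  by (induction A rule: infinite_finite_induct) (auto intro: vanish_add vanish_zero_fun)

lemma vanish_power: "vanish 1 f q \<Longrightarrow> vanish n (\<lambda>z. f z ^ n) q"
proof (induction n)
  case 0 show ?case by (simp add: vanish_0 pf_const)
next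
  case (Suc n)
  then show ?case using vanish_mult[of 1 f q n "\<lambda>z. f z ^ n"] by simp
qed

lemma vanish_coord:
  "fst (fst q) = 0 \<Longrightarrow> vanish 1 (\<lambda>z. fst (fst z)) q"
  "snd (fst q) = 0 \<Longrightarrow> vanish 1 (\<lambda>z. snd (fst z)) q"
  "fst (snd q) = 0 \<Longrightarrow> vanish 1 (\<lambda>z. fst (snd z)) q"
  "snd (snd q) = 0 \<Longrightarrow> vanish 1 (\<lambda>z. snd (snd z)) q"
proof -
  have "\<exists>h. \<forall>t. poly g t = t * poly h t" if "poly g 0 = 0" for g :: "complex poly"
  proof -
    have "[:0, 1:] dvd g" using that poly_eq_0_iff_dvd[of g 0] by simp
    then obtain h where "g = [:0, 1:] * h" by (auto elim: dvdE)
    then show ?thesis by (intro exI[of _ h]) simp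
  qed
  note * = this
  show "fst (fst q) = 0 \<Longrightarrow> vanish 1 (\<lambda>z. fst (fst z)) q"
    "snd (fst q) = 0 \<Longrightarrow> vanish 1 (\<lambda>z. snd (fst z)) q"
    "fst (snd q) = 0 \<Longrightarrow> vanish 1 (\<lambda>z. fst (snd z)) q"
    "snd (snd q) = 0 \<Longrightarrow> vanish 1 (\<lambda>z. snd (snd z)) q"
    by (auto simp: vanish_def arc_def intro!: *)
qed

text \<open>
  Along an arc through \<open>q\<close> the factor \<open>u\<close> restricts to a polynomial with nonzero constant term, which
  does not change the order at \<open>0\<close> of a product.
\<close>

lemma vanish_cancel:
  assumes "pf f" "pf u" "u q \<noteq> 0" "vanish m (\<lambda>z. f z * u z) q"
  shows "vanish m f q"
  unfolding vanish_def
proof (intro allI impI)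
  fix \<gamma> assume \<gamma>: "arc \<gamma>" "\<gamma> 0 = q"
  obtain p v where p: "\<And>t. f (\<gamma> t) = poly p t" and v: "\<And>t. u (\<gamma> t) = poly v t"
    using pf_along_arc[OF assms(1) \<gamma>(1)] pf_along_arc[OF assms(2) \<gamma>(1)] by blast
  obtain h where "\<And>t. f (\<gamma> t) * u (\<gamma> t) = t ^ m * poly h t" using assms(4) \<gamma> by (auto simp: vanish_def)
  then have "poly (p * v) = poly (monom 1 m * h)" by (auto simp: p v poly_monom fun_eq_iff)
  then have eq: "p * v = monom 1 m * h" by (simp add: poly_eq_poly_eq_iff)
  have v0: "poly v 0 \<noteq> 0" using v[of 0] \<gamma>(2) assms(3) by simp
  have "monom 1 m dvd p"
  proof (cases "p = 0")
    case False
    have "v \<noteq> 0" using v0 by auto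
    then have pv: "p * v \<noteq> 0" using False by simp
    have "m \<le> order 0 (p * v)" using monom_1_dvd_iff[OF pv, of m] eq by simp
    also have "\<dots> = order 0 p" using order_mult[OF pv, of 0] order_0I[OF v0] by simp
    finally show ?thesis using monom_1_dvd_iff[OF False] by simp
  qed simp
  then obtain k where "p = monom 1 m * k" by (auto elim: dvdE)
  then show "\<exists>h. \<forall>t. f (\<gamma> t) = t ^ m * poly h t"
    by (intro exI[of _ k]) (simp add: p poly_monom)
qed

lemma vanish_compose:
  assumes "vanish m f (T q)" "\<And>\<gamma>. arc \<gamma> \<Longrightarrow> arc (\<lambda>t. T (\<gamma> t))"
  shows "vanish m (\<lambda>z. f (T z)) q"
  using assms by (auto simp: vanish_def)

lemma arc_compose:
  assumes "arc \<gamma>" "pf a" "pf b" "pf c" "pf d"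
  shows "arc (\<lambda>t. ((a (\<gamma> t), b (\<gamma> t)), (c (\<gamma> t), d (\<gamma> t))))"
proof -
  obtain g0 g1 h0 h1 where "\<And>t. a (\<gamma> t) = poly g0 t" "\<And>t. b (\<gamma> t) = poly g1 t"
      "\<And>t. c (\<gamma> t) = poly h0 t" "\<And>t. d (\<gamma> t) = poly h1 t"
    using assms pf_along_arc by metis
  then show ?thesis unfolding arc_def by auto
qed


section \<open>Taylor expansion\<close>

definition translate :: "ypoint \<Rightarrow> ypoint \<Rightarrow> ypoint" where
  "translate q v = ((fst (fst q) + fst (fst v), snd (fst q) + snd (fst v)),
               (fst (snd q) + fst (snd v), snd (snd q) + snd (snd v)))"

definition total_degree :: "multi \<Rightarrow> nat" where "total_degree e = (case e of (i, j, k, l) \<Rightarrow> i + j + k + l)"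

definition dilate :: "complex \<Rightarrow> ypoint \<Rightarrow> ypoint" where "dilate t q = rescale t t q"

lemma mon_dilate: "mon e (dilate t q) = t ^ total_degree e * mon e q"
  by (auto simp: mon_def dilate_def rescale_def total_degree_def power_mult_distrib power_add split: prod.splits)

lemma line_coeffs:
  assumes taylor: "\<And>v. f (translate q v) = (\<Sum>d\<in>box N. K d * mon d v)"
  shows "f (translate q (dilate t v)) = poly (\<Sum>d\<in>box N. monom (K d * mon d v) (total_degree d)) t"
  by (simp add: taylor mon_dilate poly_sum poly_monom mult_ac)

lemma arc_line: "arc (\<lambda>t. translate q (dilate t v))"
proof -
  have "(\<lambda>t. translate q (dilate t v)) = (\<lambda>t. ((poly [:fst (fst q), fst (fst v):] t, poly [:snd (fst q), snd (fst v):] t),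
     (poly [:fst (snd q), fst (snd v):] t, poly [:snd (snd q), snd (snd v):] t)))"
    by (auto simp: translate_def dilate_def rescale_def split: prod.splits)
  then show ?thesis unfolding arc_def by blast
qed

lemma translate_zero: "translate q (dilate 0 v) = q"
  by (auto simp: translate_def dilate_def rescale_def split: prod.splits)

text \<open>
  Lines suffice: along \<open>t \<mapsto> q + t v\<close> the coefficient of \<open>t ^ k\<close> is the part of degree \<open>k\<close> of the
  Taylor expansion, and it can be zero for all \<open>v\<close> only if its coefficients are zero.
\<close>

lemma vanish_imp_taylor:
  assumes taylor: "\<And>v. f (translate q v) = (\<Sum>d\<in>box N. K d * mon d v)"
    and van: "vanish m f q" and d: "d \<in> box N" "total_degree d < m"
  shows "K d = 0"
proof -
  define c where "c = (\<lambda>e. if total_degree e = total_degree d then K e else 0)"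
  have "(\<Sum>e\<in>box N. c e * mon e v) = 0" for v
  proof -
    let ?P = "\<Sum>d\<in>box N. monom (K d * mon d v) (total_degree d)"
    obtain h where "\<And>t. f (translate q (dilate t v)) = t ^ m * poly h t"
      using van arc_line[of q v] translate_zero[of q v] unfolding vanish_def by blast
    then have "poly ?P = poly (monom 1 m * h)"
      by (auto simp: line_coeffs[OF taylor, symmetric] poly_monom)
    then have "?P = monom 1 m * h" by (simp add: poly_eq_poly_eq_iff)
    then have "coeff ?P (total_degree d) = 0" using d(2) monom_1_dvd_iff'[of m ?P] by simp
    moreover have "coeff ?P (total_degree d) = (\<Sum>e\<in>box N. c e * mon e v)"
      by (simp add: coeff_sum c_def if_distrib[of "\<lambda>x. x * _"] cong: if_cong)
    ultimately show ?thesis by simp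
  qed
  from mon_coeffs_zero[OF this d(1)] show ?thesis by (simp add: c_def)
qed

text \<open>
  An arc through \<open>q\<close> has the form \<open>q + t \<delta>(t)\<close>, so the Taylor term with exponent \<open>d\<close> contributes a multiple
  of \<open>t ^ total_degree d\<close>.
\<close>

lemma taylor_imp_vanish:
  assumes taylor: "\<And>v. f (translate q v) = (\<Sum>d\<in>box N. K d * mon d v)"
    and zero: "\<And>d. d \<in> box N \<Longrightarrow> total_degree d < m \<Longrightarrow> K d = 0"
  shows "vanish m f q"
  unfolding vanish_def
proof (intro allI impI)
  fix \<gamma> assume \<gamma>: "arc \<gamma>" "\<gamma> 0 = q"
  obtain g0 g1 h0 h1 where g: "\<gamma> = (\<lambda>t. ((poly g0 t, poly g1 t), (poly h0 t, poly h1 t)))"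
    using \<gamma>(1) by (auto simp: arc_def)
  have dec: "\<exists>h. \<forall>t. poly p t = poly p 0 + t * poly h t" for p :: "complex poly"
    by (cases p) (auto)
  obtain a b c d where a: "\<And>t. poly g0 t = poly g0 0 + t * poly a t"
    and b: "\<And>t. poly g1 t = poly g1 0 + t * poly b t"
    and c: "\<And>t. poly h0 t = poly h0 0 + t * poly c t"
    and d: "\<And>t. poly h1 t = poly h1 0 + t * poly d t"
    using dec by meson
  define \<delta> where "\<delta> = (\<lambda>t. ((poly a t, poly b t), (poly c t, poly d t)))"
  have arc\<delta>: "arc \<delta>" by (auto simp: arc_def \<delta>_def)
  have \<gamma>\<delta>: "\<gamma> t = translate q (dilate t (\<delta> t))" for t
    unfolding \<gamma>(2)[symmetric] g \<delta>_def translate_def dilate_def rescale_def using a[of t] b[of t] c[of t] d[of t] by simp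
  have "\<exists>h. \<forall>t. mon e (\<delta> t) = poly h t" for e by (rule pf_along_arc[OF pf_mon arc\<delta>])
  then obtain H where H: "\<And>e t. mon e (\<delta> t) = poly (H e) t" by metis
  define h where "h = (\<Sum>e\<in>box N. Polynomial.smult (K e) (monom 1 (total_degree e - m) * H e))"
  have "f (\<gamma> t) = t ^ m * poly h t" for t
  proof -
    have "K e * (t ^ total_degree e * mon e (\<delta> t)) = t ^ m * poly (Polynomial.smult (K e) (monom 1 (total_degree e - m) * H e)) t"
      if "e \<in> box N" for e
    proof (cases "total_degree e < m")
      case False
      then have "t ^ total_degree e = t ^ m * t ^ (total_degree e - m)" by (simp add: power_add[symmetric])
      then show ?thesis by (simp add: H poly_monom)
    qed (use zero[OF that] in simp)
    then have "(\<Sum>e\<in>box N. K e * (t ^ total_degree e * mon e (\<delta> t))) = t ^ m * poly h t"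
      unfolding h_def poly_sum sum_distrib_left by (intro sum.cong refl)
    then show ?thesis by (simp add: \<gamma>\<delta> taylor mon_dilate)
  qed
  then show "\<exists>h. \<forall>t. f (\<gamma> t) = t ^ m * poly h t" by blast
qed

text \<open>
  The divided (Hasse) derivative of order \<open>d\<close> of the monomial with exponent \<open>e\<close>, which is its Taylor
  coefficient at \<open>q\<close>.
\<close>

definition hasse :: "multi \<Rightarrow> multi \<Rightarrow> ypoint \<Rightarrow> complex" where
  "hasse e d q = (case (e, d, q) of ((i, j, k, l), (i', j', k', l'), ((x0, x1), (y0, y1))) \<Rightarrow>
     (of_nat (i choose i') * x0 ^ (i - i')) * (of_nat (j choose j') * x1 ^ (j - j')) *
     (of_nat (k choose k') * y0 ^ (k - k')) * (of_nat (l choose l') * y1 ^ (l - l')))"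

lemma binomial_shift:
  fixes x u :: complex
  assumes "i < N"
  shows "(x + u) ^ i = (\<Sum>d<N. of_nat (i choose d) * x ^ (i - d) * u ^ d)"
proof -
  have "(x + u) ^ i = (u + x) ^ i" by (simp add: add.commute)
  also have "\<dots> = (\<Sum>d\<le>i. of_nat (i choose d) * x ^ (i - d) * u ^ d)"
    by (simp add: binomial_ring mult_ac)
  also have "\<dots> = (\<Sum>d<N. of_nat (i choose d) * x ^ (i - d) * u ^ d)"
    by (rule sum.mono_neutral_left) (use assms in \<open>auto simp: not_le\<close>)
  finally show ?thesis .
qed

lemma prod_four_sums:
  fixes A B C D :: "nat \<Rightarrow> complex"
  shows "(\<Sum>i<N. A i) * (\<Sum>i<N. B i) * (\<Sum>i<N. C i) * (\<Sum>i<N. D i) =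
    (\<Sum>i<N. \<Sum>j<N. \<Sum>k<N. \<Sum>l<N. A i * B j * C k * D l)"
  by (simp only: sum_distrib_right mult.assoc, simp only: sum_distrib_left mult.assoc)

lemma mon_taylor:
  assumes "e \<in> box N"
  shows "mon e (translate q v) = (\<Sum>d\<in>box N. hasse e d q * mon d v)"
proof -
  obtain i j k l where e: "e = (i, j, k, l)" by (metis prod.exhaust)
  obtain x0 x1 y0 y1 where q: "q = ((x0, x1), (y0, y1))" by (metis prod.exhaust)
  obtain u0 u1 w0 w1 where v: "v = ((u0, u1), (w0, w1))" by (metis prod.exhaust)
  have lt: "i < N" "j < N" "k < N" "l < N" using assms by (auto simp: box_def e)
  have "mon e (translate q v) = (x0 + u0) ^ i * (x1 + u1) ^ j * (y0 + w0) ^ k * (y1 + w1) ^ l"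
    by (simp add: mon_def translate_def e q v)
  also have "\<dots> = (\<Sum>d\<in>box N. hasse e d q * mon d v)"
    unfolding binomial_shift[OF lt(1)] binomial_shift[OF lt(2)] binomial_shift[OF lt(3)] binomial_shift[OF lt(4)]
      prod_four_sums sum_box
    by (intro sum.cong refl) (simp add: hasse_def mon_def e q v mult_ac)
  finally show ?thesis .
qed

lemma taylor_of_sum:
  assumes f: "\<And>q. f q = (\<Sum>a\<in>A. c a * mon (e a) q)" and e: "\<And>a. a \<in> A \<Longrightarrow> e a \<in> box N"
  shows "f (translate q v) = (\<Sum>d\<in>box N. (\<Sum>a\<in>A. c a * hasse (e a) d q) * mon d v)"
proof -
  have "f (translate q v) = (\<Sum>a\<in>A. c a * (\<Sum>d\<in>box N. hasse (e a) d q * mon d v))"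
    by (simp add: f mon_taylor[OF e] cong: sum.cong)
  also have "\<dots> = (\<Sum>d\<in>box N. (\<Sum>a\<in>A. c a * hasse (e a) d q) * mon d v)"
    by (simp add: sum_distrib_left sum_distrib_right mult.assoc sum.swap[of _ _ A])
  finally show ?thesis .
qed

lemma coeff_of_nat_times: "coeff (of_nat n * p) k = of_nat n * coeff p k" for p :: "'a :: comm_ring_1 poly"
  by (simp add: of_nat_poly)

lemma coeff_map_poly_power:
  fixes g :: "'a::zero \<Rightarrow> 'a"
  assumes "g 0 = 0"
  shows "coeff ((map_poly g ^^ n) p) k = (g ^^ n) (coeff p k)"
  by (induction n arbitrary: p) (auto simp: coeff_map_poly assms)

lemma pochhammer_of_nat_poly: "pochhammer (of_nat (Suc n)) m = (of_nat (pochhammer (Suc n) m) :: 'a :: comm_ring_1)"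
  by (simp only: pochhammer_of_nat)

lemma coeff4_partial4:
  "coeff4 (partial4 i j k l F) a b c d = of_nat (pochhammer (Suc a) i * pochhammer (Suc b) j *
     pochhammer (Suc c) k * pochhammer (Suc d) l) * coeff4 F (a + i) (b + j) (c + k) (d + l)"
  unfolding coeff4_def partial4_def
  by (simp add: coeff_map_poly_power coeff_higher_pderiv pochhammer_of_nat_poly coeff_of_nat_times
      del: of_nat_Suc of_nat_add)

lemma pochhammer_choose: "pochhammer (Suc a) d = fact d * ((a + d) choose d)"
proof -
  have "fact (a + d) = fact a * pochhammer (Suc a) d" by (induction d) (auto simp: pochhammer_Suc algebra_simps)
  moreover have "fact d * fact a * ((a + d) choose d) = (fact (a + d) :: nat)"
    using binomial_fact_lemma[of d "a + d"] by simp
  ultimately have "fact a * pochhammer (Suc a) d = fact a * (fact d * ((a + d) choose d))"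
    by (simp add: mult_ac)
  then show ?thesis by (simp only: mult_cancel1) simp
qed

definition fact4 :: "multi \<Rightarrow> complex" where
  "fact4 d = (case d of (i, j, k, l) \<Rightarrow> fact i * fact j * fact k * fact l)"

lemma fact4_nonzero: "fact4 d \<noteq> 0" by (simp add: fact4_def split: prod.splits)

text \<open>
  The iterated partial derivatives are the Taylor coefficients up to factorials.  This connects
  \<open>multiplicity_at\<close> with the order along arcs.
\<close>

lemma eval4_partial4:
  assumes N: "degrees_less N F"
  shows "eval4 (partial4 i j k l F) q = fact4 (i, j, k, l) * (\<Sum>e\<in>box N. coeff_at F e * hasse e (i, j, k, l) q)"
proof -
  let ?d = "(i, j, k, l)" and ?G = "partial4 i j k l F"
  obtain M0 M1 where M01: "\<forall>n\<ge>M0. degrees_less n F" "\<forall>n\<ge>M1. degrees_less n ?G" using ex_degrees_less by metis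
  define M where "M = max N (max M0 M1)"
  have M: "degrees_less M F" "degrees_less M ?G" "N \<le> M" using M01 by (auto simp: M_def)
  define sh where "sh = (\<lambda>(a, b, c, d). (a + i, b + j, c + k, d + l))"
  define unsh where "unsh = (\<lambda>(a, b, c, d). (a - i, b - j, c - k, d - l))"
  have "eval4 ?G q = (\<Sum>e\<in>box M. coeff_at ?G e * mon e q)" by (rule eval4_expand[OF M(2)])
  also have "\<dots> = (\<Sum>e\<in>{e \<in> box M. sh e \<in> box M}. coeff_at ?G e * mon e q)"
  proof (rule sum.mono_neutral_right; (simp; fail)?)
    show "\<forall>e\<in>box M - {e \<in> box M. sh e \<in> box M}. coeff_at ?G e * mon e q = 0"
    proof
      fix e assume "e \<in> box M - {e \<in> box M. sh e \<in> box M}"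
      then have "coeff_at F (sh e) = 0" using coeff_at_zero_outside[OF M(1)] by auto
      then show "coeff_at ?G e * mon e q = 0" by (auto simp: coeff_at_def coeff4_partial4 sh_def split: prod.splits)
    qed
  qed
  also have "\<dots> = (\<Sum>e\<in>{e \<in> box M. sh (unsh e) = e}. coeff_at F e * (fact4 ?d * hasse e ?d q))"
  proof (rule sum.reindex_bij_witness[of _ unsh sh])
    fix e assume "e \<in> {e \<in> box M. sh e \<in> box M}"
    then show "sh e \<in> {e \<in> box M. sh (unsh e) = e}" "unsh (sh e) = e"
      "coeff_at F (sh e) * (fact4 ?d * hasse (sh e) ?d q) = coeff_at ?G e * mon e q"
      by (auto simp: sh_def unsh_def coeff_at_def coeff4_partial4 hasse_def mon_def pochhammer_choose fact4_def split: prod.splits)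
  qed (auto simp: sh_def unsh_def box_def)
  also have "\<dots> = (\<Sum>e\<in>box M. coeff_at F e * (fact4 ?d * hasse e ?d q))"
  proof (rule sum.mono_neutral_left; (simp; fail)?)
    show "\<forall>e\<in>box M - {e \<in> box M. sh (unsh e) = e}. coeff_at F e * (fact4 ?d * hasse e ?d q) = 0"
      by (auto simp: sh_def unsh_def hasse_def split: prod.splits)
  qed
  also have "\<dots> = (\<Sum>e\<in>box N. coeff_at F e * (fact4 ?d * hasse e ?d q))"
    by (rule sum.mono_neutral_right) (use M(3) coeff_at_zero_outside[OF N] in \<open>auto simp: box_def\<close>)
  finally show ?thesis by (simp add: sum_distrib_left mult_ac)
qed

lemma eval4_taylor:
  assumes "degrees_less N F"
  shows "eval4 F (translate q v) = (\<Sum>d\<in>box N. (\<Sum>e\<in>box N. coeff_at F e * hasse e d q) * mon d v)"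
  by (rule taylor_of_sum[where c = "coeff_at F" and e = "\<lambda>e. e"]) (use eval4_expand[OF assms] in auto)

lemma partial_nonzero_exists:
  assumes "F \<noteq> 0"
  shows "\<exists>m i j k l. i + j + k + l = m \<and> eval4 (partial4 i j k l F) q \<noteq> 0"
proof (rule ccontr)
  assume "\<not> ?thesis"
  then have z: "eval4 (partial4 i j k l F) q = 0" for i j k l by blast
  obtain N where N: "degrees_less N F" using ex_degrees_less by blast
  have "(\<Sum>e\<in>box N. coeff_at F e * hasse e d q) = 0" for d
    using z eval4_partial4[OF N, of _ _ _ _ q] fact4_nonzero by (cases d) auto
  then have v: "eval4 F (translate q v) = 0" for v by (simp add: eval4_taylor[OF N])
  have "eval4 F z = 0" for z
  proof -
    have "translate q (translate z (dilate (-1) q)) = z" by (auto simp: translate_def dilate_def rescale_def split: prod.splits)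
    then show ?thesis using v[of "translate z (dilate (-1) q)"] by simp
  qed
  then have "eval4 F = eval4 0" by (auto simp: eval4_alt)
  then show False using eval4_inject assms by blast
qed

lemma multiplicity_witness:
  assumes "F \<noteq> 0"
  shows "\<exists>i j k l. i + j + k + l = multiplicity_at F q \<and> eval4 (partial4 i j k l F) q \<noteq> 0"
  unfolding multiplicity_at_def by (rule LeastI_ex) (use partial_nonzero_exists[OF assms] in blast)

lemma vanish_multiplicity: "vanish (multiplicity_at F q) (eval4 F) q"
proof -
  obtain N where N: "degrees_less N F" using ex_degrees_less by blast
  show ?thesis
  proof (rule taylor_imp_vanish[OF eval4_taylor[OF N]])
    fix d assume d: "total_degree d < multiplicity_at F q"
    obtain i j k l where dd: "d = (i, j, k, l)" by (metis prod.exhaust)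
    have "eval4 (partial4 i j k l F) q = 0"
      using not_less_Least[OF d[unfolded multiplicity_at_def]] by (auto simp: total_degree_def dd)
    then show "(\<Sum>e\<in>box N. coeff_at F e * hasse e d q) = 0"
      using eval4_partial4[OF N] fact4_nonzero dd by auto
  qed
qed

lemma vanish_imp_le_multiplicity:
  assumes "F \<noteq> 0" "vanish m (eval4 F) q" shows "m \<le> multiplicity_at F q"
proof (rule ccontr)
  assume lt: "\<not> m \<le> multiplicity_at F q"
  obtain i j k l where ij: "i + j + k + l = multiplicity_at F q" "eval4 (partial4 i j k l F) q \<noteq> 0"
    using multiplicity_witness[OF assms(1)] by blast
  obtain N0 where N0: "\<forall>n\<ge>N0. degrees_less n F" using ex_degrees_less by blast
  define N where "N = max N0 (Suc (i + j + k + l))"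
  have N: "degrees_less N F" using N0 by (simp add: N_def)
  have "(i, j, k, l) \<in> box N" by (auto simp: box_def N_def)
  from vanish_imp_taylor[OF eval4_taylor[OF N] assms(2) this]
  have "(\<Sum>e\<in>box N. coeff_at F e * hasse e (i, j, k, l) q) = 0" using ij lt by (simp add: total_degree_def)
  then show False using eval4_partial4[OF N] ij(2) by simp
qed

text \<open>
  On a general line through \<open>q\<close> the restrictions of \<open>F\<close> and of \<open>G\<close> vanish at \<open>q\<close> to orders at most the two
  multiplicities, and orders of polynomials in one variable add.
\<close>

lemma multiplicity_mult_le:
  assumes "F \<noteq> 0" "G \<noteq> 0"
  shows "multiplicity_at (F * G) q \<le> multiplicity_at F q + multiplicity_at G q"
proof -
  obtain NF NG where "\<forall>n\<ge>NF. degrees_less n F" "\<forall>n\<ge>NG. degrees_less n G" using ex_degrees_less by metis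
  define N where "N = max NF NG"
  have N: "degrees_less N F" "degrees_less N G" using \<open>\<forall>n\<ge>NF. _ n\<close> \<open>\<forall>n\<ge>NG. _ n\<close> by (auto simp: N_def)
  define K where "K = (\<lambda>F d. \<Sum>e\<in>box N. coeff_at F e * hasse e d q)"
  define L where "L = (\<lambda>F v. \<Sum>d\<in>box N. monom (K F d * mon d v) (total_degree d))"
  have line: "eval4 F (translate q (dilate t v)) = poly (L F v) t" if "degrees_less N F" for F t v
    using line_coeffs[OF eval4_taylor[OF that]] by (simp add: L_def K_def)
  define lead where "lead = (\<lambda>F k v. coeff (L F v) k)"
  have lead: "lead F k = (\<lambda>v. \<Sum>d\<in>box N. (if total_degree d = k then K F d else 0) * mon d v)" for F k
    by (auto simp: lead_def L_def coeff_sum fun_eq_iff intro!: sum.cong)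
  have pf: "pf (lead F k)" for F k
    unfolding lead by (intro pf_rules pf_mon)
  have ex: "\<exists>k v. k \<le> multiplicity_at F q \<and> lead F k v \<noteq> 0" if "degrees_less N F" "F \<noteq> 0" for F
  proof (rule ccontr)
    assume "\<not> ?thesis"
    then have z: "lead F k v = 0" if "k \<le> multiplicity_at F q" for k v using that by blast
    have "K F d = 0" if "d \<in> box N" "total_degree d \<le> multiplicity_at F q" for d
      using mon_coeffs_zero[where c = "\<lambda>e. if total_degree e = total_degree d then K F e else 0", OF _ that(1)] z[OF that(2)]
      unfolding lead by simp
    then have "vanish (Suc (multiplicity_at F q)) (eval4 F) q"
      using taylor_imp_vanish[OF eval4_taylor[OF \<open>degrees_less N F\<close>], of "Suc (multiplicity_at F q)" q]
      by (simp add: K_def)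
    from vanish_imp_le_multiplicity[OF that(2) this] show False by simp
  qed
  obtain k v where k: "k \<le> multiplicity_at F q" "lead F k v \<noteq> 0" using ex[OF N(1) assms(1)] by blast
  obtain l w where l: "l \<le> multiplicity_at G q" "lead G l w \<noteq> 0" using ex[OF N(2) assms(2)] by blast
  obtain z where z: "lead F k z \<noteq> 0" "lead G l z \<noteq> 0" using pf_common_nonzero[OF pf pf k(2) l(2)] by blast
  have ord: "order 0 p \<le> n" if "coeff p n \<noteq> 0" for p :: "complex poly" and n
  proof -
    have "p \<noteq> 0" using that by auto
    then have "monom 1 (order 0 p) dvd p" using monom_1_dvd_iff by blast
    then show ?thesis using that monom_1_dvd_iff'[of "order 0 p" p] by (meson not_le)
  qed
  have nz: "L F z \<noteq> 0" "L G z \<noteq> 0" using z by (auto simp: lead_def)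
  have "multiplicity_at (F * G) q \<le> order 0 (L F z * L G z)"
  proof -
    obtain h where "\<And>t. eval4 (F * G) (translate q (dilate t z)) = t ^ multiplicity_at (F * G) q * poly h t"
      using vanish_multiplicity[of "F * G" q] arc_line[of q z] translate_zero[of q z] unfolding vanish_def by blast
    then have "poly (L F z * L G z) = poly (monom 1 (multiplicity_at (F * G) q) * h)"
      by (auto simp: eval4_mult line[OF N(1)] line[OF N(2)] poly_monom)
    then have "L F z * L G z = monom 1 (multiplicity_at (F * G) q) * h" by (simp add: poly_eq_poly_eq_iff)
    then have "monom 1 (multiplicity_at (F * G) q) dvd L F z * L G z" by (metis dvd_triv_left)
    then show ?thesis using monom_1_dvd_iff[of "L F z * L G z"] nz by simp
  qed
  also have "\<dots> = order 0 (L F z) + order 0 (L G z)" using nz by (intro order_mult) simp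
  also have "\<dots> \<le> k + l" using z by (intro add_mono ord) (auto simp: lead_def)
  finally show ?thesis using k(1) l(1) by linarith
qed


section \<open>Bihomogeneous forms\<close>

text \<open>
  The functions defined by bihomogeneous polynomials (see \<open>biform_eval4_iff\<close>), described without
  coefficients: this form is stable under linear changes of the homogeneous coordinates.
\<close>

definition biform :: "nat \<Rightarrow> nat \<Rightarrow> (ypoint \<Rightarrow> complex) \<Rightarrow> bool" where
  "biform a b f \<longleftrightarrow> pf f \<and> (\<forall>s t q. f (rescale s t q) = s ^ a * t ^ b * f q)"

lemma biform_pf: "biform a b f \<Longrightarrow> pf f" by (simp add: biform_def)

lemma biform_rescale: "biform a b f \<Longrightarrow> f (rescale s t q) = s ^ a * t ^ b * f q"
  unfolding biform_def by blast

definition xdeg :: "multi \<Rightarrow> nat" where "xdeg e = (case e of (i, j, k, l) \<Rightarrow> i + j)"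
definition ydeg :: "multi \<Rightarrow> nat" where "ydeg e = (case e of (i, j, k, l) \<Rightarrow> k + l)"

lemma mon_rescale: "mon e (rescale s t q) = s ^ xdeg e * t ^ ydeg e * mon e q"
  by (auto simp: mon_def rescale_def xdeg_def ydeg_def power_mult_distrib power_add split: prod.splits)

lemma bihomogeneous_coeff_at: "bihomogeneous a b F \<longleftrightarrow> (\<forall>e. coeff_at F e \<noteq> 0 \<longrightarrow> xdeg e = a \<and> ydeg e = b)"
  by (auto simp: bihomogeneous_def coeff_at_def xdeg_def ydeg_def)

lemma biform_eval4_iff: "biform a b (eval4 F) \<longleftrightarrow> bihomogeneous a b F"
proof -
  obtain N where N: "degrees_less N F" using ex_degrees_less by blast
  note ex = eval4_expand[OF N]
  show ?thesis
  proof
    assume B: "biform a b (eval4 F)"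
    show "bihomogeneous a b F" unfolding bihomogeneous_coeff_at
    proof (intro allI impI)
      fix e assume e: "coeff_at F e \<noteq> 0"
      then have eb: "e \<in> box N" using coeff_at_zero_outside[OF N] by blast
      have *: "s ^ xdeg e * t ^ ydeg e = s ^ a * t ^ b" for s t :: complex
      proof -
        have "(\<Sum>e\<in>box N. (coeff_at F e * (s ^ xdeg e * t ^ ydeg e - s ^ a * t ^ b)) * mon e q) = 0" for q
        proof -
          have "eval4 F (rescale s t q) - s ^ a * t ^ b * eval4 F q = 0" using biform_rescale[OF B] by simp
          then show ?thesis unfolding ex mon_rescale
            by (simp add: sum_distrib_left sum_subtractf[symmetric] algebra_simps)
        qed
        from mon_coeffs_zero[OF this eb] e show ?thesis by simp
      qed
      have "(2::complex) ^ xdeg e = 2 ^ a" using *[of 2 1] by simp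
      then have "complex_of_nat (2 ^ xdeg e) = of_nat (2 ^ a)" by simp
      then have "(2::nat) ^ xdeg e = 2 ^ a" by (simp only: of_nat_eq_iff)
      moreover have "(2::complex) ^ ydeg e = 2 ^ b" using *[of 1 2] by simp
      then have "complex_of_nat (2 ^ ydeg e) = of_nat (2 ^ b)" by simp
      then have "(2::nat) ^ ydeg e = 2 ^ b" by (simp only: of_nat_eq_iff)
      ultimately show "xdeg e = a \<and> ydeg e = b" by simp
    qed
  next
    assume h: "bihomogeneous a b F"
    have "coeff_at F e * mon e (rescale s t q) = s ^ a * t ^ b * (coeff_at F e * mon e q)" for e s t q
    proof (cases "coeff_at F e = 0")
      case False
      then have "xdeg e = a" "ydeg e = b" using h unfolding bihomogeneous_coeff_at by blast+
      then show ?thesis by (simp add: mon_rescale)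
    qed simp
    then show "biform a b (eval4 F)"
      unfolding biform_def ex sum_distrib_left by (intro conjI allI sum.cong refl pf_rules pf_mon)
  qed
qed

text \<open>
  The monomials of bidegree \<open>(a, b)\<close> are indexed by the exponents of \<open>x0\<close> and \<open>y0\<close>.
\<close>

definition bimon :: "nat \<Rightarrow> nat \<Rightarrow> nat \<times> nat \<Rightarrow> multi" where
  "bimon a b = (\<lambda>(p, q). (p, a - p, q, b - q))"

lemma inj_bimon: "inj_on (bimon a b) A" by (auto simp: inj_on_def bimon_def)

lemma bimon_box: "x \<in> {..a} \<times> {..b} \<Longrightarrow> a + b < N \<Longrightarrow> bimon a b x \<in> box N"
  by (auto simp: bimon_def box_def)

lemma sum_box_bihomogeneous:
  assumes "a + b < N" and c: "\<And>e. c e \<noteq> 0 \<Longrightarrow> xdeg e = a \<and> ydeg e = b"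
  shows "(\<Sum>e\<in>box N. c e * mon e q) = (\<Sum>x\<in>{..a} \<times> {..b}. c (bimon a b x) * mon (bimon a b x) q)"
proof -
  have "(\<Sum>e\<in>box N. c e * mon e q) = (\<Sum>e\<in>bimon a b ` ({..a} \<times> {..b}). c e * mon e q)"
  proof (rule sum.mono_neutral_right)
    show "bimon a b ` ({..a} \<times> {..b}) \<subseteq> box N" using bimon_box assms(1) by blast
    show "\<forall>e\<in>box N - bimon a b ` ({..a} \<times> {..b}). c e * mon e q = 0"
    proof
      fix e assume e: "e \<in> box N - bimon a b ` ({..a} \<times> {..b})"
      obtain i j k l where ee: "e = (i, j, k, l)" by (metis prod.exhaust)
      have "c e = 0"
      proof (rule ccontr)
        assume "c e \<noteq> 0"
        then have "i + j = a" "k + l = b" using c[of e] by (auto simp: xdeg_def ydeg_def ee)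
        then have "e = bimon a b (i, k)" "(i, k) \<in> {..a} \<times> {..b}" by (auto simp: bimon_def ee)
        then show False using e by blast
      qed
      then show "c e * mon e q = 0" by simp
    qed
  qed simp
  also have "\<dots> = (\<Sum>x\<in>{..a} \<times> {..b}. c (bimon a b x) * mon (bimon a b x) q)"
    by (subst sum.reindex[OF inj_bimon]) simp
  finally show ?thesis .
qed

lemma biform_expand:
  assumes "biform a b f"
  shows "\<exists>c. \<forall>q. f q = (\<Sum>x\<in>{..a} \<times> {..b}. c x * mon (bimon a b x) q)"
proof -
  obtain F where F: "f = eval4 F" using assms pf_imp_eval4 unfolding biform_def by blast
  then have h: "bihomogeneous a b F" using assms biform_eval4_iff by simp
  obtain M where M: "\<forall>n\<ge>M. degrees_less n F" using ex_degrees_less by blast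
  define N where "N = max M (a + b + 1)"
  have N: "degrees_less N F" "a + b < N" using M by (auto simp: N_def)
  have supp: "coeff_at F e \<noteq> 0 \<Longrightarrow> xdeg e = a \<and> ydeg e = b" for e using h unfolding bihomogeneous_coeff_at by blast
  have "f q = (\<Sum>x\<in>{..a} \<times> {..b}. coeff_at F (bimon a b x) * mon (bimon a b x) q)" for q
    unfolding F eval4_expand[OF N(1)] by (rule sum_box_bihomogeneous[OF N(2) supp])
  then show ?thesis by (intro exI[of _ "\<lambda>x. coeff_at F (bimon a b x)"]) blast
qed

lemma biform_sum_mon:
  assumes "\<And>x. x \<in> A \<Longrightarrow> c x \<noteq> 0 \<Longrightarrow> xdeg (e x) = a \<and> ydeg (e x) = b"
  shows "biform a b (\<lambda>q. \<Sum>x\<in>A. c x * mon (e x) q)"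
proof -
  have "c x * mon (e x) (rescale s t q) = s ^ a * t ^ b * (c x * mon (e x) q)" if "x \<in> A" for x s t q
    using assms[OF that] by (cases "c x = 0") (auto simp: mon_rescale)
  then show ?thesis unfolding biform_def sum_distrib_left
    by (intro conjI allI pf_rules pf_mon sum.cong refl)
qed

lemma bimon_coeffs_zero:
  assumes z: "\<And>q. (\<Sum>x\<in>{..a} \<times> {..b}. c x * mon (bimon a b x) q) = 0" and x: "x \<in> {..a} \<times> {..b}"
  shows "c x = 0"
proof -
  define N where "N = a + b + 1"
  define c' where "c' = (\<lambda>(i, j, k, l). if i + j = a \<and> k + l = b then c (i, k) else 0)"
  have c': "c' (bimon a b x) = c x" if "x \<in> {..a} \<times> {..b}" for x
    using that by (auto simp: c'_def bimon_def)
  have supp: "c' e \<noteq> 0 \<Longrightarrow> xdeg e = a \<and> ydeg e = b" for e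
    by (auto simp: c'_def xdeg_def ydeg_def split: prod.splits if_splits)
  have "(\<Sum>e\<in>box N. c' e * mon e q) = 0" for q
  proof -
    have "(\<Sum>e\<in>box N. c' e * mon e q) = (\<Sum>x\<in>{..a} \<times> {..b}. c' (bimon a b x) * mon (bimon a b x) q)"
      by (rule sum_box_bihomogeneous) (use supp in \<open>auto simp: N_def\<close>)
    also have "\<dots> = (\<Sum>x\<in>{..a} \<times> {..b}. c x * mon (bimon a b x) q)"
      by (intro sum.cong refl) (simp only: c')
    finally show ?thesis using z by simp
  qed
  from mon_coeffs_zero[OF this bimon_box[OF x]] show ?thesis using c'[OF x] by (simp add: N_def)
qed


section \<open>Factors of bihomogeneous polynomials\<close>

text \<open>
  Orders at \<open>0\<close> and degrees both add up to \<open>n\<close>, and the order is at most the degree; so the order and the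
  degree of \<open>p\<close> agree.
\<close>

lemma factor_of_monom:
  fixes p q :: "complex poly"
  assumes "p * q = monom c n" "c \<noteq> 0" "coeff p i \<noteq> 0"
  shows "i = degree p"
proof -
  have nz: "p * q \<noteq> 0" using assms by simp
  then have "p \<noteq> 0" "q \<noteq> 0" by auto
  then have "degree p + degree q = n" using assms(1,2) degree_mult_eq[of p q] by (simp add: degree_monom_eq)
  moreover have "order 0 p + order 0 q = n"
  proof -
    have "order 0 (monom c n) = n"
    proof (rule antisym)
      show "n \<le> order 0 (monom c n)" using monom_1_dvd_iff[of "monom c n" n] assms(2)
        by (simp add: monom_1_dvd_iff')
      show "order 0 (monom c n) \<le> n" using order_degree[of "monom c n" 0] assms(2) by (simp add: degree_monom_eq)
    qed
    then show ?thesis using order_mult[OF nz, of 0] assms(1) by simp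
  qed
  moreover have "order 0 p \<le> degree p" "order 0 q \<le> degree q" using \<open>p \<noteq> 0\<close> \<open>q \<noteq> 0\<close> by (auto intro: order_degree)
  ultimately have "order 0 p = degree p" by linarith
  then have "monom 1 (degree p) dvd p" using \<open>p \<noteq> 0\<close> by (simp add: monom_1_dvd_iff)
  then have "\<not> i < degree p" using assms(3) by (auto simp: monom_1_dvd_iff')
  moreover have "i \<le> degree p" using assms(3) by (rule le_degree)
  ultimately show ?thesis by simp
qed

text \<open>
  On an orbit of the one-parameter group \<open>act\<close> the product \<open>G * H\<close> restricts to a monomial, hence so does
  \<open>G\<close>.  Two coefficients of \<open>G\<close> of different weights would both be visible on a general orbit.
\<close>

lemma factor_homogeneous:
  fixes w :: "multi \<Rightarrow> nat" and act :: "complex \<Rightarrow> ypoint \<Rightarrow> ypoint"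
  assumes act: "\<And>t e q. mon e (act t q) = t ^ w e * mon e q"
    and hom: "\<And>e. coeff_at (G * H) e \<noteq> 0 \<Longrightarrow> w e = a" and nz: "G * H \<noteq> 0"
    and d: "coeff_at G d \<noteq> 0" "coeff_at G d' \<noteq> 0"
  shows "w d = w d'"
proof (rule ccontr)
  assume ne: "w d \<noteq> w d'"
  obtain N1 N2 N3 where "\<forall>n\<ge>N1. degrees_less n G" "\<forall>n\<ge>N2. degrees_less n H" "\<forall>n\<ge>N3. degrees_less n (G * H)" using ex_degrees_less by metis
  then have N: "degrees_less (N1 + N2 + N3) G" "degrees_less (N1 + N2 + N3) H" "degrees_less (N1 + N2 + N3) (G * H)" by auto
  define N where "N = N1 + N2 + N3"
  note N = N[folded N_def]
  define L where "L = (\<lambda>G q. \<Sum>e\<in>box N. monom (coeff_at G e * mon e q) (w e))"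
  have L: "eval4 F (act t q) = poly (L F q) t" if "degrees_less N F" for F t q
    by (simp add: eval4_expand[OF that] act L_def poly_sum poly_monom mult_ac)
  have coeffL: "(\<lambda>q. coeff (L F q) k) = (\<lambda>q. \<Sum>e\<in>box N. (if w e = k then coeff_at F e else 0) * mon e q)" for F k
    by (auto simp: L_def coeff_sum fun_eq_iff intro!: sum.cong)
  have pf: "pf (\<lambda>q. coeff (L G q) k)" for k unfolding coeffL by (intro pf_rules pf_mon)
  have nzc: "\<exists>q. coeff (L G q) (w d) \<noteq> 0" if "coeff_at G d \<noteq> 0" for d
  proof (rule ccontr)
    assume "\<not> ?thesis"
    then have "(\<Sum>e\<in>box N. (if w e = w d then coeff_at G e else 0) * mon e q) = 0" for q
      using fun_cong[OF coeffL[of G "w d"], of q] by metis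
    moreover have "d \<in> box N" using that coeff_at_zero_outside[OF N(1)] by blast
    ultimately have "(if w d = w d then coeff_at G d else 0) = 0"
      using mon_coeffs_zero[where c = "\<lambda>e. if w e = w d then coeff_at G e else 0"] by blast
    then show False using that by simp
  qed
  obtain q1 q2 where "coeff (L G q1) (w d) \<noteq> 0" "coeff (L G q2) (w d') \<noteq> 0" using nzc d by blast
  from pf_common_nonzero[OF pf pf this] obtain q3
    where q3: "coeff (L G q3) (w d) * coeff (L G q3) (w d') \<noteq> 0" by auto
  have "eval4 (G * H) \<noteq> eval4 0" using eval4_inject nz by blast
  then obtain q4 where q4: "eval4 (G * H) q4 \<noteq> 0" by (auto simp: eval4_alt fun_eq_iff)
  obtain q where q: "coeff (L G q) (w d) * coeff (L G q) (w d') \<noteq> 0" "eval4 (G * H) q \<noteq> 0"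
    using pf_common_nonzero[OF pf_mult[OF pf pf] pf_eval4 q3 q4] by blast
  have "poly (L G q * L H q) t = poly (monom (eval4 (G * H) q) a) t" for t
  proof -
    have "coeff_at (G * H) e * mon e (act t q) = t ^ a * (coeff_at (G * H) e * mon e q)" for e
      using hom[of e] by (cases "coeff_at (G * H) e = 0") (auto simp: act)
    then have "eval4 (G * H) (act t q) = t ^ a * eval4 (G * H) q"
      unfolding eval4_expand[OF N(3)] sum_distrib_left by (intro sum.cong refl)
    then show ?thesis by (simp add: eval4_mult L[OF N(1)] L[OF N(2)] poly_monom mult.commute)
  qed
  then have "L G q * L H q = monom (eval4 (G * H) q) a" by (simp add: poly_eq_poly_eq_iff[symmetric] fun_eq_iff)
  from factor_of_monom[OF this q(2)] q(1) have "w d = degree (L G q)" "w d' = degree (L G q)" by auto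
  then show False using ne by simp
qed

lemma mon_rescale_x: "mon e (rescale t 1 q) = t ^ xdeg e * mon e q"
  and mon_rescale_y: "mon e (rescale 1 t q) = t ^ ydeg e * mon e q"
  by (simp_all add: mon_rescale)

lemma coeff_at_nonzero: "F \<noteq> 0 \<Longrightarrow> \<exists>e. coeff_at F e \<noteq> 0"
proof (rule ccontr)
  assume "F \<noteq> 0" "\<nexists>e. coeff_at F e \<noteq> 0"
  then have "F = 0" by (intro poly4_eqI) (auto simp: coeff_at_def coeff4_def split: prod.splits)
  then show False using \<open>F \<noteq> 0\<close> by simp
qed

lemma factor_bihomogeneous:
  assumes "bihomogeneous a b (G * H)" "G * H \<noteq> 0"
  shows "\<exists>a' b'. bihomogeneous a' b' G"
proof -
  have "G \<noteq> 0" using assms by auto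
  then obtain d where d: "coeff_at G d \<noteq> 0" using coeff_at_nonzero by blast
  have "xdeg e = xdeg d" if "coeff_at G e \<noteq> 0" for e
    by (rule factor_homogeneous[OF mon_rescale_x _ assms(2) that d]) (use assms in \<open>auto simp: bihomogeneous_coeff_at\<close>)
  moreover have "ydeg e = ydeg d" if "coeff_at G e \<noteq> 0" for e
    by (rule factor_homogeneous[OF mon_rescale_y _ assms(2) that d]) (use assms in \<open>auto simp: bihomogeneous_coeff_at\<close>)
  ultimately show ?thesis by (auto simp: bihomogeneous_coeff_at)
qed

lemma bihomogeneous_unique:
  assumes "bihomogeneous a b F" "bihomogeneous a' b' F" "F \<noteq> 0" shows "a = a'" "b = b'"
  using coeff_at_nonzero[OF assms(3)] assms(1,2) by (auto simp: bihomogeneous_coeff_at)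

lemma biform_mult: "biform a b f \<Longrightarrow> biform a' b' g \<Longrightarrow> biform (a + a') (b + b') (\<lambda>q. f q * g q)"
  by (auto simp: biform_def power_add intro: pf_mult)

lemma bihomogeneous_mult:
  assumes "bihomogeneous a b F" "bihomogeneous a' b' G" shows "bihomogeneous (a + a') (b + b') (F * G)"
proof -
  have "eval4 (F * G) = (\<lambda>q. eval4 F q * eval4 G q)" by (auto simp: eval4_mult)
  then show ?thesis using assms biform_mult by (simp flip: biform_eval4_iff)
qed

lemma factors_bihomogeneous:
  assumes "bihomogeneous a b (G * H)" "G * H \<noteq> 0"
  obtains a1 b1 a2 b2 where "bihomogeneous a1 b1 G" "bihomogeneous a2 b2 H" "a1 + a2 = a" "b1 + b2 = b"
proof -
  obtain a1 b1 where 1: "bihomogeneous a1 b1 G" using factor_bihomogeneous[OF assms] by blast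
  obtain a2 b2 where 2: "bihomogeneous a2 b2 H" using factor_bihomogeneous[of a b H G] assms by (auto simp: mult.commute)
  from bihomogeneous_unique[OF bihomogeneous_mult[OF 1 2] assms] show ?thesis using that 1 2 by blast
qed

lemma bihomogeneous_0_0:
  assumes "bihomogeneous 0 0 F"
  obtains c where "F = [:[:[:[:c:]:]:]:]"
proof -
  have "biform 0 0 (eval4 F)" using assms by (simp add: biform_eval4_iff)
  then have "eval4 F q = eval4 F (rescale 0 0 q)" for q by (simp add: biform_rescale)
  moreover have "rescale 0 0 q = ((0, 0), (0, 0))" for q by (simp add: rescale_def split: prod.splits)
  ultimately have "eval4 F q = eval4 F ((0, 0), (0, 0))" for q by metis
  then have "eval4 F = eval4 [:[:[:[:eval4 F ((0, 0), (0, 0)):]:]:]:]" by (auto simp: eval4_alt fun_eq_iff)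
  then show ?thesis using that eval4_inject by blast
qed

lemma bihomogeneous_unit:
  assumes "bihomogeneous a b F" "is_unit F" shows "a = 0" "b = 0"
proof -
  obtain G where G: "1 = F * G" using assms(2) by (auto elim: dvdE)
  have "biform 0 0 (eval4 1)" by (simp add: biform_def pf_eval4) (simp add: eval4_alt)
  then have "bihomogeneous 0 0 (F * G)" using G by (simp add: biform_eval4_iff)
  then obtain a1 b1 where "bihomogeneous a1 b1 F" "a1 = 0" "b1 = 0"
    using factors_bihomogeneous[of 0 0 F G] G by (metis add_is_0 zero_neq_one)
  moreover have "F \<noteq> 0" using G by auto
  ultimately show "a = 0" "b = 0" using bihomogeneous_unique[OF assms(1)] by auto
qed

lemma multiplicity_const: "c \<noteq> 0 \<Longrightarrow> multiplicity_at [:[:[:[:c:]:]:]:] q = 0"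
proof -
  assume "c \<noteq> 0"
  then have "\<exists>i j k l. i + j + k + l = 0 \<and> eval4 (partial4 i j k l [:[:[:[:c:]:]:]:]) q \<noteq> 0"
    by (auto simp: partial4_def eval4_alt)
  then show ?thesis unfolding multiplicity_at_def using Least_le[of _ 0] by fastforce
qed

text \<open>
  Irreducible curves control all curves: bidegrees add up over the components, and multiplicities are
  subadditive.
\<close>

lemma nef_imp_all_curves:
  fixes e1 e2 \<gamma> :: real
  assumes irr: "\<And>F a b. irreducible F \<Longrightarrow> bihomogeneous a b F \<Longrightarrow>
      \<gamma> * (\<Sum>i<r. real (multiplicity_at F (P i))) \<le> e1 * real b + e2 * real a"
    and \<gamma>: "\<gamma> \<ge> 0" and F: "bihomogeneous a b F" "F \<noteq> 0"
  shows "\<gamma> * (\<Sum>i<r. real (multiplicity_at F (P i))) \<le> e1 * real b + e2 * real a"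
  using F
proof (induction "a + b" arbitrary: a b F rule: less_induct)
  case less
  show ?case
  proof (cases "a + b = 0")
    case True
    then have "bihomogeneous 0 0 F" using less.prems(1) by simp
    then obtain c where "F = [:[:[:[:c:]:]:]:]" using bihomogeneous_0_0 by blast
    then show ?thesis using less.prems True by (auto simp: multiplicity_const)
  next
    case False
    then have nu: "\<not> is_unit F" using bihomogeneous_unit[OF less.prems(1)] by auto
    show ?thesis
    proof (cases "irreducible F")
      case False
      then obtain G H where GH: "F = G * H" "\<not> is_unit G" "\<not> is_unit H"
        using nu less.prems by (auto simp: irreducible_def)
      then obtain a1 b1 a2 b2 where h: "bihomogeneous a1 b1 G" "bihomogeneous a2 b2 H" "a1 + a2 = a" "b1 + b2 = b"
        using factors_bihomogeneous less.prems by blast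
      have pos: "a + b > 0" if "bihomogeneous a b F" "\<not> is_unit F" "F \<noteq> 0" for a b F
      proof (rule ccontr)
        assume "\<not> ?thesis"
        then have "bihomogeneous 0 0 F" using that(1) by simp
        then obtain c where c: "F = [:[:[:[:c:]:]:]:]" using bihomogeneous_0_0 by blast
        then have "1 = F * [:[:[:[:1 / c:]:]:]:]" using that(3) by (auto simp: one_pCons)
        then show False using that(2) by (metis dvdI)
      qed
      have nz: "G \<noteq> 0" "H \<noteq> 0" using GH less.prems by auto
      have "a1 + b1 < a + b" "a2 + b2 < a + b" using pos[OF h(1)] pos[OF h(2)] GH nz h by auto
      then have "\<gamma> * (\<Sum>i<r. real (multiplicity_at G (P i))) \<le> e1 * real b1 + e2 * real a1"
        "\<gamma> * (\<Sum>i<r. real (multiplicity_at H (P i))) \<le> e1 * real b2 + e2 * real a2"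
        using less.hyps h nz by blast+
      moreover have "(\<Sum>i<r. real (multiplicity_at F (P i))) \<le>
          (\<Sum>i<r. real (multiplicity_at G (P i))) + (\<Sum>i<r. real (multiplicity_at H (P i)))"
        unfolding sum.distrib[symmetric] GH
        by (intro sum_mono) (use multiplicity_mult_le[OF nz] in \<open>simp flip: of_nat_add\<close>)
      then have "\<gamma> * (\<Sum>i<r. real (multiplicity_at F (P i))) \<le>
          \<gamma> * ((\<Sum>i<r. real (multiplicity_at G (P i))) + (\<Sum>i<r. real (multiplicity_at H (P i))))"
        using \<gamma> by (rule mult_left_mono)
      ultimately show ?thesis using h(3,4) by (auto simp: algebra_simps)
    qed (use irr less.prems in blast)
  qed
qed


section \<open>A system of linear equations has a nonzero solution iff its maximal minors vanish\<close>

lemma det_repeated_column: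
  fixes A :: "nat \<Rightarrow> nat \<Rightarrow> complex"
  assumes "x < k" "y < k" "x \<noteq> y" "\<kappa> x = \<kappa> y"
  shows "det (mat k k (\<lambda>(i, j). A i (\<kappa> j))) = 0"
proof -
  let ?M = "mat k k (\<lambda>(i, j). A i (\<kappa> j))"
  have "det ?M = det (?M\<^sup>T)" by (rule det_transpose[symmetric, where n = k]) simp
  also have "\<dots> = 0"
    by (rule det_identical_rows[of _ k x y]) (use assms in auto)
  finally show ?thesis .
qed

lemma solution_imp_minors_zero:
  fixes A :: "'r \<Rightarrow> nat \<Rightarrow> complex"
  assumes c: "e < n" "c e \<noteq> 0" and sol: "\<And>\<rho>. \<rho> \<in> R \<Longrightarrow> (\<Sum>e<n. c e * A \<rho> e) = 0"
    and \<rho>: "\<And>x. x < n \<Longrightarrow> \<rho> x \<in> R" and \<kappa>: "\<And>x. x < n \<Longrightarrow> \<kappa> x < n"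
  shows "det (mat n n (\<lambda>(i, j). A (\<rho> i) (\<kappa> j))) = 0"
proof (cases "inj_on \<kappa> {..<n}")
  case False
  then obtain x y where "x < n" "y < n" "x \<noteq> y" "\<kappa> x = \<kappa> y" by (auto simp: inj_on_def)
  then show ?thesis by (rule det_repeated_column[of _ _ _ _ "\<lambda>i. A (\<rho> i)"])
next
  case True
  have bij: "bij_betw \<kappa> {..<n} {..<n}"
    using True \<kappa> by (simp add: bij_betw_def endo_inj_surj image_subset_iff)
  let ?M = "mat n n (\<lambda>(i, j). A (\<rho> i) (\<kappa> j))"
  define v where "v = vec n (\<lambda>j. c (\<kappa> j))"
  have "?M *\<^sub>v v = 0\<^sub>v n"
  proof (rule eq_vecI)
    fix i assume "i < dim_vec (0\<^sub>v n)"
    then have i: "i < n" by simp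
    have "vec_index (?M *\<^sub>v v) i = (\<Sum>j<n. A (\<rho> i) (\<kappa> j) * c (\<kappa> j))"
      using i by (simp add: v_def scalar_prod_def lessThan_atLeast0)
    also have "\<dots> = (\<Sum>e<n. A (\<rho> i) e * c e)" by (rule sum.reindex_bij_betw[OF bij])
    finally show "vec_index (?M *\<^sub>v v) i = vec_index (0\<^sub>v n) i" using sol[OF \<rho>[OF i]] i by (simp add: mult.commute)
  qed simp
  moreover have "v \<noteq> 0\<^sub>v n"
  proof
    assume v0: "v = 0\<^sub>v n"
    obtain j where j: "j < n" "\<kappa> j = e" using bij c(1) by (auto simp: bij_betw_def image_iff) (metis imageE lessThan_iff)
    then have "vec_index v j \<noteq> 0" using c by (simp add: v_def)
    then show False using v0 j by simp
  qed
  moreover have "v \<in> carrier_vec n" "?M \<in> carrier_mat n n" by (simp_all add: v_def)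
  ultimately show ?thesis using det_0_iff_vec_prod_zero[of ?M n] by blast
qed

text \<open>
  A nonzero minor of maximal size is bordered by one more column and a variable row.  The bordered minor
  vanishes, and its expansion along the variable row says that the cofactors of that row, which do not
  depend on it, solve every equation.  One of these cofactors is the minor itself.
\<close>

lemma minors_zero_imp_solution:
  fixes A :: "'r \<Rightarrow> nat \<Rightarrow> complex"
  assumes minors: "\<And>\<rho> \<kappa>. (\<And>x. x < n \<Longrightarrow> \<rho> x \<in> R) \<Longrightarrow> (\<And>x. x < n \<Longrightarrow> \<kappa> x < n) \<Longrightarrow>
      det (mat n n (\<lambda>(i, j). A (\<rho> i) (\<kappa> j))) = 0"
  shows "\<exists>c. (\<exists>e<n. c e \<noteq> 0) \<and> (\<forall>\<rho>\<in>R. (\<Sum>e<n. c e * A \<rho> e) = 0)"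
proof -
  define good where "good = (\<lambda>k. \<exists>\<rho> \<kappa>. (\<forall>x<k. \<rho> x \<in> R \<and> \<kappa> x < n) \<and> det (mat k k (\<lambda>(i, j). A (\<rho> i) (\<kappa> j))) \<noteq> 0)"
  have g0: "good 0" by (auto simp: good_def)
  have gn: "\<not> good n" using minors by (auto simp: good_def)
  have "\<exists>k<n. good k \<and> \<not> good (Suc k)"
  proof (rule ccontr)
    assume "\<not> ?thesis"
    then have "good k" if "k \<le> n" for k using that g0 by (induction k) auto
    then show False using gn by simp
  qed
  then obtain k where k: "k < n" "good k" "\<not> good (Suc k)" by blast
  obtain \<rho> \<kappa> where rk: "\<And>x. x < k \<Longrightarrow> \<rho> x \<in> R" "\<And>x. x < k \<Longrightarrow> \<kappa> x < n"
    and nz: "det (mat k k (\<lambda>(i, j). A (\<rho> i) (\<kappa> j))) \<noteq> 0" using k(2) by (auto simp: good_def)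
  have inj: "inj_on \<kappa> {..<k}"
  proof (rule inj_onI, rule ccontr)
    fix x y assume "x \<in> {..<k}" "y \<in> {..<k}" "\<kappa> x = \<kappa> y" "x \<noteq> y"
    then show False using nz det_repeated_column[of x k y \<kappa> "\<lambda>i. A (\<rho> i)"] by simp
  qed
  have "\<not> {..<n} \<subseteq> \<kappa> ` {..<k}"
  proof
    assume "{..<n} \<subseteq> \<kappa> ` {..<k}"
    then have "card {..<n} \<le> card (\<kappa> ` {..<k})" by (intro card_mono) auto
    then show False using k(1) card_image_le[of "{..<k}" \<kappa>] by simp
  qed
  then obtain e where e: "e < n" "e \<notin> \<kappa> ` {..<k}" by blast
  define \<kappa>' where "\<kappa>' = \<kappa>(k := e)"
  have \<kappa>': "\<kappa>' x < n" if "x < Suc k" for x using that rk(2) e by (auto simp: \<kappa>'_def less_Suc_eq)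
  have inj': "inj_on \<kappa>' {..<Suc k}"
    using inj e(2) by (auto simp: \<kappa>'_def inj_on_def less_Suc_eq image_iff)
  define M where "M = (\<lambda>\<sigma>. mat (Suc k) (Suc k) (\<lambda>(i, j). A ((\<rho>(k := \<sigma>)) i) (\<kappa>' j)))"
  have Mc: "M \<sigma> \<in> carrier_mat (Suc k) (Suc k)" for \<sigma> by (simp add: M_def)
  have Mk: "M \<sigma> $$ (k, j) = A \<sigma> (\<kappa>' j)" if "j < Suc k" for \<sigma> j using that by (simp add: M_def)
  define cof where "cof = (\<lambda>j. cofactor (M undefined) k j)"
  have del: "mat_delete (M \<sigma>) k j = mat_delete (M undefined) k j" if "j < Suc k" for \<sigma> j
    by (rule eq_matI) (auto simp: mat_delete_def M_def)
  have cof: "cofactor (M \<sigma>) k j = cof j" if "j < Suc k" for \<sigma> j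
    unfolding cof_def cofactor_def using del[OF that, of \<sigma>] by simp
  have "mat_delete (M undefined) k k = mat k k (\<lambda>(i, j). A (\<rho> i) (\<kappa> j))"
    by (rule eq_matI) (auto simp: mat_delete_def M_def \<kappa>'_def)
  then have cofk: "cof k \<noteq> 0" using nz by (simp add: cof_def cofactor_def)
  define c where "c = (\<lambda>f. if f \<in> \<kappa>' ` {..<Suc k} then cof (the_inv_into {..<Suc k} \<kappa>' f) else 0)"
  have c\<kappa>: "c (\<kappa>' j) = cof j" if "j < Suc k" for j
    using that inj' by (auto simp: c_def the_inv_into_f_f)
  have "c e \<noteq> 0" using c\<kappa>[of k] cofk by (simp add: \<kappa>'_def)
  moreover have "(\<Sum>f<n. c f * A \<sigma> f) = 0" if "\<sigma> \<in> R" for \<sigma>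
  proof -
    have "(\<Sum>f<n. c f * A \<sigma> f) = (\<Sum>f\<in>\<kappa>' ` {..<Suc k}. c f * A \<sigma> f)"
      by (rule sum.mono_neutral_right) (use \<kappa>' in \<open>auto simp: c_def\<close>)
    also have "\<dots> = (\<Sum>j<Suc k. c (\<kappa>' j) * A \<sigma> (\<kappa>' j))"
      by (subst sum.reindex[OF inj']) simp
    also have "\<dots> = (\<Sum>j<Suc k. M \<sigma> $$ (k, j) * cofactor (M \<sigma>) k j)"
      by (intro sum.cong refl) (simp add: c\<kappa> cof Mk mult.commute)
    also have "\<dots> = det (M \<sigma>)" using laplace_expansion_row[OF Mc, of k] by simp
    also have "\<dots> = 0"
    proof (rule ccontr)
      assume "det (M \<sigma>) \<noteq> 0"
      moreover have "\<forall>x<Suc k. (\<rho>(k := \<sigma>)) x \<in> R \<and> \<kappa>' x < n" using rk(1) \<kappa>' that by (auto simp: less_Suc_eq)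
      ultimately have "good (Suc k)" unfolding good_def M_def by blast
      then show False using k(3) by simp
    qed
    finally show ?thesis .
  qed
  ultimately show ?thesis using e(1) by blast
qed


section \<open>Effectivity is a closed condition on the points\<close>

definition has_section :: "nat \<Rightarrow> (nat \<Rightarrow> ypoint) \<Rightarrow> nat \<Rightarrow> nat \<Rightarrow> (nat \<Rightarrow> nat) \<Rightarrow> bool" where
  "has_section r P a b m \<longleftrightarrow> (\<exists>f. biform a b f \<and> (\<exists>q. f q \<noteq> 0) \<and> (\<forall>i<r. vanish (m i) f (P i)))"

lemma hasse_bihomogeneous:
  "hasse e d (rescale s t q) = s ^ (xdeg e - xdeg d) * t ^ (ydeg e - ydeg d) * hasse e d q"
proof -
  obtain i j k l where e: "e = (i, j, k, l)" by (metis prod.exhaust)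
  obtain i' j' k' l' where d: "d = (i', j', k', l')" by (metis prod.exhaust)
  obtain x0 x1 y0 y1 where q: "q = ((x0, x1), (y0, y1))" by (metis prod.exhaust)
  show ?thesis
  proof (cases "i' \<le> i \<and> j' \<le> j \<and> k' \<le> k \<and> l' \<le> l")
    case True
    then have "i + j - (i' + j') = (i - i') + (j - j')" "k + l - (k' + l') = (k - k') + (l - l')" by auto
    then show ?thesis by (simp add: hasse_def rescale_def xdeg_def ydeg_def e d q power_add power_mult_distrib)
  next
    case False
    then have "(i choose i') = 0 \<or> (j choose j') = 0 \<or> (k choose k') = 0 \<or> (l choose l') = 0" by auto
    then show ?thesis by (auto simp: hasse_def rescale_def e d q)
  qed
qed

lemma pf_hasse: "pf (hasse e d)"
proof -
  obtain i j k l where e: "e = (i, j, k, l)" by (metis prod.exhaust)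
  obtain i' j' k' l' where d: "d = (i', j', k', l')" by (metis prod.exhaust)
  have "hasse e d = (\<lambda>q.
     (of_nat (i choose i') * fst (fst q) ^ (i - i')) * (of_nat (j choose j') * snd (fst q) ^ (j - j')) *
     (of_nat (k choose k') * fst (snd q) ^ (k - k')) * (of_nat (l choose l') * snd (snd q) ^ (l - l')))"
    by (auto simp: hasse_def e d fun_eq_iff)
  then show ?thesis by (auto intro!: pf_rules)
qed

lemma prod_collect_exponents:
  fixes s :: "nat \<Rightarrow> complex" and n :: nat
  assumes "\<And>x. x < n \<Longrightarrow> g x < r"
  shows "(\<Prod>x<n. s (g x) ^ u x) = (\<Prod>i<r. s i ^ (\<Sum>x\<in>{x \<in> {..<n}. g x = i}. u x))"
proof -
  have "(\<Prod>x<n. s (g x) ^ u x) = (\<Prod>i<r. \<Prod>x\<in>{x \<in> {..<n}. g x = i}. s (g x) ^ u x)"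
    by (rule prod.group[symmetric]) (use assms in auto)
  also have "\<dots> = (\<Prod>i<r. s i ^ (\<Sum>x\<in>{x \<in> {..<n}. g x = i}. u x))"
    by (intro prod.cong refl) (simp add: power_sum)
  finally show ?thesis .
qed

lemma permutes_lt: "p permutes {0..<n} \<Longrightarrow> x < n \<Longrightarrow> p x < n" for n :: nat
  using permutes_in_image[of p "{0..<n}" x] by simp

text \<open>
  Rescaling the coordinates of the points multiplies each row by a power that depends on the row only,
  since all columns have the same bidegree.
\<close>

lemma multihomogeneous_minor:
  assumes g: "\<And>x. x < n \<Longrightarrow> g x < r"
    and E: "\<And>y. y < n \<Longrightarrow> xdeg (E y) = a \<and> ydeg (E y) = b"
  shows "multihomogeneous r (\<lambda>P. det (mat n n (\<lambda>(x, y). hasse (E y) (d x) (P (g x)))))"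
proof -
  let ?f = "\<lambda>P. det (mat n n (\<lambda>(x, y). hasse (E y) (d x) (P (g x))))"
  have det: "?f P = (\<Sum>p\<in>{p. p permutes {0..<n}}. signof p * (\<Prod>x = 0..<n. hasse (E (p x)) (d x) (P (g x))))" for P
    by (subst det_def'[of _ n])
      (auto intro!: sum.cong prod.cong arg_cong2[of _ _ _ _ "(*)"] simp: permutes_lt)
  have "polyfun r ?f" unfolding det
    by (intro polyfun_sum polyfun.mult polyfun.const polyfun_prod pf_imp_polyfun pf_hasse g) auto
  moreover have "?f (\<lambda>i. rescale (s i) (t i) (P i)) =
      (\<Prod>i<r. s i ^ (\<Sum>x\<in>{x \<in> {..<n}. g x = i}. a - xdeg (d x)) *
        t i ^ (\<Sum>x\<in>{x \<in> {..<n}. g x = i}. b - ydeg (d x))) * ?f P" for s t P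
  proof -
    have "(\<Prod>x = 0..<n. hasse (E (p x)) (d x) (rescale (s (g x)) (t (g x)) (P (g x)))) =
       (\<Prod>x<n. s (g x) ^ (a - xdeg (d x))) * (\<Prod>x<n. t (g x) ^ (b - ydeg (d x))) *
       (\<Prod>x = 0..<n. hasse (E (p x)) (d x) (P (g x)))" if "p permutes {0..<n}" for p
      unfolding hasse_bihomogeneous prod.distrib[symmetric] lessThan_atLeast0
      by (intro prod.cong refl) (use E permutes_lt[OF that] in auto)
    then have "?f (\<lambda>i. rescale (s i) (t i) (P i)) =
      ((\<Prod>x<n. s (g x) ^ (a - xdeg (d x))) * (\<Prod>x<n. t (g x) ^ (b - ydeg (d x)))) * ?f P"
      unfolding det[of "\<lambda>i. rescale (s i) (t i) (P i)"] det[of P] sum_distrib_left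
      by (intro sum.cong refl) (simp add: mult_ac)
    moreover have "(\<Prod>x<n. s (g x) ^ (a - xdeg (d x))) = (\<Prod>i<r. s i ^ (\<Sum>x\<in>{x \<in> {..<n}. g x = i}. a - xdeg (d x)))"
      "(\<Prod>x<n. t (g x) ^ (b - ydeg (d x))) = (\<Prod>i<r. t i ^ (\<Sum>x\<in>{x \<in> {..<n}. g x = i}. b - ydeg (d x)))"
      by (rule prod_collect_exponents; rule g; assumption)+
    ultimately show ?thesis by (simp only: prod.distrib)
  qed
  ultimately show ?thesis unfolding multihomogeneous_def by (intro conjI exI allI)
qed

definition bimon_index :: "nat \<Rightarrow> nat \<Rightarrow> nat \<Rightarrow> nat \<times> nat" where
  "bimon_index a b n = (n div Suc b, n mod Suc b)"

lemma bij_bimon_index: "bij_betw (bimon_index a b) {..<Suc a * Suc b} ({..a} \<times> {..b})"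
proof (rule bij_betw_byWitness[where f' = "\<lambda>(p, q). p * Suc b + q"])
  show "bimon_index a b ` {..<Suc a * Suc b} \<subseteq> {..a} \<times> {..b}"
    unfolding bimon_index_def
    by (auto simp: less_Suc_eq_le[symmetric] simp del: mult_Suc mult_Suc_right intro: less_mult_imp_div_less)
  show "(\<lambda>(p, q). p * Suc b + q) ` ({..a} \<times> {..b}) \<subseteq> {..<Suc a * Suc b}"
  proof
    fix x assume "x \<in> (\<lambda>(p, q). p * Suc b + q) ` ({..a} \<times> {..b})"
    then obtain p q where pq: "p \<in> {..a}" "q \<in> {..b}" and x: "x = p * Suc b + q" by auto
    then have "p * Suc b + q < Suc p * Suc b" "Suc p * Suc b \<le> Suc a * Suc b"
      by (auto simp del: mult_Suc_right intro!: add_mono mult_right_mono)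
    then show "x \<in> {..<Suc a * Suc b}" unfolding x lessThan_iff by (rule less_le_trans)
  qed
qed (auto simp: bimon_index_def div_mult_self3 simp del: mult_Suc mult_Suc_right)

text \<open>
  Prescribed orders of vanishing are linear equations for the coefficients of a form, with matrix entries
  polynomial in the coordinates of the points.  A nonzero form exists iff the maximal minors vanish.
\<close>

lemma has_section_closed:
  "\<exists>S. (\<forall>f\<in>S. multihomogeneous r f) \<and> (\<forall>P. has_section r P a b m \<longleftrightarrow> (\<forall>f\<in>S. f P = 0))"
proof -
  define n where "n = Suc a * Suc b"
  define E where "E = (\<lambda>e. bimon a b (bimon_index a b e))"
  define N where "N = Suc (a + b)"
  define R where "R = {\<rho>. fst \<rho> < r \<and> snd \<rho> \<in> box N \<and> total_degree (snd \<rho>) < m (fst \<rho>)}"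
  define minor where "minor = (\<lambda>(\<rho> :: nat \<Rightarrow> nat \<times> multi) (\<kappa> :: nat \<Rightarrow> nat) P.
     det (mat n n (\<lambda>(x, y). hasse (E (\<kappa> y)) (snd (\<rho> x)) (P (fst (\<rho> x))))))"
  define S where "S = {minor \<rho> \<kappa> | \<rho> \<kappa>. \<forall>x<n. \<rho> x \<in> R \<and> \<kappa> x < n}"
  have range: "bimon_index a b e \<in> {..a} \<times> {..b}" if "e < n" for e
    using bij_bimon_index[of a b] that by (auto simp: bij_betw_def n_def)
  have EN: "E e \<in> box N" "xdeg (E e) = a \<and> ydeg (E e) = b" if "e < n" for e
    using bimon_box[OF range[OF that], of N] range[OF that]
    by (auto simp: E_def N_def bimon_def xdeg_def ydeg_def split: prod.splits)
  have reindex: "(\<Sum>e<n. c (bimon_index a b e) * mon (E e) q) = (\<Sum>x\<in>{..a} \<times> {..b}. c x * mon (bimon a b x) q)" for c q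
    unfolding E_def n_def by (rule sum.reindex_bij_betw[OF bij_bimon_index])
  have "multihomogeneous r f" if fS: "f \<in> S" for f
  proof -
    obtain \<rho> \<kappa> where rk: "\<forall>x<n. \<rho> x \<in> R \<and> \<kappa> x < n" and f: "f = minor \<rho> \<kappa>"
      using fS unfolding S_def by blast
    show ?thesis unfolding f minor_def
      by (rule multihomogeneous_minor[where g = "\<lambda>x. fst (\<rho> x)" and E = "\<lambda>y. E (\<kappa> y)" and a = a and b = b])
        (use rk EN(2) in \<open>auto simp: R_def\<close>)
  qed
  moreover have "has_section r P a b m \<longleftrightarrow> (\<forall>f\<in>S. f P = 0)" for P
  proof -
    define A where "A = (\<lambda>\<rho> e. hasse (E e) (snd \<rho>) (P (fst \<rho>)))"
    have van: "(\<forall>i<r. vanish (m i) (\<lambda>q. \<Sum>e<n. c e * mon (E e) q) (P i)) \<longleftrightarrow> (\<forall>\<rho>\<in>R. (\<Sum>e<n. c e * A \<rho> e) = 0)" for c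
    proof -
      have T: "(\<Sum>e<n. c e * mon (E e) (translate q v)) = (\<Sum>d\<in>box N. (\<Sum>e<n. c e * hasse (E e) d q) * mon d v)" for q v
        by (rule taylor_of_sum[where A = "{..<n}" and c = c and e = E]) (use EN in auto)
      have "vanish (m i) (\<lambda>q. \<Sum>e<n. c e * mon (E e) q) (P i) \<longleftrightarrow>
          (\<forall>d\<in>box N. total_degree d < m i \<longrightarrow> (\<Sum>e<n. c e * hasse (E e) d (P i)) = 0)" for i
        using vanish_imp_taylor[OF T[of "P i"]] taylor_imp_vanish[OF T[of "P i"]] by blast
      then show ?thesis by (auto simp: R_def A_def)
    qed
    have "has_section r P a b m \<longleftrightarrow> (\<exists>c. (\<exists>e<n. c e \<noteq> 0) \<and> (\<forall>\<rho>\<in>R. (\<Sum>e<n. c e * A \<rho> e) = 0))"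
    proof
      assume "has_section r P a b m"
      then obtain f q where f: "biform a b f" "f q \<noteq> 0" "\<forall>i<r. vanish (m i) f (P i)" by (auto simp: has_section_def)
      obtain c where c: "\<And>q. f q = (\<Sum>x\<in>{..a} \<times> {..b}. c x * mon (bimon a b x) q)" using biform_expand[OF f(1)] by blast
      have fc: "f = (\<lambda>q. \<Sum>e<n. c (bimon_index a b e) * mon (E e) q)" by (rule ext) (simp only: c reindex)
      have "\<exists>e<n. c (bimon_index a b e) \<noteq> 0"
      proof (rule ccontr)
        assume "\<not> ?thesis"
        then show False using f(2) by (simp add: fc)
      qed
      moreover have "\<forall>\<rho>\<in>R. (\<Sum>e<n. c (bimon_index a b e) * A \<rho> e) = 0"
        using f(3) unfolding fc van .
      ultimately show "\<exists>c. (\<exists>e<n. c e \<noteq> 0) \<and> (\<forall>\<rho>\<in>R. (\<Sum>e<n. c e * A \<rho> e) = 0)"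
        by (intro exI[of _ "\<lambda>e. c (bimon_index a b e)"] conjI)
    next
      assume "\<exists>c. (\<exists>e<n. c e \<noteq> 0) \<and> (\<forall>\<rho>\<in>R. (\<Sum>e<n. c e * A \<rho> e) = 0)"
      then obtain c e where c: "e < n" "c e \<noteq> 0" "\<forall>\<rho>\<in>R. (\<Sum>e<n. c e * A \<rho> e) = 0" by blast
      let ?f = "\<lambda>q. \<Sum>e<n. c e * mon (E e) q"
      have "biform a b ?f" by (rule biform_sum_mon) (use EN in auto)
      moreover have "\<exists>q. ?f q \<noteq> 0"
      proof (rule ccontr)
        assume z: "\<not> ?thesis"
        define c' where "c' = (\<lambda>x. c (the_inv_into {..<n} (bimon_index a b) x))"
        have inj: "inj_on (bimon_index a b) {..<n}" using bij_bimon_index by (auto simp: bij_betw_def n_def)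
        have c': "c' (bimon_index a b e) = c e" if "e < n" for e
          using that the_inv_into_f_f[OF inj] by (simp add: c'_def)
        have "(\<Sum>x\<in>{..a} \<times> {..b}. c' x * mon (bimon a b x) q) = 0" for q
        proof -
          have "(\<Sum>e<n. c' (bimon_index a b e) * mon (E e) q) = (\<Sum>e<n. c e * mon (E e) q)"
            by (intro sum.cong refl) (simp add: c')
          then show ?thesis unfolding reindex using z by metis
        qed
        from bimon_coeffs_zero[OF this range[OF c(1)]] show False using c' c by simp
      qed
      ultimately show "has_section r P a b m" using c(3) van unfolding has_section_def by blast
    qed
    also have "\<dots> \<longleftrightarrow> (\<forall>\<rho> \<kappa>. (\<forall>x<n. \<rho> x \<in> R \<and> \<kappa> x < n) \<longrightarrow> det (mat n n (\<lambda>(i, j). A (\<rho> i) (\<kappa> j))) = 0)"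
      (is "?L \<longleftrightarrow> ?D")
    proof
      show "?L \<Longrightarrow> ?D" using solution_imp_minors_zero[of _ n _ R A] by blast
      show "?D \<Longrightarrow> ?L" by (rule minors_zero_imp_solution) blast
    qed
    also have "\<dots> \<longleftrightarrow> (\<forall>f\<in>S. f P = 0)" unfolding S_def A_def minor_def by auto
    finally show ?thesis .
  qed
  ultimately show ?thesis by blast
qed


section \<open>Classes that are effective for every position of the points\<close>

text \<open>
  Effectivity of the class \<open>a F1 + b F2 - (sum of the m i E_i)\<close>.  A negative \<open>m i\<close> imposes no condition, as
  \<open>E_i\<close> is then a fixed component; with such classes included the Cremona transformations act on effective
  classes, and the orbit of \<open>E_i\<close> itself is available.
\<close>

definition effective_at :: "nat \<Rightarrow> (nat \<Rightarrow> ypoint) \<Rightarrow> int \<Rightarrow> int \<Rightarrow> (nat \<Rightarrow> int) \<Rightarrow> bool" where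
  "effective_at r P a b m \<longleftrightarrow> 0 \<le> a \<and> 0 \<le> b \<and> has_section r P (nat a) (nat b) (\<lambda>i. nat (m i))"

definition always_effective :: "nat \<Rightarrow> int \<Rightarrow> int \<Rightarrow> (nat \<Rightarrow> int) \<Rightarrow> bool" where
  "always_effective r a b m \<longleftrightarrow> (\<forall>P\<in>ypoints r. effective_at r P a b m)"

lemma effective_atI:
  assumes "0 \<le> a" "0 \<le> b" "biform (nat a) (nat b) f" "f q \<noteq> 0" "\<And>i. i < r \<Longrightarrow> vanish (nat (m i)) f (P i)"
  shows "effective_at r P a b m"
  unfolding effective_at_def has_section_def
  by (intro conjI assms exI[of _ f] exI[of _ q] allI impI)

lemma effective_atE:
  assumes "effective_at r P a b m"
  obtains f q where "0 \<le> a" "0 \<le> b" "biform (nat a) (nat b) f" "f q \<noteq> 0"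
    "\<forall>i<r. vanish (nat (m i)) f (P i)"
  using assms unfolding effective_at_def has_section_def by (elim conjE exE)

lemma always_effectiveD: "always_effective r a b m \<Longrightarrow> P \<in> ypoints r \<Longrightarrow> effective_at r P a b m"
  by (simp add: always_effective_def)

lemma always_effective_nonneg:
  assumes "always_effective r a b m" shows "0 \<le> a" "0 \<le> b"
proof -
  have "(\<lambda>i. ((1, 0), (1, 0))) \<in> ypoints r" by (simp add: ypoints_def)
  then show "0 \<le> a" "0 \<le> b" using assms by (auto simp: always_effective_def effective_at_def)
qed

text \<open>
  The locus where a class is effective is closed, and here it contains a nonempty open set.
\<close>

lemma effective_everywhere_of_dense:
  assumes "polyfun r g" "g P0 \<noteq> 0" and eff: "\<And>P. g P \<noteq> 0 \<Longrightarrow> effective_at r P a b m"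
  shows "effective_at r P a b m"
proof -
  obtain S where S: "\<And>f. f \<in> S \<Longrightarrow> multihomogeneous r f"
    "\<And>P. has_section r P (nat a) (nat b) (\<lambda>i. nat (m i)) \<longleftrightarrow> (\<forall>f\<in>S. f P = 0)"
    using has_section_closed[of r "nat a" "nat b" "\<lambda>i. nat (m i)"] by blast
  have "f P = 0" if f: "f \<in> S" for f
  proof (rule ccontr)
    assume "f P \<noteq> 0"
    moreover have "polyfun r f" using S(1)[OF f] by (simp add: multihomogeneous_def)
    ultimately obtain R where "f R \<noteq> 0" "g R \<noteq> 0" using polyfun_common_nonzero assms by blast
    then show False using eff[of R] S(2)[of R] f by (auto simp: effective_at_def)
  qed
  then show ?thesis using eff[OF assms(2)] S(2)[of P] by (simp add: effective_at_def)
qed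

lemma always_effective_weaken:
  assumes "always_effective r a b m" "\<And>i. i < r \<Longrightarrow> nat (m' i) \<le> nat (m i)"
  shows "always_effective r a b m'"
  unfolding always_effective_def
proof
  fix P assume "P \<in> ypoints r"
  from always_effectiveD[OF assms(1) this] show "effective_at r P a b m'"
  proof (rule effective_atE)
    fix f q assume f: "0 \<le> a" "0 \<le> b" "biform (nat a) (nat b) f" "f q \<noteq> 0"
      "\<forall>i<r. vanish (nat (m i)) f (P i)"
    show ?thesis
    proof (rule effective_atI[OF f(1-4)])
      fix i assume i: "i < r"
      show "vanish (nat (m' i)) f (P i)" by (rule vanish_mono[OF f(5)[rule_format, OF i] assms(2)[OF i]])
    qed
  qed
qed

lemma always_effective_add_point:
  assumes "always_effective r a b m"
  shows "always_effective (Suc r) a b (m(r := 0))"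
  unfolding always_effective_def
proof
  fix P assume "P \<in> ypoints (Suc r)"
  then have "P \<in> ypoints r" by (simp add: ypoints_def)
  from always_effectiveD[OF assms this] show "effective_at (Suc r) P a b (m(r := 0))"
  proof (rule effective_atE)
    fix f q assume f: "0 \<le> a" "0 \<le> b" "biform (nat a) (nat b) f" "f q \<noteq> 0"
      "\<forall>i<r. vanish (nat (m i)) f (P i)"
    have "vanish 0 f (P r)" by (rule vanish_0[OF biform_pf[OF f(3)]])
    then have "vanish (nat ((m(r := 0)) i)) f (P i)" if "i < Suc r" for i
      using f(5)[rule_format, of i] that by (cases "i = r") auto
    then show ?thesis by (rule effective_atI[OF f(1-4)])
  qed
qed

lemma always_effective_transpose:
  assumes eff: "always_effective r a b m" and "i < r" "j < r"
  shows "always_effective r a b (m(i := m j, j := m i))"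
  unfolding always_effective_def
proof
  fix P assume P: "P \<in> ypoints r"
  have "P(i := P j, j := P i) \<in> ypoints r" using P assms by (simp add: ypoints_def)
  from always_effectiveD[OF eff this] show "effective_at r P a b (m(i := m j, j := m i))"
  proof (rule effective_atE)
    fix f q assume f: "0 \<le> a" "0 \<le> b" "biform (nat a) (nat b) f" "f q \<noteq> 0"
      "\<forall>k<r. vanish (nat (m k)) f ((P(i := P j, j := P i)) k)"
    have "vanish (nat ((m(i := m j, j := m i)) k)) f (P k)" if "k < r" for k
      using f(5)[rule_format, OF that] f(5)[rule_format, OF assms(2)] f(5)[rule_format, OF assms(3)]
      by (cases "k = i"; cases "k = j") auto
    then show ?thesis by (rule effective_atI[OF f(1-4)])
  qed
qed

lemma biform_pullback:
  assumes "biform a b f" "pf u0" "pf u1" "pf v0" "pf v1"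
    and T: "T = (\<lambda>q. ((u0 q, u1 q), (v0 q, v1 q)))" and "\<And>s t q. T (rescale s t q) = rescale s t (T q)"
  shows "biform a b (\<lambda>q. f (T q))"
  unfolding biform_def
proof (intro conjI allI)
  show "pf (\<lambda>q. f (T q))" unfolding T by (rule pf_compose[OF biform_pf[OF assms(1)] assms(2-5)])
  show "f (T (rescale s t q)) = s ^ a * t ^ b * f (T q)" for s t q
    unfolding assms(7) by (rule biform_rescale[OF assms(1)])
qed

lemma effective_pullback:
  assumes eff: "effective_at r (\<lambda>i. T (P i)) a b m"
    and pf: "pf u0" "pf u1" "pf v0" "pf v1"
    and T: "T = (\<lambda>q. ((u0 q, u1 q), (v0 q, v1 q)))" and res: "\<And>s t q. T (rescale s t q) = rescale s t (T q)"
    and surj: "\<And>z. \<exists>q. T q = z"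
  shows "effective_at r P a b m"
proof -
  obtain f z where f: "0 \<le> a" "0 \<le> b" "biform (nat a) (nat b) f" "f z \<noteq> 0"
      "\<forall>i<r. vanish (nat (m i)) f (T (P i))"
    using eff by (rule effective_atE)
  obtain q where q: "T q = z" using surj[of z] by (elim exE)
  have "biform (nat a) (nat b) (\<lambda>q. f (T q))" by (rule biform_pullback[OF f(3) pf T res])
  moreover have "f (T q) \<noteq> 0" using f(4) q by simp
  moreover have "vanish (nat (m i)) (\<lambda>q. f (T q)) (P i)" if "i < r" for i
  proof (rule vanish_compose[where f = f and T = T])
    show "vanish (nat (m i)) f (T (P i))" using f(5) that by simp
    show "arc (\<lambda>t. T (\<gamma> t))" if "arc \<gamma>" for \<gamma> unfolding T by (rule arc_compose[OF that pf])
  qed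
  ultimately show ?thesis by (rule effective_atI[OF f(1,2)])
qed

lemma always_effective_swap:
  assumes "always_effective r a b m"
  shows "always_effective r b a m"
  unfolding always_effective_def
proof
  fix P assume "P \<in> ypoints r"
  then have "(\<lambda>i. (snd (P i), fst (P i))) \<in> ypoints r" by (simp add: ypoints_def)
  with assms have "effective_at r (\<lambda>i. (snd (P i), fst (P i))) a b m"
    unfolding always_effective_def by (rule bspec)
  then obtain f z where f: "0 \<le> a" "0 \<le> b" "biform (nat a) (nat b) f" "f z \<noteq> 0"
      "\<forall>i<r. vanish (nat (m i)) f (snd (P i), fst (P i))"
    by (rule effective_atE)
  let ?g = "\<lambda>q. f (snd q, fst q)"
  have eta: "?g = (\<lambda>q. f ((fst (snd q), snd (snd q)), (fst (fst q), snd (fst q))))" by simp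
  have "pf ?g" unfolding eta by (rule pf_compose[OF biform_pf[OF f(3)]]; rule pf.intros)
  moreover have "?g (rescale s t q) = s ^ nat b * t ^ nat a * ?g q" for s t q
    using biform_rescale[OF f(3), of t s "(snd q, fst q)"] by (simp add: rescale_def case_prod_beta mult.commute)
  ultimately have "biform (nat b) (nat a) ?g" unfolding biform_def by (intro conjI allI)
  moreover have "?g (snd z, fst z) \<noteq> 0" using f(4) by simp
  moreover have "vanish (nat (m i)) ?g (P i)" if "i < r" for i
  proof (rule vanish_compose[where f = f and T = "\<lambda>q. (snd q, fst q)"])
    fix \<gamma> assume "arc \<gamma>"
    then have "arc (\<lambda>t. ((fst (snd (\<gamma> t)), snd (snd (\<gamma> t))), (fst (fst (\<gamma> t)), snd (fst (\<gamma> t)))))"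
      by (rule arc_compose[where a = "\<lambda>q. fst (snd q)" and b = "\<lambda>q. snd (snd q)" and
          c = "\<lambda>q. fst (fst q)" and d = "\<lambda>q. snd (fst q)"]; intro pf.intros)
    then show "arc (\<lambda>t. (snd (\<gamma> t), fst (\<gamma> t)))" by simp
  qed (use f(5) that in simp)
  ultimately show "effective_at r P b a m" by (rule effective_atI[OF f(2,1)])
qed

lemma always_effective_exceptional:
  "i < r \<Longrightarrow> always_effective r 0 0 (\<lambda>k. if k = i then - 1 else 0)"
proof -
  assume "i < r"
  have b: "biform 0 0 (\<lambda>q. 1)" unfolding biform_def by (simp add: pf_const)
  have "vanish (nat (if k = i then - 1 else 0)) (\<lambda>q. 1) q" for k q
    using vanish_0[OF pf_const[of 1]] by (cases "k = i") simp_all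
  then have "has_section r P (nat 0) (nat 0) (\<lambda>k. nat (if k = i then - 1 else 0))" for P
    unfolding has_section_def using b by (intro exI[of _ "\<lambda>q. 1"]) simp
  then show ?thesis unfolding always_effective_def effective_at_def by simp
qed


section \<open>The elementary Cremona transformation\<close>

text \<open>
  Near \<open>([0 : 1], [0 : 1])\<close> the coordinates \<open>x0\<close> and \<open>y0\<close> are local parameters, so the order is read off
  from the exponents of the monomials.
\<close>

lemma vanish_std0_coeffs:
  assumes f: "\<And>z. f z = (\<Sum>x\<in>{..A} \<times> {..B}. c x * mon (bimon A B x) z)"
    and van: "vanish M f ((0, 1), (0, 1))" and pq: "p \<le> A" "q \<le> B" "p + q < M"
  shows "c (p, q) = 0"
proof -
  define N where "N = Suc (A + B)"
  let ?s = "((0, 1), (0, 1)) :: ypoint"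
  have T: "f (translate ?s v) = (\<Sum>d\<in>box N. (\<Sum>x\<in>{..A} \<times> {..B}. c x * hasse (bimon A B x) d ?s) * mon d v)" for v
    by (rule taylor_of_sum[OF f]) (simp add: bimon_box N_def)
  have "(\<Sum>x\<in>{..A} \<times> {..B}. c x * hasse (bimon A B x) (p, 0, q, 0) ?s) = 0"
    by (rule vanish_imp_taylor[OF T van]) (use pq in \<open>auto simp: box_def N_def total_degree_def\<close>)
  moreover have "c x * hasse (bimon A B x) (p, 0, q, 0) ?s = (if x = (p, q) then c x else 0)"
    if "x \<in> {..A} \<times> {..B}" for x
  proof (cases x)
    case (Pair p' q')
    have z: "of_nat (n choose k) * 0 ^ (n - k) = (if n = k then 1 else 0 :: complex)" for n k
      by (cases "n < k"; cases "n = k") auto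
    show ?thesis unfolding Pair hasse_def bimon_def prod.case z by simp
  qed
  ultimately show ?thesis using pq by (simp add: sum.delta cong: sum.cong)
qed

lemma vanish_std1_coeffs:
  assumes f: "\<And>z. f z = (\<Sum>x\<in>{..A} \<times> {..B}. c x * mon (bimon A B x) z)"
    and van: "vanish M f ((1, 0), (1, 0))" and pq: "p \<le> A" "q \<le> B" "(A - p) + (B - q) < M"
  shows "c (p, q) = 0"
proof -
  define N where "N = Suc (A + B)"
  let ?s = "((1, 0), (1, 0)) :: ypoint"
  have T: "f (translate ?s v) = (\<Sum>d\<in>box N. (\<Sum>x\<in>{..A} \<times> {..B}. c x * hasse (bimon A B x) d ?s) * mon d v)" for v
    by (rule taylor_of_sum[OF f]) (simp add: bimon_box N_def)
  have "(\<Sum>x\<in>{..A} \<times> {..B}. c x * hasse (bimon A B x) (0, A - p, 0, B - q) ?s) = 0"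
    by (rule vanish_imp_taylor[OF T van]) (use pq in \<open>auto simp: box_def N_def total_degree_def\<close>)
  moreover have "c x * hasse (bimon A B x) (0, A - p, 0, B - q) ?s = (if x = (p, q) then c x else 0)"
    if "x \<in> {..A} \<times> {..B}" for x
  proof (cases x)
    case (Pair p' q')
    have z: "of_nat (n choose k) * 0 ^ (n - k) = (if n = k then 1 else 0 :: complex)" for n k
      by (cases "n < k"; cases "n = k") auto
    have "A - p' = A - p \<longleftrightarrow> p' = p" "B - q' = B - q \<longleftrightarrow> q' = q" using that pq Pair by auto
    then show ?thesis unfolding Pair hasse_def bimon_def prod.case z by simp
  qed
  ultimately show ?thesis using pq by (simp add: sum.delta cong: sum.cong)
qed

lemma mon_split: "mon (i, j, k, l) = (\<lambda>z. (fst (fst z) ^ i * fst (snd z) ^ k) * (snd (fst z) ^ j * snd (snd z) ^ l))"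
  by (auto simp: mon_def fun_eq_iff)

lemma vanish_mon_std0: "vanish (i + k) (mon (i, j, k, l)) ((0, 1), (0, 1))"
proof -
  have "vanish (i + k + 0) (mon (i, j, k, l)) ((0, 1), (0, 1))"
    unfolding mon_split by (intro vanish_mult vanish_power vanish_coord vanish_0 pf_rules) auto
  then show ?thesis by simp
qed

lemma vanish_mon_std1: "vanish (j + l) (mon (i, j, k, l)) ((1, 0), (1, 0))"
proof -
  have "vanish (0 + (j + l)) (mon (i, j, k, l)) ((1, 0), (1, 0))"
    unfolding mon_split by (intro vanish_mult vanish_power vanish_coord vanish_0 pf_rules) auto
  then show ?thesis by simp
qed

text \<open>
  In the affine coordinates \<open>x = x0 / x1\<close> and \<open>y = y0 / y1\<close> this is the birational involution
  \<open>(x, y) \<mapsto> (x, x / y)\<close>, whose base points are \<open>([0 : 1], [0 : 1])\<close> and \<open>([1 : 0], [1 : 0])\<close>.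
\<close>

definition cremona_map :: "ypoint \<Rightarrow> ypoint" where
  "cremona_map z = (fst z, (fst (fst z) * snd (snd z), snd (fst z) * fst (snd z)))"

text \<open>
  The pullback of \<open>f\<close> is divisible by \<open>x0 ^ (m i)\<close> and \<open>x1 ^ (m j)\<close>, where a negative exponent means a
  multiplication instead; the quotient \<open>g\<close> has the new bidegree.  At the other points \<open>x0\<close> and \<open>x1\<close> are
  units, so there the order of \<open>g\<close> is that of the pullback; at the base points it is read off from the
  exponents.
\<close>

lemma cremona_normalized:
  assumes ij: "i < r" "j < r" "i \<noteq> j" and Qi: "Q i = ((0, 1), (0, 1))" and Qj: "Q j = ((1, 0), (1, 0))"
    and Qk: "\<And>k. k < r \<Longrightarrow> k \<noteq> i \<Longrightarrow> k \<noteq> j \<Longrightarrow> fst (fst (Q k)) \<noteq> 0 \<and> snd (fst (Q k)) \<noteq> 0"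
    and eff: "effective_at r (\<lambda>k. if k = i \<or> k = j then Q k else cremona_map (Q k)) a b m"
  shows "effective_at r Q (a + b - m i - m j) b (m(i := b - m i, j := b - m j))"
proof -
  obtain f z0 where ab: "0 \<le> a" "0 \<le> b" and f: "biform (nat a) (nat b) f" "f z0 \<noteq> 0"
      and "\<forall>k<r. vanish (nat (m k)) f (if k = i \<or> k = j then Q k else cremona_map (Q k))"
    using eff by (rule effective_atE)
  then have van: "\<And>k. k < r \<Longrightarrow> vanish (nat (m k)) f (if k = i \<or> k = j then Q k else cremona_map (Q k))" by blast
  define A where "A = nat a"
  define B where "B = nat b"
  have AB: "int A = a" "int B = b" using ab by (auto simp: A_def B_def)
  obtain c where c: "\<And>z. f z = (\<Sum>x\<in>{..A} \<times> {..B}. c x * mon (bimon A B x) z)"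
    using biform_expand[OF f(1)] unfolding A_def B_def by blast
  \<comment> \<open>The orders at the two base points bound the exponents of the monomials that occur in \<open>f\<close>.\<close>
  have supp: "m i \<le> int (p + q)" "m j \<le> int ((A - p) + (B - q))" if "p \<le> A" "q \<le> B" "c (p, q) \<noteq> 0" for p q
  proof -
    have "vanish (nat (m i)) f ((0, 1), (0, 1))" using van[OF ij(1)] Qi by simp
    from vanish_std0_coeffs[OF c this that(1,2)] have "\<not> p + q < nat (m i)" using that(3) by blast
    then show "m i \<le> int (p + q)" by linarith
    have "vanish (nat (m j)) f ((1, 0), (1, 0))" using van[OF ij(2)] Qj by simp
    from vanish_std1_coeffs[OF c this that(1,2)] have "\<not> (A - p) + (B - q) < nat (m j)" using that(3) by blast
    then show "m j \<le> int ((A - p) + (B - q))" by linarith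
  qed
  define e where "e = (\<lambda>(p, q). (nat (int (p + q) - m i), nat (int ((A - p) + (B - q)) - m j), B - q, q))"
  define g where "g = (\<lambda>z. \<Sum>x\<in>{..A} \<times> {..B}. c x * mon (e x) z)"
  have deg: "int (xdeg (e x)) = a + b - m i - m j" "ydeg (e x) = nat b"
    if "x \<in> {..A} \<times> {..B}" "c x \<noteq> 0" for x
  proof -
    obtain p q where x: "x = (p, q)" by (cases x)
    have pq: "p \<le> A" "q \<le> B" using that x by auto
    note s = supp[OF pq that(2)[unfolded x]]
    have "int (A - p) = a - int p" "int (B - q) = b - int q" using pq AB by linarith+
    then show "int (xdeg (e x)) = a + b - m i - m j" using s by (simp add: e_def x xdeg_def)
    show "ydeg (e x) = nat b" using pq by (simp add: e_def x ydeg_def B_def)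
  qed
  have "\<exists>x\<in>{..A} \<times> {..B}. c x \<noteq> 0"
  proof (rule ccontr)
    assume "\<not> ?thesis"
    then have "f z0 = 0" unfolding c by (intro sum.neutral) auto
    then show False using f(2) by simp
  qed
  then have a': "0 \<le> a + b - m i - m j" using deg(1) by (metis of_nat_0_le_iff)
  have bg: "biform (nat (a + b - m i - m j)) (nat b) g"
    unfolding g_def by (rule biform_sum_mon) (use deg in force)
  let ?u = "\<lambda>z. fst (fst z) ^ nat (m i) * snd (fst z) ^ nat (m j)"
  let ?w = "\<lambda>z. fst (fst z) ^ nat (- m i) * snd (fst z) ^ nat (- m j)"
  have gu: "g z * ?u z = f (cremona_map z) * ?w z" for z
  proof -
    obtain x0 x1 y0 y1 where z: "z = ((x0, x1), (y0, y1))" by (metis prod.exhaust)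
    have "c x * mon (e x) z * ?u z = c x * mon (bimon A B x) (cremona_map z) * ?w z"
      if "x \<in> {..A} \<times> {..B}" for x
    proof (cases "c x = 0")
      case False
      obtain p q where x: "x = (p, q)" by (cases x)
      have pq: "p \<le> A" "q \<le> B" using that x by auto
      note s = supp[OF pq False[unfolded x]]
      have 1: "nat (int (p + q) - m i) + nat (m i) = p + q + nat (- m i)" using s by linarith
      have 2: "nat (int ((A - p) + (B - q)) - m j) + nat (m j) = (A - p) + (B - q) + nat (- m j)" using s by linarith
      have "mon (e x) z * ?u z = x0 ^ (nat (int (p + q) - m i) + nat (m i)) *
          x1 ^ (nat (int ((A - p) + (B - q)) - m j) + nat (m j)) * (y0 ^ (B - q) * y1 ^ q)"
        by (simp add: mon_def e_def x z power_add mult_ac)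
      also have "\<dots> = mon (bimon A B x) (cremona_map z) * ?w z"
        unfolding 1 2 by (simp add: mon_def bimon_def x z cremona_map_def power_add power_mult_distrib mult_ac)
      finally show ?thesis by (simp add: mult.assoc)
    qed simp
    then show ?thesis unfolding g_def c sum_distrib_right by (intro sum.cong refl)
  qed
  have gnz: "\<exists>z. g z \<noteq> 0"
  proof -
    have "pf (\<lambda>z. fst (fst z) * snd (fst z))" by (intro pf.intros)
    from pf_common_nonzero[OF biform_pf[OF f(1)] this f(2), of "((1, 1), (0, 0))"]
    obtain z where z: "f z \<noteq> 0" "fst (fst z) \<noteq> 0" "snd (fst z) \<noteq> 0" by auto
    define v where "v = (fst z, (snd (snd z) / snd (fst z), fst (snd z) / fst (fst z)))"
    have "cremona_map v = z" using z by (simp add: cremona_map_def v_def prod_eq_iff)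
    then have "g v * ?u v \<noteq> 0" using gu[of v] z by (simp add: v_def)
    then have "g v \<noteq> 0" by auto
    then show ?thesis by (rule exI[of _ v])
  qed
  have vterm: "vanish n (\<lambda>z. c x * mon (e x) z) q" if "c x \<noteq> 0 \<Longrightarrow> vanish n (mon (e x)) q" for n x q
  proof (cases "c x = 0")
    case False
    then show ?thesis using vanish_mult[OF vanish_0[OF pf_const] that[OF False]] by simp
  qed (simp add: vanish_zero_fun)
  have "vanish (nat ((m(i := b - m i, j := b - m j)) k)) g (Q k)" if k: "k < r" for k
  proof -
    consider "k = i" | "k = j" | "k \<noteq> i" "k \<noteq> j" by blast
    then show ?thesis
    proof cases
      case 1
      have "vanish (nat (b - m i)) g ((0, 1), (0, 1))" unfolding g_def
      proof (intro vanish_sum vterm)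
        fix x assume x: "x \<in> {..A} \<times> {..B}" "c x \<noteq> 0"
        obtain p q where xx: "x = (p, q)" by (cases x)
        have pq: "p \<le> A" "q \<le> B" using x xx by auto
        have "nat (b - m i) \<le> nat (int (p + q) - m i) + (B - q)" using supp[OF pq x(2)[unfolded xx]] pq AB by linarith
        then show "vanish (nat (b - m i)) (mon (e x)) ((0, 1), (0, 1))"
          unfolding e_def xx prod.case by (rule vanish_mono[OF vanish_mon_std0])
      qed
      then show ?thesis using 1 ij(3) Qi by simp
    next
      case 2
      have "vanish (nat (b - m j)) g ((1, 0), (1, 0))" unfolding g_def
      proof (intro vanish_sum vterm)
        fix x assume x: "x \<in> {..A} \<times> {..B}" "c x \<noteq> 0"
        obtain p q where xx: "x = (p, q)" by (cases x)
        have pq: "p \<le> A" "q \<le> B" using x xx by auto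
        have "nat (b - m j) \<le> nat (int ((A - p) + (B - q)) - m j) + q"
          using supp[OF pq x(2)[unfolded xx]] pq AB by linarith
        then show "vanish (nat (b - m j)) (mon (e x)) ((1, 0), (1, 0))"
          unfolding e_def xx prod.case by (rule vanish_mono[OF vanish_mon_std1])
      qed
      then show ?thesis using 2 ij(3) Qj by simp
    next
      case 3
      have "vanish (nat (m k)) (\<lambda>z. f (cremona_map z)) (Q k)"
      proof (rule vanish_compose[where f = f and T = cremona_map])
        show "vanish (nat (m k)) f (cremona_map (Q k))" using van[OF k] 3 by simp
        fix \<gamma> assume "arc \<gamma>"
        then have "arc (\<lambda>t. ((fst (fst (\<gamma> t)), snd (fst (\<gamma> t))),
            (fst (fst (\<gamma> t)) * snd (snd (\<gamma> t)), snd (fst (\<gamma> t)) * fst (snd (\<gamma> t)))))"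
          by (rule arc_compose[where a = "\<lambda>q. fst (fst q)" and b = "\<lambda>q. snd (fst q)" and
              c = "\<lambda>q. fst (fst q) * snd (snd q)" and d = "\<lambda>q. snd (fst q) * fst (snd q)"]; intro pf.intros)
        then show "arc (\<lambda>t. cremona_map (\<gamma> t))" by (simp add: cremona_map_def)
      qed
      then have "vanish (nat (m k) + 0) (\<lambda>z. f (cremona_map z) * ?w z) (Q k)"
        by (intro vanish_mult vanish_0 pf_rules)
      then have "vanish (nat (m k)) (\<lambda>z. g z * ?u z) (Q k)" by (simp add: gu)
      then have "vanish (nat (m k)) g (Q k)"
        by (rule vanish_cancel[rotated -1]) (use Qk[OF k 3] biform_pf[OF bg] in \<open>auto intro!: pf_rules\<close>)
      then show ?thesis using 3 by simp
    qed
  qed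
  with gnz show ?thesis using effective_atI[OF a' ab(2) bg] by blast
qed

definition cross :: "complex \<times> complex \<Rightarrow> complex \<times> complex \<Rightarrow> complex" where
  "cross u v = fst u * snd v - snd u * fst v"

text \<open>
  A linear change of coordinates on each factor moves the points \<open>i\<close> and \<open>j\<close> to the two base points of
  \<open>cremona_map\<close>.  The transformed configuration may well be special; effectivity at all configurations
  covers it.
\<close>

lemma cremona_general_position:
  assumes ij: "i < r" "j < r" "i \<noteq> j" and eff: "always_effective r a b m"
    and X: "cross (fst (P i)) (fst (P j)) \<noteq> 0" and Y: "cross (snd (P i)) (snd (P j)) \<noteq> 0"
    and gen: "\<And>k. k < r \<Longrightarrow> k \<noteq> i \<Longrightarrow> k \<noteq> j \<Longrightarrow> cross (fst (P i)) (fst (P k)) \<noteq> 0 \<and>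
        cross (fst (P k)) (fst (P j)) \<noteq> 0 \<and> cross (snd (P i)) (snd (P k)) \<noteq> 0"
  shows "effective_at r P (a + b - m i - m j) b (m(i := b - m i, j := b - m j))"
proof -
  define u0 where "u0 = (\<lambda>z :: ypoint. cross (fst (P i)) (fst z) / cross (fst (P i)) (fst (P j)))"
  define u1 where "u1 = (\<lambda>z :: ypoint. cross (fst z) (fst (P j)) / cross (fst (P i)) (fst (P j)))"
  define v0 where "v0 = (\<lambda>z :: ypoint. cross (snd (P i)) (snd z) / cross (snd (P i)) (snd (P j)))"
  define v1 where "v1 = (\<lambda>z :: ypoint. cross (snd z) (snd (P j)) / cross (snd (P i)) (snd (P j)))"
  define T where "T = (\<lambda>z. ((u0 z, u1 z), (v0 z, v1 z)))"
  have lin: "pf (\<lambda>z. \<alpha> * fst (fst z) + \<beta> * snd (fst z))" "pf (\<lambda>z. \<alpha> * fst (snd z) + \<beta> * snd (snd z))" for \<alpha> \<beta>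
    by (intro pf.intros)+
  have lin0: "cross p w / D = (- snd p / D) * fst w + (fst p / D) * snd w" for p w :: "complex \<times> complex" and D
    by (simp add: cross_def diff_divide_distrib)
  have lin1: "cross w p / D = (snd p / D) * fst w + (- fst p / D) * snd w" for p w :: "complex \<times> complex" and D
    by (simp add: cross_def diff_divide_distrib mult.commute)
  have u0_lin: "u0 = (\<lambda>z. (- snd (fst (P i)) / cross (fst (P i)) (fst (P j))) * fst (fst z) +
      (fst (fst (P i)) / cross (fst (P i)) (fst (P j))) * snd (fst z))"
    by (simp add: u0_def lin0 diff_divide_distrib)
  have pf1: "pf u0" unfolding u0_lin by (rule lin)
  have u1_lin: "u1 = (\<lambda>z. (snd (fst (P j)) / cross (fst (P i)) (fst (P j))) * fst (fst z) +
      (- fst (fst (P j)) / cross (fst (P i)) (fst (P j))) * snd (fst z))"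
    by (simp add: u1_def lin1 diff_divide_distrib)
  have pf2: "pf u1" unfolding u1_lin by (rule lin)
  have v0_lin: "v0 = (\<lambda>z. (- snd (snd (P i)) / cross (snd (P i)) (snd (P j))) * fst (snd z) +
      (fst (snd (P i)) / cross (snd (P i)) (snd (P j))) * snd (snd z))"
    by (simp add: v0_def lin0 diff_divide_distrib)
  have pf3: "pf v0" unfolding v0_lin by (rule lin)
  have v1_lin: "v1 = (\<lambda>z. (snd (snd (P j)) / cross (snd (P i)) (snd (P j))) * fst (snd z) +
      (- fst (snd (P j)) / cross (snd (P i)) (snd (P j))) * snd (snd z))"
    by (simp add: v1_def lin1 diff_divide_distrib)
  have pf4: "pf v1" unfolding v1_lin by (rule lin)
  have res: "T (rescale s t z) = rescale s t (T z)" for s t z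
  proof -
    have "cross p (s * x, s * y) = s * cross p (x, y)" "cross (s * x, s * y) p = s * cross (x, y) p" for p s x y
      by (simp_all add: cross_def algebra_simps)
    then show ?thesis by (cases z) (simp add: T_def u0_def u1_def v0_def v1_def rescale_def case_prod_beta)
  qed
  have anti: "cross u u = 0" for u by (simp add: cross_def)
  have surj: "\<exists>q. T q = z" for z
  proof
    let ?q = "((fst (fst z) * fst (fst (P j)) + snd (fst z) * fst (fst (P i)),
        fst (fst z) * snd (fst (P j)) + snd (fst z) * snd (fst (P i))),
       (fst (snd z) * fst (snd (P j)) + snd (snd z) * fst (snd (P i)),
        fst (snd z) * snd (snd (P j)) + snd (snd z) * snd (snd (P i))))"
    show "T ?q = z"
    proof -
      have "cross (fst (P i)) (fst ?q) = fst (fst z) * cross (fst (P i)) (fst (P j))"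
        "cross (fst ?q) (fst (P j)) = snd (fst z) * cross (fst (P i)) (fst (P j))"
        "cross (snd (P i)) (snd ?q) = fst (snd z) * cross (snd (P i)) (snd (P j))"
        "cross (snd ?q) (snd (P j)) = snd (snd z) * cross (snd (P i)) (snd (P j))"
        by (simp_all add: cross_def algebra_simps)
      then show ?thesis using X Y by (simp add: T_def u0_def u1_def v0_def v1_def prod_eq_iff del: minus_mult_left)
    qed
  qed
  define Q where "Q = (\<lambda>k. T (P k))"
  have Qi: "Q i = ((0, 1), (0, 1))" using X Y by (simp add: Q_def T_def u0_def u1_def v0_def v1_def anti)
  have Qj: "Q j = ((1, 0), (1, 0))"
    using X Y by (simp add: Q_def T_def u0_def u1_def v0_def v1_def anti)
  have Qk: "fst (fst (Q k)) \<noteq> 0 \<and> snd (fst (Q k)) \<noteq> 0 \<and> fst (snd (Q k)) \<noteq> 0" if "k < r" "k \<noteq> i" "k \<noteq> j" for k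
    using gen[OF that] X Y by (simp add: Q_def T_def u0_def u1_def v0_def v1_def)
  have "(\<lambda>k. if k = i \<or> k = j then Q k else cremona_map (Q k)) \<in> ypoints r"
    unfolding ypoints_def mem_Collect_eq
  proof (intro allI impI)
    fix k assume k: "k < r"
    let ?q = "if k = i \<or> k = j then Q k else cremona_map (Q k)"
    show "fst ?q \<noteq> (0, 0) \<and> snd ?q \<noteq> (0, 0)"
    proof (cases "k = i \<or> k = j")
      case True
      then show ?thesis using Qi Qj by auto
    next
      case False
      then show ?thesis using Qk[OF k] by (auto simp: cremona_map_def prod_eq_iff)
    qed
  qed
  then have "effective_at r (\<lambda>k. if k = i \<or> k = j then Q k else cremona_map (Q k)) a b m"
    using eff by (simp add: always_effective_def)
  from cremona_normalized[OF ij Qi Qj _ this]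
  have "effective_at r (\<lambda>k. T (P k)) (a + b - m i - m j) b (m(i := b - m i, j := b - m j))"
    using Qk by (simp add: Q_def)
  then show ?thesis by (rule effective_pullback[OF _ pf1 pf2 pf3 pf4 T_def res surj])
qed

text \<open>
  The elementary transformation along the fibres of class \<open>F1\<close> through the points \<open>i\<close> and \<open>j\<close>, followed by
  the exchange of these points, is the reflection in \<open>F1 - E_i - E_j\<close>.
\<close>

lemma always_effective_cremona:
  assumes ij: "i < r" "j < r" "i \<noteq> j" and eff: "always_effective r a b m"
  shows "always_effective r (a + b - m i - m j) b (m(i := b - m i, j := b - m j))"
proof -
  define g where "g = (\<lambda>P :: nat \<Rightarrow> ypoint. cross (fst (P i)) (fst (P j)) * cross (snd (P i)) (snd (P j)) *
     (\<Prod>k\<in>{..<r} - {i, j}. cross (fst (P i)) (fst (P k)) * cross (fst (P k)) (fst (P j)) * cross (snd (P i)) (snd (P k))))"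
  have cr: "polyfun r (\<lambda>P. cross (fst (P k)) (fst (P l)))" "polyfun r (\<lambda>P. cross (snd (P k)) (snd (P l)))"
    if "k < r" "l < r" for k l
  proof -
    have e: "cross u v = fst u * snd v + (- 1) * (snd u * fst v)" for u v by (simp add: cross_def)
    show "polyfun r (\<lambda>P. cross (fst (P k)) (fst (P l)))" "polyfun r (\<lambda>P. cross (snd (P k)) (snd (P l)))"
      unfolding e by (intro polyfun.intros that)+
  qed
  have "polyfun r g" unfolding g_def
    by (intro polyfun.mult polyfun_prod cr) (use ij in auto)
  moreover have "g (\<lambda>k. ((of_nat k, 1), (of_nat k, 1))) \<noteq> 0"
    using ij by (auto simp: g_def cross_def prod_zero_iff)
  moreover have "effective_at r P (a + b - m i - m j) b (m(i := b - m i, j := b - m j))" if "g P \<noteq> 0" for P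
    by (rule cremona_general_position[OF ij eff]) (use that in \<open>auto simp: g_def prod_zero_iff\<close>)
  ultimately show ?thesis unfolding always_effective_def
    using effective_everywhere_of_dense by blast
qed


section \<open>Seshadri constants of very general points\<close>

lemma has_section_cong: "(\<And>i. i < r \<Longrightarrow> m i = m' i) \<Longrightarrow> has_section r P a b m = has_section r P a b m'"
  by (auto simp: has_section_def)

text \<open>
  For each of the countably many classes that are not effective at some configuration, the configurations
  at which the class is effective form a proper closed set.  These sets are removed.
\<close>

lemma very_general_effective:
  "very_general r (\<lambda>P. \<forall>a b m. effective_at r P a b m \<longrightarrow> always_effective r a b m)"
proof -
  define Z where "Z = (\<lambda>(a, b, ms). {P \<in> ypoints r. has_section r P a b (\<lambda>i. ms ! i)})"
  let ?F = "{Z t | t :: nat \<times> nat \<times> nat list. Z t \<noteq> ypoints r}"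
  have count: "countable ?F" by (rule countable_subset[of _ "range Z"]) auto
  have closed: "zariski_closed r (Z t)" for t
  proof -
    obtain a b ms where t: "t = (a, b, ms)" by (cases t)
    obtain S where S: "\<forall>f\<in>S. multihomogeneous r f"
      "\<forall>P. has_section r P a b (\<lambda>i. ms ! i) \<longleftrightarrow> (\<forall>f\<in>S. f P = 0)"
      using has_section_closed[of r a b "\<lambda>i. ms ! i"] by blast
    have "Z t = {P \<in> ypoints r. \<forall>f\<in>S. f P = 0}" using S(2) by (simp add: Z_def t)
    then show ?thesis using S(1) unfolding zariski_closed_def by (intro exI[of _ S] conjI)
  qed
  have always: "always_effective r a b m" if P: "P \<in> ypoints r - \<Union>?F" and eff: "effective_at r P a b m" for P a b m
  proof -
    let ?t = "(nat a, nat b, map (\<lambda>i. nat (m i)) [0..<r])"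
    have cong: "has_section r P (nat a) (nat b) (\<lambda>i. map (\<lambda>i. nat (m i)) [0..<r] ! i) =
        has_section r P (nat a) (nat b) (\<lambda>i. nat (m i))" for P
      by (rule has_section_cong) simp
    have mem: "P \<in> Z ?t \<longleftrightarrow> P \<in> ypoints r \<and> has_section r P (nat a) (nat b) (\<lambda>i. nat (m i))" for P
      unfolding Z_def prod.case mem_Collect_eq cong ..
    have ab: "0 \<le> a" "0 \<le> b" "has_section r P (nat a) (nat b) (\<lambda>i. nat (m i))"
      using eff by (simp_all add: effective_at_def)
    then have "P \<in> Z ?t" using P by (simp add: mem)
    then have "Z ?t = ypoints r" using P by blast
    then have "\<forall>P\<in>ypoints r. has_section r P (nat a) (nat b) (\<lambda>i. nat (m i))" using mem by blast
    then show ?thesis using ab by (simp add: always_effective_def effective_at_def)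
  qed
  show ?thesis unfolding very_general_def
  proof (intro exI[of _ ?F] conjI)
    show "\<forall>Z'\<in>?F. zariski_closed r Z' \<and> Z' \<noteq> ypoints r"
    proof
      fix Z' assume "Z' \<in> ?F"
      then obtain t where "Z' = Z t" "Z t \<noteq> ypoints r" by (elim CollectE exE conjE)
      then show "zariski_closed r Z' \<and> Z' \<noteq> ypoints r" using closed by simp
    qed
    show "\<forall>P\<in>ypoints r - \<Union>?F. \<forall>a b m. effective_at r P a b m \<longrightarrow> always_effective r a b m"
      by (intro ballI allI impI always)
  qed (rule count)
qed

lemma curve_effective:
  assumes "bihomogeneous a b F" "F \<noteq> 0"
  shows "effective_at r P (int a) (int b) (\<lambda>i. int (multiplicity_at F (P i)))"
proof -
  have "biform (nat (int a)) (nat (int b)) (eval4 F)" using assms by (simp add: biform_eval4_iff)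
  moreover have "eval4 F \<noteq> eval4 0" using eval4_inject assms(2) by blast
  then obtain q where "eval4 F q \<noteq> 0" by (auto simp: eval4_alt fun_eq_iff)
  moreover have "vanish (nat (int (multiplicity_at F (P i)))) (eval4 F) (P i)" for i
    using vanish_multiplicity by simp
  ultimately show ?thesis by (intro effective_atI[where f = "eval4 F" and q = q]) simp_all
qed

text \<open>
  A certificate for the Seshadri constant \<open>\<epsilon>\<close>: the first inequality on classes makes \<open>(e1, e2) - \<epsilon> E\<close> nef at
  very general points, and the class with equality excludes every larger value.
\<close>

definition seshadri_bound :: "nat \<Rightarrow> real \<Rightarrow> real \<Rightarrow> real \<Rightarrow> bool" where
  "seshadri_bound r e1 e2 \<epsilon> \<longleftrightarrow> 0 \<le> \<epsilon> \<and>
     (\<forall>a b m. always_effective r a b m \<longrightarrow> \<epsilon> * of_int (\<Sum>i<r. m i) \<le> e1 * of_int b + e2 * of_int a) \<and>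
     (\<exists>a b m. always_effective r a b m \<and> 0 < (\<Sum>i<r. m i) \<and>
        e1 * of_int b + e2 * of_int a = \<epsilon> * of_int (\<Sum>i<r. m i))"

lemma seshadri_boundD:
  assumes "seshadri_bound r e1 e2 \<epsilon>" "always_effective r a b m"
  shows "\<epsilon> * of_int (\<Sum>i<r. m i) \<le> e1 * of_int b + e2 * of_int a"
  using assms unfolding seshadri_bound_def by (elim conjE allE[of _ a] allE[of _ b] allE[of _ m] impE)

lemma seshadri_bound_swap:
  assumes "seshadri_bound r e1 e2 \<epsilon>" shows "seshadri_bound r e2 e1 \<epsilon>"
  unfolding seshadri_bound_def
proof (intro conjI allI impI)
  show "0 \<le> \<epsilon>" using assms unfolding seshadri_bound_def by (rule conjunct1)
  fix a b m assume "always_effective r a b m"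
  from seshadri_boundD[OF assms always_effective_swap[OF this]]
  show "\<epsilon> * of_int (\<Sum>i<r. m i) \<le> e2 * of_int b + e1 * of_int a" by simp
next
  from assms obtain a b m where abm: "always_effective r a b m" "0 < (\<Sum>i<r. m i)"
      "e1 * of_int b + e2 * of_int a = \<epsilon> * of_int (\<Sum>i<r. m i)"
    unfolding seshadri_bound_def by (elim conjE exE)
  show "\<exists>a b m. always_effective r a b m \<and> 0 < (\<Sum>i<r. m i) \<and>
        e2 * of_int b + e1 * of_int a = \<epsilon> * of_int (\<Sum>i<r. m i)"
    using always_effective_swap[OF abm(1)] abm(2,3)
    by (intro exI[of _ b] exI[of _ a] exI[of _ m] conjI) (simp_all only: add.commute)
qed

text \<open>
  An irreducible curve through very general points has an always effective class, so \<open>\<epsilon>\<close> is admissible.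
  For the converse, a member of the class with equality has by \<open>nef_imp_all_curves\<close> nonnegative
  intersection with \<open>(e1, e2) - \<gamma> E\<close> whenever the latter is nef, which forces \<open>\<gamma> \<le> \<epsilon>\<close>.
\<close>

lemma seshadri_eqI:
  assumes P: "P \<in> ypoints r" and gen: "\<And>a b m. effective_at r P a b m \<Longrightarrow> always_effective r a b m"
    and bound: "seshadri_bound r (of_int e1) (of_int e2) \<epsilon>"
  shows "seshadri r P e1 e2 = \<epsilon>"
proof -
  have nef_iff: "nef r P (triple (of_int e1) (of_int e2) (- \<gamma>)) \<longleftrightarrow>
      (\<forall>F a b. irreducible F \<longrightarrow> bihomogeneous a b F \<longrightarrow>
        \<gamma> * (\<Sum>i<r. real (multiplicity_at F (P i))) \<le> of_int e1 * real b + of_int e2 * real a)"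
    (is "?nef \<longleftrightarrow> ?curves") if "\<gamma> \<ge> 0" for \<gamma>
  proof -
    have exc: "intersection r (triple (of_int e1) (of_int e2) (- \<gamma>)) (0, 0, \<lambda>j. if j = i then 1 else 0) = \<gamma>"
      if "i < r" for i
    proof -
      have "(\<Sum>j<r. - \<gamma> * (if j = i then 1 else 0)) = (\<Sum>j<r. if j = i then - \<gamma> else 0)" by (intro sum.cong) auto
      also have "\<dots> = - \<gamma>" using that by (simp add: sum.delta)
      finally show ?thesis by (simp add: intersection_def triple_def)
    qed
    have str: "intersection r (triple (of_int e1) (of_int e2) (- \<gamma>)) (real a, real b, \<lambda>i. - real (multiplicity_at F (P i)))
        = of_int e1 * real b + of_int e2 * real a - \<gamma> * (\<Sum>i<r. real (multiplicity_at F (P i)))" for a b F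
      by (simp add: intersection_def triple_def sum_distrib_left)
    show ?thesis
    proof
      assume nef: ?nef
      show ?curves
      proof (intro allI impI)
        fix F a b assume F: "irreducible F" "bihomogeneous a b F"
        from nef curve_classes.strict_transform[OF this]
        have "0 \<le> intersection r (triple (of_int e1) (of_int e2) (- \<gamma>)) (real a, real b, \<lambda>i. - real (multiplicity_at F (P i)))"
          unfolding nef_def by (rule bspec)
        then show "\<gamma> * (\<Sum>i<r. real (multiplicity_at F (P i))) \<le> of_int e1 * real b + of_int e2 * real a"
          unfolding str by simp
      qed
    next
      assume curves: ?curves
      show ?nef unfolding nef_def
      proof
        fix C assume C: "C \<in> curve_classes r P"
        obtain x y z where xyz: "C = (x, y, z)" by (cases C)
        from C[unfolded xyz] show "0 \<le> intersection r (triple (of_int e1) (of_int e2) (- \<gamma>)) C"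
        proof (cases rule: curve_classes.cases)
          case (exceptional i)
          then show ?thesis using exc \<open>\<gamma> \<ge> 0\<close> by (simp add: xyz)
        next
          case (strict_transform F a b)
          from curves[rule_format, OF strict_transform(4,5)] show ?thesis
            unfolding xyz strict_transform(1-3) str by simp
        qed
      qed
    qed
  qed
  have "0 \<le> \<epsilon>" using bound unfolding seshadri_bound_def by (rule conjunct1)
  have nef: "nef r P (triple (of_int e1) (of_int e2) (- \<epsilon>))"
    unfolding nef_iff[OF \<open>0 \<le> \<epsilon>\<close>]
  proof (intro allI impI)
    fix F a b assume F: "irreducible F" "bihomogeneous a b F"
    then have "F \<noteq> 0" by (auto simp: irreducible_def)
    from seshadri_boundD[OF bound gen[OF curve_effective[OF F(2) this]]]
    show "\<epsilon> * (\<Sum>i<r. real (multiplicity_at F (P i))) \<le> of_int e1 * real b + of_int e2 * real a" by simp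
  qed
  have max: "\<gamma> \<le> \<epsilon>" if \<gamma>: "0 \<le> \<gamma>" "nef r P (triple (of_int e1) (of_int e2) (- \<gamma>))" for \<gamma>
  proof -
    from bound obtain a b m where abm: "always_effective r a b m" "0 < (\<Sum>i<r. m i)"
      "of_int e1 * of_int b + of_int e2 * of_int a = \<epsilon> * of_int (\<Sum>i<r. m i)"
      unfolding seshadri_bound_def by (elim conjE exE)
    obtain f q where f: "0 \<le> a" "0 \<le> b" "biform (nat a) (nat b) f" "f q \<noteq> 0" "\<forall>i<r. vanish (nat (m i)) f (P i)"
      using always_effectiveD[OF abm(1) P] by (rule effective_atE)
    obtain F where F: "f = eval4 F" using pf_imp_eval4[OF biform_pf[OF f(3)]] by blast
    have nz: "F \<noteq> 0"
    proof
      assume "F = 0"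
      then show False using f(4) by (simp add: F eval4_alt)
    qed
    have bi: "bihomogeneous (nat a) (nat b) F" using f(3) by (simp add: F biform_eval4_iff)
    have "m i \<le> int (multiplicity_at F (P i))" if "i < r" for i
      using vanish_imp_le_multiplicity[OF nz, of "nat (m i)" "P i"] f(5) that by (simp add: F)
    then have "(\<Sum>i<r. m i) \<le> (\<Sum>i<r. int (multiplicity_at F (P i)))" by (intro sum_mono) auto
    then have "real_of_int (\<Sum>i<r. m i) \<le> of_int (\<Sum>i<r. int (multiplicity_at F (P i)))" by (simp only: of_int_le_iff)
    then have "\<gamma> * of_int (\<Sum>i<r. m i) \<le> \<gamma> * (\<Sum>i<r. real (multiplicity_at F (P i)))"
      using \<gamma>(1) by (intro mult_left_mono) simp_all
    also have "\<dots> \<le> of_int e1 * real (nat b) + of_int e2 * real (nat a)"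
      by (rule nef_imp_all_curves[OF _ \<gamma>(1) bi nz]) (use \<gamma>(2) in \<open>simp add: nef_iff[OF \<gamma>(1)]\<close>)
    also have "\<dots> = \<epsilon> * of_int (\<Sum>i<r. m i)" using f(1,2) abm(3) by simp
    finally have le: "\<gamma> * real_of_int (\<Sum>i<r. m i) \<le> \<epsilon> * real_of_int (\<Sum>i<r. m i)" .
    have "0 < real_of_int (\<Sum>i<r. m i)" using abm(2) by (simp only: of_int_0_less_iff)
    with le show ?thesis by (rule mult_right_le_imp_le)
  qed
  show ?thesis unfolding seshadri_def
  proof (rule cSup_eq_maximum)
    show "\<epsilon> \<in> {\<gamma>. 0 \<le> \<gamma> \<and> nef r P (triple (of_int e1) (of_int e2) (- \<gamma>))}"
      using \<open>0 \<le> \<epsilon>\<close> nef by simp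
  next
    fix \<gamma> assume "\<gamma> \<in> {\<gamma>. 0 \<le> \<gamma> \<and> nef r P (triple (of_int e1) (of_int e2) (- \<gamma>))}"
    then show "\<gamma> \<le> \<epsilon>" using max by simp
  qed
qed


section \<open>Compositions of Cremona transformations\<close>

lemma always_effective_cremona_snd:
  assumes "i < r" "j < r" "i \<noteq> j" "always_effective r a b m"
  shows "always_effective r a (a + b - m i - m j) (m(i := a - m i, j := a - m j))"
  using always_effective_swap[OF always_effective_cremona[OF assms(1-3) always_effective_swap[OF assms(4)]]]
  unfolding add.commute[of b a] .

text \<open>
  Transformations along fibres of class \<open>F2\<close> at the pairs of points \<open>(0, 1), (2, 3), ...\<close> are performed one
  after another; they leave \<open>a\<close> unchanged and involve disjoint pairs.
\<close>

lemma always_effective_pairs: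
  assumes eff: "always_effective r a b m"
  shows "2 * k \<le> r \<Longrightarrow> always_effective r a (b + int k * a - (\<Sum>i<2 * k. m i)) (\<lambda>i. if i < 2 * k then a - m i else m i)"
proof (induction k)
  case 0
  then show ?case using eff by simp
next
  case (Suc k)
  let ?m = "\<lambda>i. if i < 2 * k then a - m i else m i"
  have IH: "always_effective r a (b + int k * a - (\<Sum>i<2 * k. m i)) ?m" using Suc by simp
  have new: "always_effective r a (a + (b + int k * a - (\<Sum>i<2 * k. m i)) - ?m (2 * k) - ?m (2 * k + 1))
      (?m(2 * k := a - ?m (2 * k), 2 * k + 1 := a - ?m (2 * k + 1)))"
    by (rule always_effective_cremona_snd[OF _ _ _ IH]) (use Suc.prems in auto)
  have deg: "a + (b + int k * a - (\<Sum>i<2 * k. m i)) - ?m (2 * k) - ?m (2 * k + 1) =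
      b + int (Suc k) * a - (\<Sum>i<2 * Suc k. m i)"
    by (simp add: algebra_simps)
  have mult: "?m(2 * k := a - ?m (2 * k), 2 * k + 1 := a - ?m (2 * k + 1)) =
      (\<lambda>i. if i < 2 * Suc k then a - m i else m i)"
    by (auto simp: fun_eq_iff)
  show ?case by (rule new[unfolded deg mult])
qed

lemma always_effective_all:
  assumes "always_effective (2 * k) a b m"
  shows "always_effective (2 * k) a (b + int k * a - (\<Sum>i<2 * k. m i)) (\<lambda>i. a - m i)"
  by (rule always_effective_weaken[OF always_effective_pairs[OF assms]]) auto

text \<open>
  Give another point multiplicity \<open>0\<close> and transform at both: the new coefficient \<open>a + b - m i\<close> cannot be
  negative.
\<close>

lemma multiplicity_le_degree:
  assumes "always_effective r a b m" "i < r" "2 \<le> r"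
  shows "m i \<le> a + b"
proof -
  define j where "j = (if i = 0 then 1 else 0 :: nat)"
  have j: "j < r" "i \<noteq> j" using assms by (auto simp: j_def)
  have "always_effective r a b (m(j := 0))" by (rule always_effective_weaken[OF assms(1)]) auto
  from always_effective_nonneg(1)[OF always_effective_cremona[OF assms(2) j this]] j show ?thesis by simp
qed

text \<open>
  Reflection in \<open>F1 + F2 - E_i - E_j - E_k - E_l\<close>.  This root is the sum of \<open>R = F1 - E_i - E_j\<close> and
  \<open>R' = F2 - E_k - E_l\<close> with \<open>R \<cdot> R' = 1\<close>, so its reflection is \<open>s_R s_R' s_R\<close>.  A Cremona transformation is
  such a reflection up to the exchange of its two points, whence the transposition at the end.
\<close>

lemma always_effective_reflection:
  assumes eff: "always_effective r a b m" and lt: "i < r" "j < r" "k < r" "l < r"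
    and d: "distinct [i, j, k, l]" and \<delta>: "\<delta> = m i + m j + m k + m l - a - b"
  shows "always_effective r (a - \<delta>) (b - \<delta>) (\<lambda>x. if x \<in> {i, j, k, l} then m x - \<delta> else m x)"
proof -
  have ne: "i \<noteq> j" "i \<noteq> k" "i \<noteq> l" "j \<noteq> k" "j \<noteq> l" "k \<noteq> l" using d by auto
  note 1 = always_effective_cremona[OF lt(1,2) ne(1) eff]
  note 2 = always_effective_cremona_snd[OF lt(3,4) ne(6) 1]
  note 3 = always_effective_cremona[OF lt(1,2) ne(1) 2]
  note 4 = always_effective_transpose[OF 3 lt(3,4)]
  let ?m1 = "m(i := b - m i, j := b - m j)"
  let ?a1 = "a + b - m i - m j"
  let ?m2 = "?m1(k := ?a1 - ?m1 k, l := ?a1 - ?m1 l)"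
  let ?b2 = "?a1 + b - ?m1 k - ?m1 l"
  let ?m3 = "?m2(i := ?b2 - ?m2 i, j := ?b2 - ?m2 j)"
  have deg: "?b2 = b - \<delta>" "?a1 + (b - \<delta>) - ?m2 i - ?m2 j = a - \<delta>" using ne by (simp_all add: \<delta>)
  have mult: "?m3(k := ?m3 l, l := ?m3 k) = (\<lambda>x. if x \<in> {i, j, k, l} then m x - \<delta> else m x)"
    using ne by (auto simp: fun_eq_iff \<delta>)
  show ?thesis using 4 unfolding mult unfolding deg(1) unfolding deg(2) .
qed

lemma sum_rotate: "(\<Sum>x<r. f ((x + c) mod r)) = (\<Sum>x<r. f x)" if "c < r" for f :: "nat \<Rightarrow> int"
proof (rule sum.reindex_bij_witness[where i = "\<lambda>x. (x + (r - c)) mod r" and j = "\<lambda>x. (x + c) mod r"])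
  fix x assume "x \<in> {..<r}"
  then have x: "x < r" by simp
  show "((x + c) mod r + (r - c)) mod r = x"
    unfolding mod_add_left_eq using x that by simp
  show "((x + (r - c)) mod r + c) mod r = x"
    unfolding mod_add_left_eq using x that by simp
qed (use that in auto)

text \<open>
  Blowing up the point \<open>r\<close> and contracting the two fibres through it makes this a statement on plane curves
  of degree \<open>d = a + b - m r\<close> with multiplicities \<open>m i\<close> at \<open>r\<close> points.  If three of them add up to \<open>d + \<delta>\<close> with
  \<open>\<delta> > 0\<close>, the quadratic transformation based at these points lowers the degree by \<open>\<delta>\<close> and the sum of the
  multiplicities by \<open>3 \<delta>\<close>, and \<open>r \<ge> 9\<close> turns the bound for the new curve into the bound for the old one.
  Otherwise the \<open>r\<close> triples of cyclically consecutive points have sums at most \<open>d\<close>, and each multiplicity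
  occurs in three of them.
\<close>

lemma planar_bound:
  assumes "always_effective (Suc r) a b m" "9 \<le> r"
  shows "3 * (\<Sum>i<r. m i) \<le> int r * (a + b - m r)"
  using assms(1)
proof (induction "nat (a + b - m r)" arbitrary: a b m rule: less_induct)
  case less
  define d where "d = a + b - m r"
  have d0: "0 \<le> d" using multiplicity_le_degree[OF less.prems, of r] assms(2) by (simp add: d_def)
  show ?case
  proof (cases "\<exists>i j k. i < r \<and> j < r \<and> k < r \<and> distinct [i, j, k] \<and> m i + m j + m k > d")
    case True
    then obtain i j k where ijk: "i < r" "j < r" "k < r" "distinct [i, j, k]" "m i + m j + m k > d" by blast
    define \<delta> where "\<delta> = m i + m j + m k - d"
    define m' where "m' = (\<lambda>x. if x \<in> {i, j, k, r} then m x - \<delta> else m x)"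
    have eff': "always_effective (Suc r) (a - \<delta>) (b - \<delta>) m'"
      unfolding m'_def by (rule always_effective_reflection[OF less.prems]) (use ijk in \<open>auto simp: \<delta>_def d_def\<close>)
    have d': "a - \<delta> + (b - \<delta>) - m' r = d - \<delta>" by (simp add: m'_def d_def)
    have "0 \<le> d - \<delta>" using multiplicity_le_degree[OF eff', of r] assms(2) d' by simp
    moreover have "0 < \<delta>" using ijk by (simp add: \<delta>_def)
    ultimately have "nat (a - \<delta> + (b - \<delta>) - m' r) < nat (a + b - m r)" using d' by (simp add: d_def)
    from less.hyps[OF this eff'] have IH: "3 * (\<Sum>x<r. m' x) \<le> int r * (d - \<delta>)" unfolding d' .
    have "(\<Sum>x<r. m' x) = (\<Sum>x<r. m x - (if x \<in> {i, j, k} then \<delta> else 0))"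
      by (intro sum.cong) (auto simp: m'_def)
    also have "\<dots> = (\<Sum>x<r. m x) - (\<Sum>x\<in>{i, j, k}. \<delta>)"
    proof -
      have "(\<Sum>x<r. if x \<in> {i, j, k} then \<delta> else 0) = (\<Sum>x\<in>{..<r} \<inter> {i, j, k}. \<delta>)"
        by (simp add: sum.inter_restrict del: sum_constant)
      moreover have "{..<r} \<inter> {i, j, k} = {i, j, k}" using ijk by auto
      ultimately show ?thesis by (simp add: sum_subtractf)
    qed
    also have "(\<Sum>x\<in>{i, j, k}. \<delta>) = 3 * \<delta>" using ijk by simp
    finally have "3 * (\<Sum>x<r. m x) \<le> int r * (d - \<delta>) + 9 * \<delta>" using IH by simp
    also have "\<dots> \<le> int r * (d - \<delta>) + int r * \<delta>"
      using assms(2) \<open>0 < \<delta>\<close> by (intro add_left_mono mult_right_mono) auto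
    also have "\<dots> = int r * d" by (simp add: algebra_simps)
    finally show ?thesis by (simp add: d_def)
  next
    case False
    have "m ((x + 0) mod r) + m ((x + 1) mod r) + m ((x + 2) mod r) \<le> d" if x: "x < r" for x
    proof -
      have "distinct [(x + 0) mod r, (x + 1) mod r, (x + 2) mod r]"
      proof -
        consider "x + 2 < r" | "x + 2 = r" | "x + 1 = r" using x by linarith
        then show ?thesis
        proof cases
          case 1
          then show ?thesis by simp
        next
          case 2
          then have "(x + 2) mod r = 0" by simp
          then show ?thesis using 2 assms(2) by simp
        next
          case 3
          then have "x + 2 = r + 1" by simp
          then have "(x + 2) mod r = 1" using assms(2) by (simp add: mod_Suc)
          moreover have "(x + 1) mod r = 0" using 3 by simp
          ultimately show ?thesis using 3 assms(2) by simp
        qed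
      qed
      moreover have "(x + 0) mod r < r" "(x + 1) mod r < r" "(x + 2) mod r < r" using assms(2) by auto
      ultimately have "\<not> m ((x + 0) mod r) + m ((x + 1) mod r) + m ((x + 2) mod r) > d"
        using False by blast
      then show ?thesis by simp
    qed
    then have "(\<Sum>x<r. m ((x + 0) mod r) + m ((x + 1) mod r) + m ((x + 2) mod r)) \<le> (\<Sum>x<r. d)"
      by (intro sum_mono) auto
    moreover have "(\<Sum>x<r. m ((x + 0) mod r) + m ((x + 1) mod r) + m ((x + 2) mod r)) = 3 * (\<Sum>x<r. m x)"
      unfolding sum.distrib using assms(2) by (subst (1 2 3) sum_rotate) auto
    ultimately show ?thesis by (simp add: d_def)
  qed
qed

text \<open>
  As \<open>r + 1\<close> is even, the elementary transformations can be performed at all pairs once a point of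
  multiplicity \<open>0\<close> is added.  The bounds are the nonnegativity of the degree of the resulting plane curve
  and \<open>planar_bound\<close> for it.
\<close>

lemma odd_bounds:
  assumes eff: "always_effective r a b m" and r: "odd r" "9 \<le> r"
  shows "(\<Sum>i<r. m i) \<le> b + (int r + 1) div 2 * a"
    and "(int r - 3) * (\<Sum>i<r. m i) \<le> int r * b + int r * ((int r - 5) div 2) * a"
proof -
  obtain k where k: "Suc r = 2 * k" using r(1) by (metis evenE even_Suc)
  define S where "S = (\<Sum>i<r. m i)"
  have "always_effective (2 * k) a b (m(r := 0))" using always_effective_add_point[OF eff] k by simp
  from always_effective_all[OF this]
  have "always_effective (Suc r) a (b + int k * a - (\<Sum>i<Suc r. (m(r := 0)) i)) (\<lambda>i. a - (m(r := 0)) i)" using k by simp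
  moreover have "(\<Sum>i<Suc r. (m(r := 0)) i) = S" by (simp add: S_def)
  ultimately have eff': "always_effective (Suc r) a (b + int k * a - S) (\<lambda>i. a - (m(r := 0)) i)" by simp
  have kk: "(int r + 1) div 2 = int k" "(int r - 5) div 2 = int k - 3" using k by linarith+
  have "0 \<le> b + int k * a - S" using always_effective_nonneg[OF eff'] by simp
  then show "(\<Sum>i<r. m i) \<le> b + (int r + 1) div 2 * a" unfolding kk S_def[symmetric] by simp
  have "(\<Sum>i<r. a - (m(r := 0)) i) = int r * a - S" by (simp add: S_def sum_subtractf)
  then have "3 * (int r * a - S) \<le> int r * (b + int k * a - S)" using planar_bound[OF eff' r(2)] by simp
  then show "(int r - 3) * (\<Sum>i<r. m i) \<le> int r * b + int r * ((int r - 5) div 2) * a"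
    unfolding kk S_def[symmetric] by (simp add: algebra_simps)
qed

lemma always_effective_ruling:
  assumes "i < r" "2 \<le> r"
  shows "always_effective r 1 0 (\<lambda>k. if k = i then 1 else 0)"
proof -
  define j where "j = (if i = 0 then 1 else 0 :: nat)"
  have j: "j < r" "i \<noteq> j" using assms by (auto simp: j_def)
  from always_effective_cremona[OF assms(1) j always_effective_exceptional[OF assms(1)]]
  have "always_effective r 1 0 ((\<lambda>k. if k = i then - 1 else 0)(i := 1, j := 0))" using j by simp
  moreover have "((\<lambda>k. if k = i then - 1 else 0)(i := 1, j := 0)) = (\<lambda>k. if k = i then 1 else 0 :: int)"
    using j by (auto simp: fun_eq_iff)
  ultimately show ?thesis by simp
qed

text \<open>
  The fibre of class \<open>F1 - E_(r-1)\<close> transformed at the pairs formed by the remaining \<open>r - 1\<close> points.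
\<close>

lemma always_effective_odd_curve:
  assumes r: "odd r" "2 \<le> r"
  shows "always_effective r 1 ((int r - 1) div 2) (\<lambda>i. 1)"
proof -
  obtain k where k: "r = 2 * k + 1" using r(1) by (auto elim: oddE)
  have "always_effective r 1 (0 + int k * 1 - (\<Sum>i<2 * k. if i = r - 1 then 1 else 0))
     (\<lambda>i. if i < 2 * k then 1 - (if i = r - 1 then 1 else 0) else if i = r - 1 then 1 else 0)"
    by (rule always_effective_pairs[OF always_effective_ruling[of "r - 1"]]) (use k r in auto)
  moreover have "(\<Sum>i<2 * k. if i = r - 1 then 1 else 0 :: int) = 0" using k by (intro sum.neutral) auto
  moreover have "int k = (int r - 1) div 2" using k by simp
  ultimately have "always_effective r 1 ((int r - 1) div 2)
     (\<lambda>i. if i < 2 * k then 1 - (if i = r - 1 then 1 else 0) else if i = r - 1 then 1 else 0)" by simp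
  then show ?thesis by (rule always_effective_weaken) (use k in auto)
qed


section \<open>The numerical sequences\<close>

definition lam :: "nat \<Rightarrow> real" where "lam r = sqrt (alpha r)"

text \<open>
  The quantum integer \<open>[n]\<close> at the parameter \<open>lam r\<close>; \<open>qint2\<close> is \<open>[2]\<close>.  The square of
  \<open>[2]\<close> is \<open>r / 2\<close>, and \<open>p_seq\<close> and \<open>m_seq\<close> are quadratic in these numbers.
\<close>

definition qint :: "nat \<Rightarrow> int \<Rightarrow> real" where
  "qint r n = (lam r powi n - lam r powi (- n)) / (lam r - 1 / lam r)"

definition qint2 :: "nat \<Rightarrow> real" where "qint2 r = lam r + 1 / lam r"

context
  fixes r :: nat
  assumes r: "9 \<le> r"
begin

lemma alpha_gt_1: "1 < alpha r"
proof -
  have "0 < sqrt (real r * (real r - 8))" using r by simp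
  then have "(real r - 4) / 4 < alpha r" by (simp add: alpha_def field_simps)
  moreover have "1 < (real r - 4) / 4" using r by simp
  ultimately show ?thesis by (rule less_trans[rotated])
qed

lemma lam_gt_1: "1 < lam r" using alpha_gt_1 by (simp add: lam_def)

lemma lam_sq: "lam r * lam r = alpha r" using alpha_gt_1 by (simp add: lam_def)

lemma alpha_inverse: "alpha r + 1 / alpha r = (real r - 4) / 2"
  using alpha_beta_roots(1)[of r] r alpha_gt_1 by (simp add: field_simps power2_eq_square)

lemma beta_eq: "beta r = 1 / alpha r"
proof -
  have "beta r = (real r - 4) / 2 - alpha r" by (simp add: alpha_def beta_def field_simps)
  then show ?thesis using alpha_inverse by linarith
qed

lemma qint2_sq: "qint2 r * qint2 r = real r / 2"
proof -
  have "qint2 r * qint2 r = lam r * lam r + 1 / (lam r * lam r) + 2"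
    using lam_gt_1 by (simp add: qint2_def field_simps)
  then show ?thesis using alpha_inverse unfolding lam_sq by (simp add: field_simps)
qed

lemma qint2_pos: "0 < qint2 r" using lam_gt_1 by (simp add: qint2_def add_pos_pos)

lemma lam_denominator: "0 < lam r - 1 / lam r"
  using lam_gt_1 by (simp add: field_simps) (metis less_1_mult)

lemma qint_0: "qint r 0 = 0" and qint_1: "qint r 1 = 1"
  using lam_denominator lam_gt_1 by (simp_all add: qint_def power_int_minus field_simps)

lemma qint_minus: "qint r (- n) = - qint r n"
  by (simp add: qint_def minus_divide_left)

lemma lam_powi:
  "lam r powi (n + 1) = lam r powi n * lam r" "lam r powi (- (n + 1)) = 1 / (lam r powi n * lam r)"
  "lam r powi (n - 1) = lam r powi n / lam r" "lam r powi (- (n - 1)) = lam r / lam r powi n"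
  "lam r powi (- n) = 1 / lam r powi n"
  using lam_gt_1 by (simp_all add: power_int_add power_int_diff power_int_minus field_simps)

lemma qint_step: "qint r (n + 1) = qint2 r * qint r n - qint r (n - 1)"
proof -
  let ?l = "lam r" and ?a = "lam r powi n"
  have a: "?a \<noteq> 0" "?l \<noteq> 0" using lam_gt_1 by auto
  have "?a * ?l - 1 / (?a * ?l) = (?l + 1 / ?l) * (?a - 1 / ?a) - (?a / ?l - ?l / ?a)"
    using a by (simp add: field_simps)
  then show ?thesis unfolding qint_def qint2_def lam_powi
    by (simp add: diff_divide_distrib[symmetric])
qed

lemma qint_quad: "qint r n * qint r n - qint r (n + 1) * qint r (n - 1) = 1"
proof -
  let ?l = "lam r" and ?a = "lam r powi n"
  have a: "?a \<noteq> 0" "?l \<noteq> 0" using lam_gt_1 by auto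
  let ?D = "?l - 1 / ?l"
  have D: "?D \<noteq> 0" using lam_denominator by simp
  have "(?a - 1 / ?a) * (?a - 1 / ?a) - (?a * ?l - 1 / (?a * ?l)) * (?a / ?l - ?l / ?a) = ?D * ?D"
    using a by (simp add: field_simps)
  then show ?thesis unfolding qint_def lam_powi using D
    by (simp add: diff_divide_distrib[symmetric])
qed

lemma qint2_gt_2: "2 < qint2 r"
proof (rule ccontr)
  assume "\<not> ?thesis"
  then have "qint2 r * qint2 r \<le> 2 * 2" using qint2_pos by (intro mult_mono) auto
  then show False using qint2_sq r by simp
qed

lemma qint_less: "0 \<le> n \<Longrightarrow> 0 \<le> qint r n \<and> qint r n < qint r (n + 1)"
proof (induction n rule: int_ge_induct)
  case base
  show ?case by (simp add: qint_0 qint_1)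
next
  case (step n)
  have "qint r (n + 1 + 1) = qint2 r * qint r (n + 1) - qint r n" using qint_step[of "n + 1"] by simp
  moreover have "qint2 r * qint r (n + 1) > 2 * qint r (n + 1)" using qint2_gt_2 step by (intro mult_strict_right_mono) auto
  ultimately show ?case using step by linarith
qed

lemma qint_ge_1: "1 \<le> n \<Longrightarrow> 1 \<le> qint r n"
proof (induction n rule: int_ge_induct)
  case base show ?case by (simp add: qint_1)
next
  case (step n)
  then show ?case using qint_less[of n] by linarith
qed

lemma qint_sq_ge_1: "n \<noteq> 0 \<Longrightarrow> 1 \<le> qint r n * qint r n"
proof -
  assume "n \<noteq> 0"
  then consider "1 \<le> n" | "1 \<le> - n" by linarith
  then show ?thesis
  proof cases
    case 1 then show ?thesis using qint_ge_1[OF 1] by (metis mult_mono mult_1 zero_le_one order.trans)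
  next
    case 2
    then have "1 * 1 \<le> qint r (- n) * qint r (- n)" using qint_ge_1[OF 2] by (intro mult_mono) auto
    then show ?thesis by (simp add: qint_minus)
  qed
qed

lemma qint_product_nonneg: "0 \<le> qint r n * qint r (n + 1)"
proof (cases "0 \<le> n")
  case True
  then show ?thesis using qint_less[of n] by (intro mult_nonneg_nonneg) auto
next
  case False
  then have "0 \<le> - (n + 1)" by linarith
  then have "0 \<le> qint r (- (n + 1))" "0 \<le> qint r (- n)" using qint_less[of "- (n + 1)"] by auto
  then have "0 \<le> (- qint r (n + 1)) * (- qint r n)" unfolding qint_minus by (rule mult_nonneg_nonneg)
  then show ?thesis by (simp add: mult.commute)
qed

text \<open>
  The recursion determines its values to the right of \<open>1\<close> by itself and to the left of \<open>- 1\<close> when solved for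
  its last term.
\<close>

lemma recursion_unique:
  fixes s t :: "int \<Rightarrow> real"
  assumes s: "\<And>n. s n = c * (s (n - 1) - s (n - 2)) + s (n - 3)"
    and t: "\<And>n. t n = c * (t (n - 1) - t (n - 2)) + t (n - 3)"
    and init: "s (- 1) = t (- 1)" "s 0 = t 0" "s 1 = t 1"
  shows "s n = t n"
proof -
  have up: "s n = t n \<and> s (n - 1) = t (n - 1) \<and> s (n - 2) = t (n - 2)" if "1 \<le> n" for n
    using that
  proof (induction n rule: int_ge_induct)
    case base show ?case using init by simp
  next
    case (step n)
    have "s (n + 1) = t (n + 1)" using s[of "n + 1"] t[of "n + 1"] step by (simp add: algebra_simps)
    then show ?case using step by (simp add: algebra_simps)
  qed
  have down: "s n = t n \<and> s (n + 1) = t (n + 1) \<and> s (n + 2) = t (n + 2)" if "n \<le> - 1" for n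
    using that
  proof (induction n rule: int_le_induct)
    case base show ?case using init by simp
  next
    case (step n)
    have "s (n - 1) = t (n - 1)" using s[of "n + 2"] t[of "n + 2"] step by (simp add: algebra_simps)
    then show ?case using step by (simp add: algebra_simps)
  qed
  consider "1 \<le> n" | "n = 0" | "n \<le> - 1" by linarith
  then show ?thesis using up[of n] down[of n] init(2) by cases auto
qed

text \<open>
  Products of two solutions of \<open>qint_step\<close> satisfy the third order recursion, whose characteristic roots
  are \<open>alpha r\<close>, \<open>1\<close> and \<open>1 / alpha r\<close>.
\<close>

lemma p_seq_eq: "p_seq r n = real r * (qint r n * qint r (n + 1)) / qint2 r"
proof (rule recursion_unique[where c = "(real r - 2) / 2" and s = "p_seq r" and
      t = "\<lambda>n. real r * (qint r n * qint r (n + 1)) / qint2 r"])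
  show "p_seq r n = (real r - 2) / 2 * (p_seq r (n - 1) - p_seq r (n - 2)) + p_seq r (n - 3)" for n
    unfolding p_seq_def by (rule rec_seq_recursion)
  show "real r * (qint r n * qint r (n + 1)) / qint2 r = (real r - 2) / 2 * (real r * (qint r (n - 1) * qint r (n - 1 + 1)) / qint2 r -
      real r * (qint r (n - 2) * qint r (n - 2 + 1)) / qint2 r) + real r * (qint r (n - 3) * qint r (n - 3 + 1)) / qint2 r" for n
  proof -
    define u v s where "u = qint r (n - 3)" and "v = qint r (n - 2)" and "s = qint2 r"
    have w: "qint r (n - 1) = s * v - u" using qint_step[of "n - 2"] by (simp add: u_def v_def s_def)
    have x: "qint r n = s * (s * v - u) - v" using qint_step[of "n - 1"] w by (simp add: u_def v_def s_def)
    have y: "qint r (n + 1) = s * (s * (s * v - u) - v) - (s * v - u)" using qint_step[of n] w x by (simp add: s_def)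
    have c: "(real r - 2) / 2 = s * s - 1" using qint2_sq by (simp add: s_def)
    have i: "n - 1 + 1 = n" "n - 2 + 1 = n - 1" "n - 3 + 1 = n - 2" by auto
    have "qint r n * qint r (n + 1) = (s * s - 1) * (qint r (n - 1) * qint r n - qint r (n - 2) * qint r (n - 1)) + qint r (n - 3) * qint r (n - 2)"
      unfolding w x y u_def[symmetric] v_def[symmetric] by (simp add: algebra_simps)
    then show ?thesis unfolding i c s_def[symmetric]
      by (simp only:) (simp add: algebra_simps add_divide_distrib diff_divide_distrib)
  qed
qed (use qint2_pos qint2_sq in \<open>simp_all add: p_seq_def rec_seq_initial qint_0 qint_1 qint_minus qint_step[of 1, simplified] field_simps\<close>)

lemma m_seq_eq: "m_seq r n = 2 * (qint r n * qint r n) - 1"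
proof (rule recursion_unique[where c = "(real r - 2) / 2" and s = "m_seq r" and
      t = "\<lambda>n. 2 * (qint r n * qint r n) - 1"])
  show "m_seq r n = (real r - 2) / 2 * (m_seq r (n - 1) - m_seq r (n - 2)) + m_seq r (n - 3)" for n
    unfolding m_seq_def by (rule rec_seq_recursion)
  show "2 * (qint r n * qint r n) - 1 = (real r - 2) / 2 * (2 * (qint r (n - 1) * qint r (n - 1)) - 1 -
      (2 * (qint r (n - 2) * qint r (n - 2)) - 1)) + (2 * (qint r (n - 3) * qint r (n - 3)) - 1)" for n
  proof -
    define u v s where "u = qint r (n - 3)" and "v = qint r (n - 2)" and "s = qint2 r"
    have w: "qint r (n - 1) = s * v - u" using qint_step[of "n - 2"] by (simp add: u_def v_def s_def)
    have x: "qint r n = s * (s * v - u) - v" using qint_step[of "n - 1"] w by (simp add: u_def v_def s_def)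
    have c: "(real r - 2) / 2 = s * s - 1" using qint2_sq by (simp add: s_def)
    show ?thesis unfolding c w x u_def[symmetric] v_def[symmetric] by (simp add: algebra_simps)
  qed
qed (simp_all add: m_seq_def rec_seq_initial qint_0 qint_1 qint_minus)


section \<open>The even case: an infinite dihedral group of Cremona transformations\<close>

text \<open>
  The intersection number of \<open>[n-1]^2 F1 + [n]^2 F2 - ([n-1] [n] / [2]) E\<close> with a class of coefficients \<open>a\<close>
  and \<open>b\<close> and sum of multiplicities \<open>S\<close>.  The first of these isotropic classes, for \<open>n = 0\<close> and \<open>n = 1\<close>, are the
  rulings \<open>F1\<close> and \<open>F2\<close>; the others are images of them under the group generated by the exchange of the
  rulings and the transformation at all pairs of points.
\<close>

definition pencil :: "int \<Rightarrow> real \<Rightarrow> real \<Rightarrow> real \<Rightarrow> real" where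
  "pencil n a b S = qint r (n - 1) * qint r (n - 1) * b + qint r n * qint r n * a - qint r n * qint r (n - 1) / qint2 r * S"

lemma pencil_swap: "pencil (1 - n) b a S = pencil n a b S"
proof -
  have "qint r (1 - n) = - qint r (n - 1)" "qint r (1 - n - 1) = - qint r n"
    using qint_minus[of "n - 1"] qint_minus[of n] by simp_all
  then show ?thesis by (simp add: pencil_def mult_ac)
qed

lemma pencil_cremona:
  "pencil (2 - n) a (b + qint2 r * qint2 r * a - S) (2 * (qint2 r * qint2 r) * a - S) = pencil n a b S"
proof -
  define u v s where "u = qint r (n - 1)" and "v = qint r n" and "s = qint2 r"
  have s: "s \<noteq> 0" using qint2_pos by (simp add: s_def)
  have "qint r (n - 2) = s * u - v" using qint_step[of "n - 1"] by (simp add: u_def v_def s_def)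
  then have 1: "qint r (2 - n) = - (s * u - v)" using qint_minus[of "n - 2"] by simp
  have 2: "qint r (2 - n - 1) = - u" using qint_minus[of "n - 1"] by (simp add: u_def)
  show ?thesis unfolding pencil_def 1 2 u_def[symmetric] v_def[symmetric] s_def[symmetric]
    using s by (simp add: field_simps)
qed

context
  assumes even: "even r"
begin

lemma always_effective_even:
  assumes "always_effective r a b m"
  shows "\<exists>b' m'. always_effective r a b' m' \<and> real_of_int b' = of_int b + qint2 r * qint2 r * of_int a - of_int (\<Sum>i<r. m i) \<and>
     real_of_int (\<Sum>i<r. m' i) = 2 * (qint2 r * qint2 r) * of_int a - of_int (\<Sum>i<r. m i)"
proof -
  obtain k where k: "r = 2 * k" using even by blast
  have rk: "real r = 2 * real k" using k by simp
  show ?thesis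
  proof (intro exI conjI)
    show "always_effective r a (b + int k * a - (\<Sum>i<r. m i)) (\<lambda>i. a - m i)"
      using always_effective_all[of k a b m] assms k by simp
  qed (simp_all add: qint2_sq rk sum_subtractf)
qed

text \<open>
  For \<open>n = 0\<close> this is \<open>b \<ge> 0\<close>.  Both generators of the group preserve effectivity and reflect the index, by
  \<open>n \<mapsto> 1 - n\<close> and \<open>n \<mapsto> 2 - n\<close>, so together they reach every \<open>n\<close>.
\<close>

lemma pencil_nonneg:
  assumes "always_effective r a b m"
  shows "0 \<le> pencil n (of_int a) (of_int b) (of_int (\<Sum>i<r. m i))"
proof -
  have nonneg: "\<forall>a b m. always_effective r a b m \<longrightarrow> 0 \<le> pencil n (of_int a) (of_int b) (of_int (\<Sum>i<r. m i))"
    if "0 \<le> n" for n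
    using that
  proof (induction n rule: int_ge_induct)
    case base
    show ?case using always_effective_nonneg by (simp add: pencil_def qint_0 qint_1 qint_minus)
  next
    case (step n)
    show ?case
    proof (intro allI impI)
      fix a b m assume "always_effective r a b m"
      then obtain b' m' where b': "always_effective r a b' m'"
          "real_of_int b' = of_int b + qint2 r * qint2 r * of_int a - of_int (\<Sum>i<r. m i)"
          "real_of_int (\<Sum>i<r. m' i) = 2 * (qint2 r * qint2 r) * of_int a - of_int (\<Sum>i<r. m i)"
        using always_effective_even by blast
      have "0 \<le> pencil n (of_int b') (of_int a) (of_int (\<Sum>i<r. m' i))"
        using step always_effective_swap[OF b'(1)] by blast
      also have "\<dots> = pencil (1 - n) (of_int a) (of_int b') (of_int (\<Sum>i<r. m' i))" by (rule pencil_swap[symmetric])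
      also have "\<dots> = pencil (n + 1) (of_int a) (of_int b) (of_int (\<Sum>i<r. m i))"
        unfolding b'(2,3) using pencil_cremona[of "n + 1"] by simp
      finally show "0 \<le> pencil (n + 1) (of_int a) (of_int b) (of_int (\<Sum>i<r. m i))" .
    qed
  qed
  show ?thesis
  proof (cases "0 \<le> n")
    case False
    then have "0 \<le> pencil (1 - n) (of_int b) (of_int a) (of_int (\<Sum>i<r. m i))"
      using nonneg[of "1 - n"] always_effective_swap[OF assms] by simp
    then show ?thesis by (simp only: pencil_swap)
  qed (use nonneg assms in blast)
qed

text \<open>
  The orbit of an exceptional curve \<open>E_0\<close>, which is the case \<open>n = 0\<close>, under the same group.
\<close>

lemma exceptional_orbit:
  "\<exists>a b m. always_effective r a b m \<and> real_of_int a = qint r n * qint r (n - 1) / qint2 r \<and>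
     real_of_int b = qint r n * qint r (n + 1) / qint2 r \<and> real_of_int (\<Sum>i<r. m i) = 2 * (qint r n * qint r n) - 1"
proof -
  have nonneg: "\<exists>a b m. always_effective r a b m \<and> real_of_int a = qint r n * qint r (n - 1) / qint2 r \<and>
     real_of_int b = qint r n * qint r (n + 1) / qint2 r \<and> real_of_int (\<Sum>i<r. m i) = 2 * (qint r n * qint r n) - 1"
    if "0 \<le> n" for n
    using that
  proof (induction n rule: int_ge_induct)
    case base
    have "(\<Sum>i<r. if i = 0 then - 1 else 0 :: int) = - 1" using r by (simp add: sum.delta)
    then show ?case using always_effective_exceptional[of 0 r] r
      by (intro exI[of _ 0] exI[of _ "\<lambda>i. if i = 0 then - 1 else 0"]) (simp add: qint_0)
  next
    case (step n)
    then obtain a b m where abm: "always_effective r a b m" "real_of_int a = qint r n * qint r (n - 1) / qint2 r"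
        "real_of_int b = qint r n * qint r (n + 1) / qint2 r" "real_of_int (\<Sum>i<r. m i) = 2 * (qint r n * qint r n) - 1" by blast
    obtain a' m' where a': "always_effective r b a' m'"
          "real_of_int a' = of_int a + qint2 r * qint2 r * of_int b - of_int (\<Sum>i<r. m i)"
          "real_of_int (\<Sum>i<r. m' i) = 2 * (qint2 r * qint2 r) * of_int b - of_int (\<Sum>i<r. m i)"
      using always_effective_even[OF always_effective_swap[OF abm(1)]] by blast
    define v w s where "v = qint r n" and "w = qint r (n + 1)" and "s = qint2 r"
    have s: "s \<noteq> 0" using qint2_pos by (simp add: s_def)
    have u: "qint r (n - 1) = s * v - w" using qint_step[of n] by (simp add: v_def w_def s_def)
    have x: "qint r (n + 1 + 1) = s * w - v" using qint_step[of "n + 1"] by (simp add: v_def w_def s_def)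
    have q: "v * v + w * w = 1 + s * (v * w)" using qint_quad[of n] u by (simp add: v_def w_def algebra_simps)
    have "real_of_int a' = v * (s * v - w) / s + s * (v * w) - (2 * (v * v) - 1)"
      using a'(2) abm(2-4) s unfolding u v_def[symmetric] w_def[symmetric] s_def[symmetric] by simp
    also have "\<dots> = - (v * w) / s + (1 + s * (v * w)) - v * v" using s by (simp add: field_simps)
    also have "\<dots> = w * (s * w - v) / s" unfolding q[symmetric] using s by (simp add: field_simps)
    finally have "real_of_int a' = w * (s * w - v) / s" .
    moreover have "real_of_int (\<Sum>i<r. m' i) = 2 * (w * w) - 1"
    proof -
      have "real_of_int (\<Sum>i<r. m' i) = 2 * (s * (v * w)) - (2 * (v * v) - 1)"
        using a'(3) abm(3,4) s unfolding v_def[symmetric] w_def[symmetric] s_def[symmetric] by simp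
      then show ?thesis using q by linarith
    qed
    moreover have "n + 1 - 1 = n" by simp
    ultimately show ?case using a'(1) abm(3) unfolding x
      by (intro exI[of _ b] exI[of _ a'] exI[of _ m']) (simp add: v_def w_def s_def mult.commute)
  qed
  show ?thesis
  proof (cases "0 \<le> n")
    case False
    then obtain a b m where "always_effective r a b m" "real_of_int a = qint r (- n) * qint r (- n - 1) / qint2 r"
        "real_of_int b = qint r (- n) * qint r (- n + 1) / qint2 r" "real_of_int (\<Sum>i<r. m i) = 2 * (qint r (- n) * qint r (- n)) - 1"
      using nonneg[of "- n"] by auto
    moreover have "qint r (- n - 1) = - qint r (n + 1)" "qint r (- n + 1) = - qint r (n - 1)"
      using qint_minus[of "n + 1"] qint_minus[of "n - 1"] by simp_all
    ultimately show ?thesis using always_effective_swap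
      by (intro exI[of _ b] exI[of _ a] exI[of _ m]) (simp add: qint_minus)
  qed (rule nonneg)
qed

text \<open>
  With \<open>\<epsilon>\<close> as stated, \<open>(e1, e2) - \<epsilon> E\<close> is orthogonal to the \<open>n\<close>-th class of \<open>exceptional_orbit\<close>.  It is a
  combination of the isotropic classes with indices \<open>n\<close> and \<open>n + 1\<close>, with coefficients proportional to
  \<open>e2 [n]^2 - e1 [n+1]^2\<close> and \<open>e1 [n]^2 - e2 [n-1]^2\<close>; so the two hypotheses make it nef.
\<close>

lemma seshadri_bound_even:
  assumes e: "0 < e1" "0 < e2" and n: "n \<noteq> 0"
    and x: "e1 * (qint r (n + 1) * qint r (n + 1)) \<le> e2 * (qint r n * qint r n)"
    and y: "e2 * (qint r (n - 1) * qint r (n - 1)) \<le> e1 * (qint r n * qint r n)"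
  shows "seshadri_bound r e1 e2 ((e1 * p_seq r n + e2 * p_seq r (n - 1)) / (real r * m_seq r n))"
proof -
  define u v w s M where "u = qint r (n - 1)" and "v = qint r n" and "w = qint r (n + 1)" and "s = qint2 r" and "M = 2 * (v * v) - 1"
  have s: "0 < s" using qint2_pos by (simp add: s_def)
  have M: "1 \<le> M" using qint_sq_ge_1[OF n] by (simp add: M_def v_def)
  have q: "v * v - w * u = 1" using qint_quad[of n] by (simp add: u_def v_def w_def)
  define \<epsilon> where "\<epsilon> = v * (e1 * w + e2 * u) / (s * M)"
  have eq: "(e1 * p_seq r n + e2 * p_seq r (n - 1)) / (real r * m_seq r n) = \<epsilon>"
  proof -
    have i: "n - 1 + 1 = n" by simp
    show ?thesis using r s M
      unfolding p_seq_eq m_seq_eq i \<epsilon>_def u_def[symmetric] v_def[symmetric] w_def[symmetric] s_def[symmetric] M_def[symmetric]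
      by (simp add: field_simps)
  qed
  have "0 \<le> v * w" "0 \<le> v * u" using qint_product_nonneg[of n] qint_product_nonneg[of "n - 1"]
    by (simp_all add: u_def v_def w_def mult.commute)
  then have "0 \<le> e1 * (v * w) + e2 * (v * u)" using e by simp
  then have "0 \<le> \<epsilon>" using s M unfolding \<epsilon>_def by (intro divide_nonneg_pos) (simp_all add: algebra_simps)
  moreover have "\<epsilon> * of_int (\<Sum>i<r. m i) \<le> e1 * of_int b + e2 * of_int a" if eff: "always_effective r a b m" for a b m
  proof -
    define S A B where "S = real_of_int (\<Sum>i<r. m i)" and "A = real_of_int a" and "B = real_of_int b"
    have 1: "0 \<le> u * u * B + v * v * A - v * u / s * S"
      using pencil_nonneg[OF eff, of n] by (simp add: pencil_def S_def A_def B_def u_def v_def s_def)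
    have 2: "0 \<le> v * v * B + w * w * A - w * v / s * S"
      using pencil_nonneg[OF eff, of "n + 1"] by (simp add: pencil_def S_def A_def B_def w_def v_def s_def)
    \<comment> \<open>Up to the factor \<open>M\<close> this is \<open>(e1, e2) - \<epsilon> E\<close> written in terms of the two pencils.\<close>
    have "0 \<le> (e2 * (v * v) - e1 * (w * w)) * (u * u * B + v * v * A - v * u / s * S) +
        (e1 * (v * v) - e2 * (u * u)) * (v * v * B + w * w * A - w * v / s * S)"
      using 1 2 x y by (intro add_nonneg_nonneg mult_nonneg_nonneg) (simp_all add: u_def v_def w_def)
    also have "\<dots> = ((v * v) * (v * v) - (w * u) * (w * u)) * (e1 * B + e2 * A) -
        (v * v - w * u) * (v * (e1 * w + e2 * u)) / s * S"
      using s by (simp add: field_simps)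
    also have "w * u = v * v - 1" using q by linarith
    also have "((v * v) * (v * v) - (v * v - 1) * (v * v - 1)) = M" by (simp add: M_def algebra_simps)
    finally have "v * (e1 * w + e2 * u) / s * S \<le> M * (e1 * B + e2 * A)" by simp
    then have "\<epsilon> * S \<le> e1 * B + e2 * A" using s M by (simp add: \<epsilon>_def field_simps)
    then show ?thesis by (simp add: S_def A_def B_def)
  qed
  moreover have "\<exists>a b m. always_effective r a b m \<and> 0 < (\<Sum>i<r. m i) \<and>
        e1 * of_int b + e2 * of_int a = \<epsilon> * of_int (\<Sum>i<r. m i)"
  proof -
    obtain a b m where abm: "always_effective r a b m" "real_of_int a = v * u / s" "real_of_int b = v * w / s"
        "real_of_int (\<Sum>i<r. m i) = M"
      using exceptional_orbit[of n] unfolding u_def[symmetric] v_def[symmetric] w_def[symmetric] s_def[symmetric] M_def[symmetric]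
      by blast
    have "0 < real_of_int (\<Sum>i<r. m i)" using abm(4) M by linarith
    then have "0 < (\<Sum>i<r. m i)" by (simp only: of_int_0_less_iff)
    moreover have "e1 * of_int b + e2 * of_int a = \<epsilon> * of_int (\<Sum>i<r. m i)"
      unfolding abm(2-4) \<epsilon>_def using s M by (simp add: field_simps)
    ultimately show ?thesis using abm(1) by blast
  qed
  ultimately show ?thesis unfolding eq seshadri_bound_def by blast
qed

end

section \<open>The function \<open>\<phi>\<close>\<close>

text \<open>
  As \<open>alpha r + 1 = lam r * qint2 r\<close>, both intersection numbers in the definition of \<open>phi\<close> are perfect squares
  up to the factor \<open>alpha r + 1\<close>.
\<close>

lemma phi_v_L:
  assumes e: "1 \<le> e1" "1 \<le> e2"
  defines "a \<equiv> sqrt (real_of_int e1)" and "b \<equiv> sqrt (real_of_int e2)"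
  shows "phi r (v_L r e1 e2) = ln (((lam r * b - a) / (b - lam r * a))\<^sup>2) / (4 * ln (lam r))"
proof -
  have ab: "a * a = of_int e1" "b * b = of_int e2" using e by (simp_all add: a_def b_def)
  have eta: "eta r e1 e2 = a * b / qint2 r"
  proof -
    have "sqrt (real r / 2) = qint2 r" using qint2_sq qint2_pos by (metis abs_of_pos real_sqrt_mult_self real_sqrt_mult)
    moreover have "2 * real_of_int e1 * real_of_int e2 / real r = real_of_int e1 * real_of_int e2 / (real r / 2)" by simp
    ultimately show ?thesis unfolding eta_def a_def b_def by (simp only: real_sqrt_divide real_sqrt_mult)
  qed
  have al: "alpha r + 1 = lam r * qint2 r"
    using lam_sq lam_gt_1 by (simp add: qint2_def field_simps)
  have pos: "0 < lam r" "0 < qint2 r" using lam_gt_1 qint2_pos by simp_all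
  define D where "D = alpha r + 1"
  have D: "0 < D" "0 < real r" using alpha_gt_1 r by (simp_all add: D_def)
  have eta': "eta r e1 e2 = a * b * lam r / D" using pos by (simp add: eta D_def al)
  have "intersection r (v_L r e1 e2) (v_beta r) = (lam r * b - a)\<^sup>2 / D"
    unfolding v_L_def v_beta_def intersection_triple eta' D_def[symmetric]
    unfolding ab[symmetric] lam_sq[symmetric]
    using D by (simp add: field_simps power2_eq_square)
  moreover have "intersection r (v_L r e1 e2) (v_alpha r) = (b - lam r * a)\<^sup>2 / D"
    unfolding v_L_def v_alpha_def intersection_triple eta' D_def[symmetric]
    unfolding ab[symmetric] lam_sq[symmetric]
    using D by (simp add: field_simps power2_eq_square)
  ultimately have "intersection r (v_L r e1 e2) (v_beta r) / intersection r (v_L r e1 e2) (v_alpha r) =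
      ((lam r * b - a) / (b - lam r * a))\<^sup>2"
    using D by (simp add: power_divide)
  moreover have "ln (alpha r) = 2 * ln (lam r)" using pos by (simp add: lam_sq[symmetric] ln_mult)
  ultimately show ?thesis by (simp add: phi_def)
qed

text \<open>
  After exponentiation the two bounds compare a quotient with odd powers of \<open>lam r\<close>; division by
  \<open>lam r powi n\<close> makes both sides symmetric and turns them into quantum integers.
\<close>

lemma chamber_inequalities:
  fixes a b :: real
  assumes ab: "0 < a" "lam r * a < b"
    and lo: "(2 * of_int n - 1) * ln (lam r) \<le> ln ((lam r * b - a) / (b - lam r * a))"
    and hi: "ln ((lam r * b - a) / (b - lam r * a)) \<le> (2 * of_int n + 1) * ln (lam r)"
  shows "1 \<le> n" "a * qint r (n + 1) \<le> b * qint r n" "b * qint r (n - 1) \<le> a * qint r n"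
proof -
  let ?l = "lam r" and ?c = "lam r powi n" and ?w = "(lam r * b - a) / (b - lam r * a)"
  have l: "1 < ?l" "0 < ?l" "0 < ln ?l" using lam_gt_1 by auto
  have den: "0 < b - ?l * a" using ab by simp
  have "?l * (b - ?l * a) < ?l * b - a"
  proof -
    have "1 * a < ?l * ?l * a" using l ab by (intro mult_strict_right_mono) (auto intro: less_1_mult)
    then show ?thesis by (simp add: algebra_simps)
  qed
  then have wl: "?l < ?w" using den by (simp add: field_simps)
  then have "ln ?l < ln ?w" using l by (subst ln_less_cancel_iff) auto
  then have "1 * ln ?l < (2 * of_int n + 1) * ln ?l" using hi by simp
  then have "1 < 2 * real_of_int n + 1" using l(3) by (rule mult_right_less_imp_less[OF _ less_imp_le])
  then show n: "1 \<le> n" by simp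
  have w0: "0 < ?w" using wl l by linarith
  have c: "0 < ?c" using l by simp
  have lnp: "ln (?l powi k) = of_int k * ln ?l" for k :: int
  proof -
    have "?l powr of_int k = ?l powi k" using l by (intro powr_real_of_int') auto
    then show ?thesis using l ln_powr[of ?l "of_int k"] by simp
  qed
  have "ln (?l powi (2 * n - 1)) \<le> ln ?w" using lo by (simp add: lnp)
  then have 1: "?l powi (2 * n - 1) \<le> ?w" using w0 l by (subst (asm) ln_le_cancel_iff) auto
  have "ln ?w \<le> ln (?l powi (2 * n + 1))" using hi by (simp add: lnp)
  then have 2: "?w \<le> ?l powi (2 * n + 1)" using w0 l by (subst (asm) ln_le_cancel_iff) auto
  have pw: "?l powi (2 * n - 1) = ?c * ?c / ?l" "?l powi (2 * n + 1) = ?c * ?c * ?l"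
  proof -
    have l0: "?l \<noteq> 0" using l by simp
    have e: "2 * n - 1 = (n + n) - 1" "2 * n + 1 = (n + n) + 1" by simp_all
    show "?l powi (2 * n - 1) = ?c * ?c / ?l" "?l powi (2 * n + 1) = ?c * ?c * ?l"
      unfolding e by (simp_all only: power_int_diff[OF disjI1[OF l0]] power_int_add[OF disjI1[OF l0]] power_int_1_right)
  qed
  have cancel: "0 \<le> u" if "0 \<le> u * v" "0 < v" for u v :: real using that by (simp add: zero_le_mult_iff)
  have 3: "b * (?c / ?l - ?l / ?c) \<le> a * (?c - 1 / ?c)"
  proof -
    have "?c * ?c / ?l * (b - ?l * a) \<le> ?l * b - a" using 1 den unfolding pw by (simp add: pos_le_divide_eq)
    moreover have "(a * (?c - 1 / ?c) - b * (?c / ?l - ?l / ?c)) * ?c = (?l * b - a) - ?c * ?c / ?l * (b - ?l * a)"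
      using c l by (simp add: field_simps)
    ultimately have "0 \<le> (a * (?c - 1 / ?c) - b * (?c / ?l - ?l / ?c)) * ?c" by simp
    from cancel[OF this c] show ?thesis by simp
  qed
  have 4: "a * (?c * ?l - 1 / (?c * ?l)) \<le> b * (?c - 1 / ?c)"
  proof -
    have "?l * b - a \<le> ?c * ?c * ?l * (b - ?l * a)" using 2 den unfolding pw by (simp add: pos_divide_le_eq)
    moreover have "(b * (?c - 1 / ?c) - a * (?c * ?l - 1 / (?c * ?l))) * (?c * ?l) = ?c * ?c * ?l * (b - ?l * a) - (?l * b - a)"
      using c l by (simp add: field_simps)
    ultimately have "0 \<le> (b * (?c - 1 / ?c) - a * (?c * ?l - 1 / (?c * ?l))) * (?c * ?l)" by simp
    from cancel[OF this mult_pos_pos[OF c l(2)]] show ?thesis by simp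
  qed
  have D: "0 < ?l - 1 / ?l" by (rule lam_denominator)
  show "a * qint r (n + 1) \<le> b * qint r n" unfolding qint_def lam_powi using divide_right_mono[OF 4, of "?l - 1 / ?l"] D by simp
  show "b * qint r (n - 1) \<le> a * qint r n" unfolding qint_def lam_powi using divide_right_mono[OF 3, of "?l - 1 / ?l"] D by simp
qed

lemma chamber_of_phi:
  assumes e: "1 \<le> e1" "1 \<le> e2" and out: "real_of_int e2 / real_of_int e1 \<notin> {beta r .. alpha r}"
    and n: "n = \<lfloor>phi r (v_L r e1 e2) + 1 / 2\<rfloor>"
  shows "n \<noteq> 0" "real_of_int e1 * (qint r (n + 1) * qint r (n + 1)) \<le> real_of_int e2 * (qint r n * qint r n)"
    "real_of_int e2 * (qint r (n - 1) * qint r (n - 1)) \<le> real_of_int e1 * (qint r n * qint r n)"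
proof -
  define a b where "a = sqrt (real_of_int e1)" and "b = sqrt (real_of_int e2)"
  have ab: "0 < a" "0 < b" "a * a = of_int e1" "b * b = of_int e2" using e by (simp_all add: a_def b_def)
  have l: "1 < lam r" "0 < ln (lam r)" using lam_gt_1 by auto
  have sq: "x * x * (y * y) \<le> z * z * (t * t)" if "x * y \<le> z * t" "0 \<le> x * y" for x y z t :: real
    using mult_mono[OF that(1,1)] that by (simp add: mult_ac)
  define w where "w = (lam r * b - a) / (b - lam r * a)"
  have phi: "phi r (v_L r e1 e2) = ln (w\<^sup>2) / (4 * ln (lam r))"
    using phi_v_L[OF e] by (simp add: w_def a_def b_def)
  have bounds: "(2 * of_int n - 1) * ln (lam r) \<le> ln w" "ln w \<le> (2 * of_int n + 1) * ln (lam r)" if "0 < w"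
  proof -
    have "phi r (v_L r e1 e2) = ln w / (2 * ln (lam r))" using that by (simp add: phi ln_realpow)
    moreover have "of_int n \<le> phi r (v_L r e1 e2) + 1 / 2" "phi r (v_L r e1 e2) + 1 / 2 < of_int n + 1"
      unfolding n by linarith+
    ultimately have "2 * of_int n - 1 \<le> ln w / ln (lam r)" "ln w / ln (lam r) \<le> 2 * of_int n + 1"
      by simp_all
    then show "(2 * of_int n - 1) * ln (lam r) \<le> ln w" "ln w \<le> (2 * of_int n + 1) * ln (lam r)"
      using l(2) by (simp_all only: pos_le_divide_eq pos_divide_le_eq)
  qed
  have "real_of_int e2 / real_of_int e1 < beta r \<or> alpha r < real_of_int e2 / real_of_int e1" using out by auto
  then have "n \<noteq> 0 \<and> real_of_int e1 * (qint r (n + 1) * qint r (n + 1)) \<le> real_of_int e2 * (qint r n * qint r n) \<and>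
    real_of_int e2 * (qint r (n - 1) * qint r (n - 1)) \<le> real_of_int e1 * (qint r n * qint r n)"
  proof
    assume "alpha r < real_of_int e2 / real_of_int e1"
    then have "alpha r * real_of_int e1 < real_of_int e2" using e by (simp add: field_simps)
    moreover have "(lam r * a) * (lam r * a) = (lam r * lam r) * (a * a)" by simp
    ultimately have "(lam r * a) * (lam r * a) < b * b" unfolding lam_sq ab by simp
    then have lt: "lam r * a < b" using ab by (metis mult_mono not_less less_eq_real_def mult_pos_pos l(1) less_trans zero_less_one)
    then have "0 < w"
    proof -
      have "a < lam r * a" "b < lam r * b" using l ab by simp_all
      then show ?thesis using lt unfolding w_def by (intro divide_pos_pos) linarith+
    qed
    from chamber_inequalities[OF ab(1) lt bounds[OF this, unfolded w_def]]
    have *: "1 \<le> n" "a * qint r (n + 1) \<le> b * qint r n" "b * qint r (n - 1) \<le> a * qint r n" by auto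
    have "0 \<le> qint r (n + 1)" "0 \<le> qint r (n - 1)" using qint_less[of "n + 1"] qint_less[of "n - 1"] *(1) by auto
    then show ?thesis using *(1) sq[OF *(2)] sq[OF *(3)] ab by simp
  next
    \<comment> \<open>Exchanging \<open>e1\<close> and \<open>e2\<close> inverts \<open>w\<close> and replaces \<open>n\<close> by \<open>- n\<close>.\<close>
    assume "real_of_int e2 / real_of_int e1 < beta r"
    then have "alpha r * real_of_int e2 < real_of_int e1" using e alpha_gt_1 by (simp add: beta_eq field_simps)
    moreover have "(lam r * b) * (lam r * b) = (lam r * lam r) * (b * b)" by simp
    ultimately have "(lam r * b) * (lam r * b) < a * a" unfolding lam_sq ab by simp
    then have lt: "lam r * b < a" using ab by (metis mult_mono not_less less_eq_real_def mult_pos_pos l(1) less_trans zero_less_one)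
    have "a < lam r * a" "b < lam r * b" using l ab by simp_all
    then have neg: "lam r * b - a < 0" "b - lam r * a < 0" using lt by linarith+
    then have w: "0 < w" unfolding w_def by (rule divide_neg_neg)
    have inv: "(lam r * a - b) / (a - lam r * b) = inverse w" using neg by (simp add: w_def field_simps)
    have "ln ((lam r * a - b) / (a - lam r * b)) = - ln w" unfolding inv using w by (simp add: ln_inverse)
    then have "(2 * of_int (- n) - 1) * ln (lam r) \<le> ln ((lam r * a - b) / (a - lam r * b))"
      "ln ((lam r * a - b) / (a - lam r * b)) \<le> (2 * of_int (- n) + 1) * ln (lam r)"
      using bounds[OF w] by (simp_all add: algebra_simps)
    from chamber_inequalities[OF ab(2) lt this]
    have *: "1 \<le> - n" "b * qint r (- n + 1) \<le> a * qint r (- n)" "a * qint r (- n - 1) \<le> b * qint r (- n)" by auto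
    have "0 \<le> qint r (- n + 1)" "0 \<le> qint r (- n - 1)" using qint_less[of "- n + 1"] qint_less[of "- n - 1"] *(1) by auto
    then have "b * b * (qint r (- n + 1) * qint r (- n + 1)) \<le> a * a * (qint r (- n) * qint r (- n))"
      "a * a * (qint r (- n - 1) * qint r (- n - 1)) \<le> b * b * (qint r (- n) * qint r (- n))"
      using sq[OF *(2)] sq[OF *(3)] ab by simp_all
    moreover have "qint r (- n - 1) = - qint r (n + 1)" "qint r (- n + 1) = - qint r (n - 1)"
      using qint_minus[of "n + 1"] qint_minus[of "n - 1"] by simp_all
    ultimately show ?thesis using *(1) ab by (simp add: qint_minus)
  qed
  then show "n \<noteq> 0" "real_of_int e1 * (qint r (n + 1) * qint r (n + 1)) \<le> real_of_int e2 * (qint r n * qint r n)"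
    "real_of_int e2 * (qint r (n - 1) * qint r (n - 1)) \<le> real_of_int e1 * (qint r n * qint r n)" by auto
qed


section \<open>The odd case\<close>

context
  assumes odd: "odd r"
begin

text \<open>
  Nonnegativity of \<open>F1 + ((r + 1) / 2) F2 - E\<close> and \<open>r F1 + (r (r - 5) / 2) F2 - (r - 3) E\<close> on always
  effective classes.
\<close>

lemma always_effective_odd_bounds:
  assumes eff: "always_effective r a b m"
  defines "S \<equiv> real_of_int (\<Sum>i<r. m i)"
  shows "S \<le> of_int b + (real r + 1) / 2 * of_int a"
    and "(real r - 3) * S \<le> real r * of_int b + real r * ((real r - 5) / 2) * of_int a"
proof -
  obtain k where k: "r = 2 * k + 1" using odd by (auto elim: oddE)
  have 1: "real_of_int ((int r + 1) div 2) = (real r + 1) / 2" "real_of_int ((int r - 5) div 2) = (real r - 5) / 2"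
    using k by (simp_all add: field_simps)
  have "real_of_int (\<Sum>i<r. m i) \<le> of_int (b + (int r + 1) div 2 * a)"
    using odd_bounds(1)[OF eff odd r] by (simp only: of_int_le_iff)
  then show "S \<le> of_int b + (real r + 1) / 2 * of_int a" unfolding S_def of_int_add of_int_mult 1 .
  have "real_of_int ((int r - 3) * (\<Sum>i<r. m i)) \<le> of_int (int r * b + int r * ((int r - 5) div 2) * a)"
    using odd_bounds(2)[OF eff odd r] by (simp only: of_int_le_iff)
  then show "(real r - 3) * S \<le> real r * of_int b + real r * ((real r - 5) / 2) * of_int a"
    unfolding S_def of_int_add of_int_mult 1 of_int_diff by simp
qed

text \<open>
  Here \<open>(e1, e2) - e1 E\<close> is \<open>e1\<close> times the first class of \<open>always_effective_odd_bounds\<close> plus a nonnegative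
  multiple of \<open>F2\<close>, and it is orthogonal to the curve of class \<open>F2 - E_0\<close>.
\<close>

lemma seshadri_bound_ruling:
  assumes e: "0 < e1" "0 < e2" and ratio: "(real r + 1) / 2 \<le> e2 / e1"
  shows "seshadri_bound r e1 e2 e1"
proof -
  have x: "0 \<le> e2 - e1 * ((real r + 1) / 2)" using ratio e by (simp add: field_simps)
  have "e1 * of_int (\<Sum>i<r. m i) \<le> e1 * of_int b + e2 * of_int a" if eff: "always_effective r a b m" for a b m
  proof -
    have "e1 * of_int (\<Sum>i<r. m i) \<le> e1 * (of_int b + (real r + 1) / 2 * of_int a)"
      using always_effective_odd_bounds(1)[OF eff] e by (intro mult_left_mono) auto
    also have "\<dots> \<le> e1 * (of_int b + (real r + 1) / 2 * of_int a) + (e2 - e1 * ((real r + 1) / 2)) * of_int a"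
      using x always_effective_nonneg(1)[OF eff] by simp
    also have "\<dots> = e1 * of_int b + e2 * of_int a" by (simp add: algebra_simps)
    finally show ?thesis .
  qed
  moreover have "always_effective r 0 1 (\<lambda>k. if k = 0 then 1 else 0)"
    by (rule always_effective_swap[OF always_effective_ruling]) (use r in auto)
  moreover have "(\<Sum>k<r. if k = 0 then 1 else 0 :: int) = 1" using r by (simp add: sum.delta)
  ultimately show ?thesis using e unfolding seshadri_bound_def
    by (intro conjI exI[of _ 0] exI[of _ 1] exI[of _ "\<lambda>k. if k = 0 then 1 else 0"]) auto
qed

text \<open>
  The second class of \<open>always_effective_odd_bounds\<close> has slope \<open>(r - 5) / 2\<close>, and the first has slope
  \<open>(r + 1) / 2\<close>; so every slope from \<open>alpha r\<close> to \<open>(r + 1) / 2\<close> lies between them.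
\<close>

lemma alpha_ge: "(real r - 5) / 2 \<le> alpha r"
proof -
  have "(real r - 6)\<^sup>2 \<le> real r * (real r - 8)" using r by (simp add: power2_eq_square algebra_simps)
  then have "real r - 6 \<le> sqrt (real r * (real r - 8))" by (rule real_le_rsqrt)
  then show ?thesis by (simp add: alpha_def field_simps)
qed

text \<open>
  Here \<open>(e1, e2) - \<epsilon> E\<close> is the combination of the two classes of \<open>always_effective_odd_bounds\<close> with
  coefficients \<open>x\<close> and \<open>y\<close>.  Both classes are orthogonal to \<open>F1 + ((r - 1) / 2) F2 - E\<close>, the class of a section
  through all the points.
\<close>

lemma seshadri_bound_section:
  assumes e: "0 < e1" "0 < e2" and ratio: "alpha r \<le> e2 / e1" "e2 / e1 \<le> (real r + 1) / 2"
  shows "seshadri_bound r e1 e2 (((real r - 1) * e1 + 2 * e2) / (2 * real r))"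
proof -
  let ?\<epsilon> = "((real r - 1) * e1 + 2 * e2) / (2 * real r)"
  define x y where "x = (e2 - e1 * ((real r - 5) / 2)) / 3" and "y = (e1 * ((real r + 1) / 2) - e2) / (3 * real r)"
  have "(real r - 5) / 2 \<le> e2 / e1" using alpha_ge ratio(1) by linarith
  then have x: "0 \<le> x" using e by (simp add: x_def field_simps)
  have y: "0 \<le> y" using ratio(2) e r by (simp add: y_def field_simps)
  have r0: "0 < real r" using r by simp
  have 1: "x + y * real r = e1" "x * ((real r + 1) / 2) + y * real r * ((real r - 5) / 2) = e2"
    "x + y * (real r - 3) = ?\<epsilon>"
    using r0 by (simp_all add: x_def y_def field_simps)
  have "?\<epsilon> * of_int (\<Sum>i<r. m i) \<le> e1 * of_int b + e2 * of_int a" if eff: "always_effective r a b m" for a b m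
  proof -
    have "x * of_int (\<Sum>i<r. m i) + y * ((real r - 3) * of_int (\<Sum>i<r. m i)) \<le>
      x * (of_int b + (real r + 1) / 2 * of_int a) + y * (real r * of_int b + real r * ((real r - 5) / 2) * of_int a)"
      using always_effective_odd_bounds[OF eff] x y by (intro add_mono mult_left_mono) auto
    also have "\<dots> = (x + y * real r) * of_int b + (x * ((real r + 1) / 2) + y * real r * ((real r - 5) / 2)) * of_int a"
      by (simp add: algebra_simps)
    also have "\<dots> = e1 * of_int b + e2 * of_int a" unfolding 1 ..
    also have "x * of_int (\<Sum>i<r. m i) + y * ((real r - 3) * of_int (\<Sum>i<r. m i)) = (x + y * (real r - 3)) * of_int (\<Sum>i<r. m i)"
      by (simp add: algebra_simps)
    finally show ?thesis unfolding 1 .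
  qed
  moreover have "e1 * of_int ((int r - 1) div 2) + e2 * of_int 1 = ?\<epsilon> * of_int (\<Sum>i<r. 1)"
  proof -
    obtain k where k: "r = 2 * k + 1" using odd by (auto elim: oddE)
    have "real_of_int ((int r - 1) div 2) = (real r - 1) / 2" using k by simp
    then show ?thesis using r0 by (simp only:) (simp add: field_simps)
  qed
  moreover have "0 \<le> ?\<epsilon>" using e r by simp
  moreover have "always_effective r 1 ((int r - 1) div 2) (\<lambda>i. 1)" by (rule always_effective_odd_curve[OF odd]) (use r in simp)
  ultimately show ?thesis using r unfolding seshadri_bound_def
    by (intro conjI exI[of _ 1] exI[of _ "(int r - 1) div 2"] exI[of _ "\<lambda>i. 1"]) auto
qed

end
end

theorem theorem1p10:
  fixes r :: nat
  assumes "r \<ge> 9"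
  shows "very_general r (\<lambda>P. \<forall>e1 e2 :: int.
    e1 \<ge> 1 \<longrightarrow> e2 \<ge> 1 \<longrightarrow> real_of_int e2 / real_of_int e1 \<notin> {beta r .. alpha r} \<longrightarrow>
      (odd r \<longrightarrow>
        (real_of_int e2 / real_of_int e1 \<le> 2 / (real r + 1) \<longrightarrow>
           seshadri r P e1 e2 = real_of_int e2) \<and>
        (real_of_int e2 / real_of_int e1 \<in> {2 / (real r + 1) .. beta r} \<longrightarrow>
           seshadri r P e1 e2 =
             (2 * real_of_int e1 + (real r - 1) * real_of_int e2) / (2 * real r)) \<and>
        (real_of_int e2 / real_of_int e1 \<in> {alpha r .. (real r + 1) / 2} \<longrightarrow>
           seshadri r P e1 e2 =
             ((real r - 1) * real_of_int e1 + 2 * real_of_int e2) / (2 * real r)) \<and>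
        ((real r + 1) / 2 \<le> real_of_int e2 / real_of_int e1 \<longrightarrow>
           seshadri r P e1 e2 = real_of_int e1)) \<and>
      (even r \<longrightarrow>
        (let n = \<lfloor>phi r (v_L r e1 e2) + 1 / 2\<rfloor> in
           seshadri r P e1 e2 =
             (real_of_int e1 * p_seq r n + real_of_int e2 * p_seq r (n - 1)) /
             (real r * m_seq r n))))"
  (is "very_general r ?Q" is "very_general r (\<lambda>P. \<forall>e1 e2. _ \<longrightarrow> _ \<longrightarrow> _ \<longrightarrow> ?claim P e1 e2)")
proof -
  have Q: "?Q P" if P: "P \<in> ypoints r" and gen: "\<And>a b m. effective_at r P a b m \<Longrightarrow> always_effective r a b m" for P
  proof (intro allI impI)
    fix e1 e2 :: int
    assume e: "e1 \<ge> 1" "e2 \<ge> 1" and out: "real_of_int e2 / real_of_int e1 \<notin> {beta r .. alpha r}"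
    define x y where "x = real_of_int e1" and "y = real_of_int e2"
    have xy: "0 < x" "0 < y" using e by (simp_all add: x_def y_def)
    have seshadri: "seshadri r P e1 e2 = \<epsilon>" if "seshadri_bound r x y \<epsilon>" for \<epsilon>
      using seshadri_eqI[OF P gen] that by (simp add: x_def y_def)
    have r1: "0 < real r + 1" by simp
    have A: "seshadri r P e1 e2 = y" if "odd r" "y / x \<le> 2 / (real r + 1)"
    proof -
      have "(real r + 1) / 2 \<le> x / y" using that(2) xy r1 by (simp add: field_simps)
      then show ?thesis by (rule seshadri[OF seshadri_bound_swap[OF seshadri_bound_ruling[OF assms that(1) xy(2,1)]]])
    qed
    have B: "seshadri r P e1 e2 = (2 * x + (real r - 1) * y) / (2 * real r)"
      if "odd r" "2 / (real r + 1) \<le> y / x" "y / x \<le> beta r"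
    proof -
      have "x / y \<le> (real r + 1) / 2" using that(2) xy r1 by (simp add: field_simps)
      moreover have "alpha r \<le> x / y" using that(3) xy alpha_gt_1[OF assms] by (simp add: beta_eq[OF assms] field_simps)
      ultimately have "seshadri_bound r x y (((real r - 1) * y + 2 * x) / (2 * real r))"
        by (intro seshadri_bound_swap[OF seshadri_bound_section[OF assms that(1) xy(2,1)]])
      then show ?thesis unfolding add.commute[of "2 * x"] by (rule seshadri)
    qed
    have C: "seshadri r P e1 e2 = ((real r - 1) * x + 2 * y) / (2 * real r)"
      if "odd r" "alpha r \<le> y / x" "y / x \<le> (real r + 1) / 2"
      by (rule seshadri[OF seshadri_bound_section[OF assms that(1) xy that(2,3)]])
    have D: "seshadri r P e1 e2 = x" if "odd r" "(real r + 1) / 2 \<le> y / x"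
      by (rule seshadri[OF seshadri_bound_ruling[OF assms that(1) xy that(2)]])
    have E: "seshadri r P e1 e2 = (x * p_seq r n + y * p_seq r (n - 1)) / (real r * m_seq r n)"
      if "even r" "n = \<lfloor>phi r (v_L r e1 e2) + 1 / 2\<rfloor>" for n
      by (rule seshadri[OF seshadri_bound_even[OF assms that(1) xy]])
        (use chamber_of_phi[OF assms e out that(2)] in \<open>simp_all add: x_def y_def\<close>)
    show "?claim P e1 e2"
      unfolding Let_def x_def[symmetric] y_def[symmetric] atLeastAtMost_iff
      by (intro conjI impI A B C D E[OF _ refl]; (elim conjE)?; assumption)
  qed
  from very_general_effective[of r] obtain \<Z> where
    Z: "countable \<Z>" "\<forall>Z\<in>\<Z>. zariski_closed r Z \<and> Z \<noteq> ypoints r"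
    and gen: "\<forall>P\<in>ypoints r - \<Union>\<Z>. \<forall>a b m. effective_at r P a b m \<longrightarrow> always_effective r a b m"
    unfolding very_general_def by (elim exE conjE)
  show ?thesis unfolding very_general_def
  proof (intro exI[of _ \<Z>] conjI Z ballI)
    fix P assume P: "P \<in> ypoints r - \<Union>\<Z>"
    show "?Q P" by (rule Q) (use P gen in blast)+
  qed
qed

end
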